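(* Let $n\ge 2$, $1<p<+\infty$, let $\Omega\subset\mathbb{R}^n$ be a $C^1$ domain (bounded or unbounded), let $f\in C^1(\mathbb{R})$ and let $\kappa> 0$ be a constant (i.e. $\kappa\ge 0$ and $\kappa\neq 0$). Let $u$ be a bounded $C^3$ solution of \[ \begin{cases} \mathrm{div}\left(|\nabla u|^{p-2}\nabla u\right)+f(u)=0 & \text{in } \Omega,\\ u>0 & \text{in } \Omega,\\ u=0 & \text{on } \partial\Omega,\\ \partial_\nu u=-\kappa & \text{on } \partial\Omega, \end{cases} \] where $\nu$ is the exterior unit normal to $\partial\Omega$. Suppose there exists a primitive $F\in C^2(\mathbb{R})$ of $f$ (i.e. $F'=f$) with $F\le 0$ on $\mathbb{R}$ and \[ F(0)\ge -\frac{p-1}{p}\kappa^p . \] If $p>2$, assume in addition that for every $u_0\in\mathbb{R}$ with $F(u_0)=0$ one has $F(s)=O(|s-u_0|^p)$ as $s\to u_0$. Then either $\Omega$ is a half-space and $u$ is parallel, or $H(q)<0$ for every $q\in\partial\Omega$, where $H(q)$ denotes the mean curvature of $\partial\Omega$ at $q$.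
   Context: A solution $u$ is called parallel (one-dimensional) if there exist $x_0,a\in\mathbb{R}^n$ and a function $g:[0,+\infty)\to\mathbb{R}$ such that $\Omega=\{x\in\mathbb{R}^n: a\cdot(x-x_0)>0\}$ and $u(x)=g(a\cdot(x-x_0))$ for all $x$ in this half-space. The mean curvature $H$ of $\partial\Omega$ is taken with the sign convention for which, with $\nu$ the exterior unit normal, $\partial^2_{\nu\nu}u=\Delta u-(n-1)H\,\partial_\nu u$ on $\partial\Omega$ for functions vanishing on $\partial\Omega$ (so that the boundary sphere of a ball has positive mean curvature). *)

theory Defs
  imports "HOL-Analysis.Analysis" "HOL-Library.Landau_Symbols"
begin

definition partial :: "'n::finite \<Rightarrow> (real^'n \<Rightarrow> real) \<Rightarrow> real^'n \<Rightarrow> real" where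
  "partial i f x = deriv (\<lambda>t. f (x + t *\<^sub>R axis i 1)) 0"

primrec Dp :: "'n::finite list \<Rightarrow> (real^'n \<Rightarrow> real) \<Rightarrow> real^'n \<Rightarrow> real" where
  "Dp [] f = f"
| "Dp (i # is) f = partial i (Dp is f)"

definition grad :: "(real^'n::finite \<Rightarrow> real) \<Rightarrow> real^'n \<Rightarrow> real^'n" where
  "grad f x = (\<chi> i. partial i f x)"

definition divg :: "(real^'n::finite \<Rightarrow> real^'n) \<Rightarrow> real^'n \<Rightarrow> real" where
  "divg V x = (\<Sum>i\<in>UNIV. partial i (\<lambda>y. V y $ i) x)"

definition Ck_on :: "nat \<Rightarrow> (real^'n::finite \<Rightarrow> real) \<Rightarrow> (real^'n) set \<Rightarrow> bool" where
  "Ck_on k f S \<longleftrightarrow>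
     (\<forall>is::'n list. length is \<le> k \<longrightarrow> continuous_on S (Dp is f)) \<and>
     (\<forall>(is::'n list) i x. length is < k \<and> x \<in> S \<longrightarrow>
         (\<lambda>t. Dp is f (x + t *\<^sub>R axis i 1)) differentiable (at 0))"

definition Ck_closure :: "nat \<Rightarrow> (real^'n::finite \<Rightarrow> real) \<Rightarrow> (real^'n) set \<Rightarrow> bool" where
  "Ck_closure k f \<Omega> \<longleftrightarrow> Ck_on k f \<Omega> \<and> continuous_on (closure \<Omega>) f \<and>
     (\<forall>is::'n list. length is \<le> k \<longrightarrow>
        (\<exists>g. continuous_on (closure \<Omega>) g \<and> (\<forall>x\<in>\<Omega>. g x = Dp is f x)))"

definition bgrad :: "(real^'n::finite \<Rightarrow> real) \<Rightarrow> (real^'n) set \<Rightarrow> real^'n \<Rightarrow> real^'n" where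
  "bgrad u \<Omega> q = (\<chi> i. Lim (at q within \<Omega>) (partial i u))"

definition local_defining ::
    "nat \<Rightarrow> (real^'n::finite) set \<Rightarrow> real^'n \<Rightarrow> real \<Rightarrow> (real^'n \<Rightarrow> real) \<Rightarrow> bool" where
  "local_defining k \<Omega> q r \<phi> \<longleftrightarrow> r > 0 \<and> Ck_on k \<phi> (ball q r) \<and>
     (\<forall>x\<in>ball q r. grad \<phi> x \<noteq> 0) \<and>
     \<Omega> \<inter> ball q r = {x \<in> ball q r. \<phi> x < 0}"

definition C1_domain :: "(real^'n::finite) set \<Rightarrow> bool" where
  "C1_domain \<Omega> \<longleftrightarrow> open \<Omega> \<and> connected \<Omega> \<and> \<Omega> \<noteq> {} \<and>
     (\<forall>q\<in>frontier \<Omega>. \<exists>r \<phi>. local_defining 1 \<Omega> q r \<phi>)"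

definition ext_normal :: "(real^'n::finite) set \<Rightarrow> real^'n \<Rightarrow> real^'n \<Rightarrow> bool" where
  "ext_normal \<Omega> q \<nu> \<longleftrightarrow> (\<exists>r \<phi>. local_defining 1 \<Omega> q r \<phi> \<and>
     \<nu> = (1 / norm (grad \<phi> q)) *\<^sub>R grad \<phi> q)"

text \<open>H is the mean curvature of the boundary at q: (n-1) H = div of the exterior unit
  normal field (positive for spheres bounding balls).\<close>
definition mean_curv :: "(real^'n::finite) set \<Rightarrow> real^'n \<Rightarrow> real \<Rightarrow> bool" where
  "mean_curv \<Omega> q H \<longleftrightarrow> (\<exists>r \<phi>. local_defining 2 \<Omega> q r \<phi> \<and>
     H = divg (\<lambda>x. (1 / norm (grad \<phi> x)) *\<^sub>R grad \<phi> x) q / (real CARD('n) - 1))"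

definition test_fn :: "(real^'n::finite \<Rightarrow> real) \<Rightarrow> (real^'n) set \<Rightarrow> bool" where
  "test_fn \<psi> \<Omega> \<longleftrightarrow> (\<forall>k. Ck_on k \<psi> UNIV) \<and> compact (closure {x. \<psi> x \<noteq> 0}) \<and>
     closure {x. \<psi> x \<noteq> 0} \<subseteq> \<Omega>"

text \<open>div(|grad u|^(p-2) grad u) + f(u) = 0 in Omega, in the (standard) weak sense.\<close>
definition p_laplace_eq :: "real \<Rightarrow> (real \<Rightarrow> real) \<Rightarrow> (real^'n::finite \<Rightarrow> real) \<Rightarrow> (real^'n) set \<Rightarrow> bool" where
  "p_laplace_eq p f u \<Omega> \<longleftrightarrow> (\<forall>\<psi>. test_fn \<psi> \<Omega> \<longrightarrow>
     integral \<Omega> (\<lambda>x. norm (grad u x) powr (p - 2) * (grad u x \<bullet> grad \<psi> x))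
       = integral \<Omega> (\<lambda>x. f (u x) * \<psi> x))"

definition parallel_sol :: "(real^'n::finite) set \<Rightarrow> (real^'n \<Rightarrow> real) \<Rightarrow> bool" where
  "parallel_sol \<Omega> u \<longleftrightarrow> (\<exists>x0 a (g::real \<Rightarrow> real).
     \<Omega> = {x. a \<bullet> (x - x0) > 0} \<and> (\<forall>x\<in>\<Omega>. u x = g (a \<bullet> (x - x0))))"

end

theory Submission
  imports Defs
begin

text \<open>Let \<open>P = (p - 1) / p * |\<nabla>u|^p + F(u)\<close>. Where \<open>\<nabla>u \<noteq> 0\<close> the equation holds pointwise and
  \<open>P\<close> is a subsolution of a linear elliptic equation. On the boundary \<open>P\<close> is the constant
  \<open>c = (p - 1) / p * \<kappa>^p + F(0) \<ge> 0\<close>. If \<open>P\<close> exceeded \<open>c\<close> somewhere then \<open>P > 0\<close>, hence \<open>\<nabla>u \<noteq> 0\<close> (as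
  \<open>F \<le> 0\<close>), and a cutoff argument with the strict perturbation \<open>ln P + \<eta> exp (K u)\<close> gives a
  contradiction as the cutoff radius grows; so \<open>P \<le> c\<close>. By the strong maximum principle either
  \<open>P = c\<close> everywhere, and then the Hessian of \<open>u\<close> is a multiple of \<open>\<nabla>u \<otimes> \<nabla>u\<close>, the direction of \<open>\<nabla>u\<close> is
  constant and \<open>u\<close> is parallel; or \<open>P < c\<close> inside, and then the boundary point lemma gives
  \<open>\<partial>P/\<partial>\<nu> > 0\<close>, which is \<open>- (n - 1) H \<kappa>^p > 0\<close>. That the boundary is of class \<open>C^2\<close> follows from
  \<open>\<nabla>u = - \<kappa> \<nu>\<close> on it.\<close>

section \<open>Partial derivatives\<close>

text \<open>\<open>L\<close> consists of the linearised p-Laplacian, normalised by a power of |grad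
  u|, and a drift along the gradient with coefficient \<open>p * f (u x) / w x\<close>. For this
  drift the equation and its derivative along the gradient turn \<open>L\<close> of \<open>P\<close>
  into a sum of squares, and as \<open>L\<close> has no zero-order term, elementary maximum
  principles apply. All this makes sense off the critical points only, which shapes the proof. The
  weak equation has to be localised by test functions. Contact of \<open>P\<close> with
  \<open>c\<close> at a critical point has to be excluded: it forces \<open>c = 0\<close>, and then
  the growth of \<open>F\<close> at its zeros gives |grad u| \<le> C |u - u0|, so \<open>u\<close>
  would be constant, against \<open>\<kappa> > 0\<close>. A C^1 boundary offers neither interior
  balls nor curvature a priori: the Hopf barrier takes \<open>u\<close> in place of the distance to
  the boundary, and derivatives along the boundary are limits of derivatives along shifted copies
  inside the domain.\<close>

lemma has_real_derivative_along_axis: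
  fixes f :: "real^'n \<Rightarrow> real"
  assumes "((\<lambda>t. f (y + t0 *\<^sub>R v + t *\<^sub>R v)) has_real_derivative D) (at 0)"
  shows "((\<lambda>t. f (y + t *\<^sub>R v)) has_real_derivative D) (at t0)"
proof -
  have "((\<lambda>t. f (y + (t + t0) *\<^sub>R v)) has_real_derivative D) (at 0)"
    using assms by (simp add: algebra_simps)
  then show ?thesis
    using DERIV_shift[of "\<lambda>t. f (y + t *\<^sub>R v)" D 0 t0] by simp
qed

text \<open>\<open>Ck_on\<close> speaks of one-dimensional derivatives along the axes; this bridge
  to Frechet derivatives makes the chain and product rules available.\<close>

lemma has_derivative_continuous_partials:
  fixes f :: "real^'n \<Rightarrow> real" and D :: "'n \<Rightarrow> real^'n \<Rightarrow> real"
  assumes "open S" "x \<in> S"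
    and deriv: "\<And>i y. y \<in> S \<Longrightarrow> ((\<lambda>t. f (y + t *\<^sub>R axis i 1)) has_real_derivative D i y) (at 0)"
    and cont: "\<And>i. continuous (at x) (D i)"
  shows "(f has_derivative (\<lambda>h. \<Sum>i\<in>UNIV. D i x * h $ i)) (at x)"
  unfolding has_derivative_at_alt
proof (intro conjI allI impI)
  show "bounded_linear (\<lambda>h::real^'n. \<Sum>i\<in>UNIV. D i x * h $ i)"
    by (intro bounded_linear_sum bounded_linear_mult_right bounded_linear_compose[OF bounded_linear_mult_right bounded_linear_vec_nth])
next
  fix e :: real assume "e > 0"
  define e' where "e' = e / CARD('n)"
  have e': "e' > 0" using \<open>e > 0\<close> by (simp add: e'_def)
  have "\<forall>i. \<forall>\<^sub>F y in nhds x. \<bar>D i y - D i x\<bar> < e'"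
    using cont e' by (auto simp: continuous_at_eps_delta eventually_nhds_metric dist_real_def)
  then have "\<forall>\<^sub>F y in nhds x. \<forall>i. \<bar>D i y - D i x\<bar> < e'"
    by (simp add: eventually_all_finite)
  moreover have "\<forall>\<^sub>F y in nhds x. y \<in> S"
    using assms(1,2) by (rule eventually_nhds_in_open)
  ultimately have "\<forall>\<^sub>F y in nhds x. y \<in> S \<and> (\<forall>i. \<bar>D i y - D i x\<bar> < e')"
    by eventually_elim auto
  then obtain d where d: "d > 0" "\<And>y. dist y x < d \<Longrightarrow> y \<in> S \<and> (\<forall>i. \<bar>D i y - D i x\<bar> < e')"
    unfolding eventually_nhds_metric by blast
  \<comment> \<open>\<open>pr I h\<close> has only the coordinates in \<open>I\<close> switched on,
    so adding an index to \<open>I\<close> moves along a single axis. Each such move costs at most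
    \<open>e' * norm h\<close>, and there are \<open>CARD('n)\<close> of them.\<close>
  define pr where "pr I h = (\<chi> i. if i \<in> I then h $ i else 0)" for I and h :: "real^'n"
  have key: "\<bar>f (x + pr I h) - f x - (\<Sum>i\<in>I. D i x * h $ i)\<bar> \<le> card I * e' * norm h"
    if "norm h < d" "finite I" for I h
    using that(2)
  proof (induction I rule: finite_induct)
    case empty
    have "pr {} h = 0" by (simp add: pr_def vec_eq_iff)
    then show ?case by simp
  next
    case (insert i I)
    define y where "y = x + pr I h"
    have eq: "x + pr (insert i I) h = y + (h $ i) *\<^sub>R axis i 1"
      using insert.hyps by (auto simp: y_def pr_def vec_eq_iff axis_def)
    have mem: "dist (y + t *\<^sub>R axis i 1) x < d" if "t \<in> closed_segment 0 (h $ i)" for t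
    proof -
      have "\<bar>t\<bar> \<le> \<bar>h $ i\<bar>" using that by (auto simp: closed_segment_eq_real_ivl split: if_splits)
      then have "norm (pr I h + t *\<^sub>R axis i 1) \<le> norm h"
        using insert.hyps by (intro norm_le_componentwise_cart) (auto simp: pr_def axis_def)
      then show ?thesis using \<open>norm h < d\<close> by (simp add: dist_norm y_def)
    qed
    have "\<bar>(f (y + (h $ i) *\<^sub>R axis i 1) - D i x * h $ i) - (f (y + 0 *\<^sub>R axis i 1) - D i x * 0)\<bar> \<le> e' * norm (h $ i - 0)"
      unfolding real_norm_def[symmetric]
    proof (rule field_differentiable_bound[where S="closed_segment 0 (h $ i)" and f'="\<lambda>t. D i (y + t *\<^sub>R axis i 1) - D i x"])
      fix t assume t: "t \<in> closed_segment 0 (h $ i)"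
      have "((\<lambda>t. f (y + t *\<^sub>R axis i 1)) has_real_derivative D i (y + t *\<^sub>R axis i 1)) (at t)"
        by (rule has_real_derivative_along_axis[where f=f], rule deriv) (use d mem[OF t] in auto)
      then show "((\<lambda>t. f (y + t *\<^sub>R axis i 1) - D i x * t) has_field_derivative D i (y + t *\<^sub>R axis i 1) - D i x)
          (at t within closed_segment 0 (h $ i))"
        by (auto intro!: derivative_eq_intros dest: has_field_derivative_at_within)
      show "norm (D i (y + t *\<^sub>R axis i 1) - D i x) \<le> e'"
        using d(2)[OF mem[OF t]] by (simp add: less_imp_le)
    qed auto
    also have "e' * norm (h $ i - 0) \<le> e' * norm h"
      using e' component_le_norm_cart[of h i] by simp
    finally have "\<bar>f (x + pr (insert i I) h) - f (x + pr I h) - D i x * h $ i\<bar> \<le> e' * norm h"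
      by (simp add: eq y_def algebra_simps)
    moreover have "card (insert i I) * e' * norm h = e' * norm h + card I * e' * norm h"
      using insert.hyps by (simp add: algebra_simps)
    moreover have "(\<Sum>j\<in>insert i I. D j x * h $ j) = D i x * h $ i + (\<Sum>j\<in>I. D j x * h $ j)"
      using insert.hyps by simp
    ultimately show ?case using insert.IH by linarith
  qed
  show "\<exists>d>0. \<forall>y. norm (y - x) < d \<longrightarrow> norm (f y - f x - (\<Sum>i\<in>UNIV. D i x * (y - x) $ i)) \<le> e * norm (y - x)"
  proof (intro exI[of _ d] conjI allI impI d(1))
    fix y assume "norm (y - x) < d"
    from key[OF this finite] have "\<bar>f (x + pr UNIV (y-x)) - f x - (\<Sum>i\<in>UNIV. D i x * (y-x) $ i)\<bar> \<le> CARD('n) * e' * norm (y-x)" .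
    moreover have "x + pr UNIV (y-x) = y" by (simp add: pr_def vec_eq_iff)
    ultimately show "norm (f y - f x - (\<Sum>i\<in>UNIV. D i x * (y - x) $ i)) \<le> e * norm (y - x)"
      by (simp add: e'_def)
  qed
qed

lemma partial_has_real_derivative:
  assumes "(\<lambda>t. f (x + t *\<^sub>R axis i 1)) differentiable (at 0)"
  shows "((\<lambda>t. f (x + t *\<^sub>R axis i 1)) has_real_derivative partial i f x) (at 0)"
  unfolding partial_def
  using assms by (metis DERIV_imp_deriv real_differentiable_def)

lemma has_derivative_direction:
  fixes f :: "'a::real_normed_vector \<Rightarrow> real"
  assumes "(f has_derivative f') (at x)"
  shows "((\<lambda>t. f (x + t *\<^sub>R v)) has_real_derivative f' v) (at 0)"
proof -
  interpret bounded_linear f' using assms by (rule has_derivative_bounded_linear)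
  have "((\<lambda>t. x + t *\<^sub>R v) has_derivative (\<lambda>t. t *\<^sub>R v)) (at (0::real))"
    by (auto intro!: derivative_eq_intros)
  from has_derivative_compose[OF this, of f f'] assms
  show ?thesis
    by (simp add: has_field_derivative_def scaleR mult_commute_abs)
qed

lemma partial_eqI:
  assumes "(f has_derivative f') (at x)"
  shows "partial i f x = f' (axis i 1)"
  unfolding partial_def by (rule DERIV_imp_deriv[OF has_derivative_direction[OF assms]])

lemma partial_cong_open:
  assumes "open S" "x \<in> S" "\<And>y. y \<in> S \<Longrightarrow> f y = g y"
  shows "partial i f x = partial i g x"
proof -
  have "((\<lambda>t. x + t *\<^sub>R axis i 1) \<longlongrightarrow> x + 0 *\<^sub>R axis i 1) (nhds (0::real))"
    by (intro tendsto_intros filterlim_ident)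
  then have "\<forall>\<^sub>F t in nhds 0. x + t *\<^sub>R axis i 1 \<in> S"
    using assms by (auto simp: tendsto_def)
  then have "\<forall>\<^sub>F t in nhds 0. f (x + t *\<^sub>R axis i 1) = g (x + t *\<^sub>R axis i 1)"
    by eventually_elim (use assms in auto)
  then show ?thesis unfolding partial_def by (intro deriv_cong_ev) auto
qed

text \<open>The mean value theorem twice: in direction \<open>i\<close> for the difference across
  the side parallel to \<open>j\<close>, then in direction \<open>j\<close> for \<open>D i\<close>.
  The second difference itself is symmetric in \<open>i\<close> and \<open>j\<close>, so the same
  expression also yields the derivatives in the other order.\<close>

lemma mixed_second_difference:
  fixes f :: "real^'n \<Rightarrow> real" and D :: "'n \<Rightarrow> real^'n \<Rightarrow> real" and E :: "real^'n \<Rightarrow> real"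
  assumes s: "s > 0" and sub: "\<And>a b. 0 \<le> a \<Longrightarrow> a \<le> s \<Longrightarrow> 0 \<le> b \<Longrightarrow> b \<le> s \<Longrightarrow> x + a *\<^sub>R axis i 1 + b *\<^sub>R axis j 1 \<in> S"
    and D: "\<And>y. y \<in> S \<Longrightarrow> ((\<lambda>t. f (y + t *\<^sub>R axis i 1)) has_real_derivative D i y) (at 0)"
    and E: "\<And>y. y \<in> S \<Longrightarrow> ((\<lambda>t. D i (y + t *\<^sub>R axis j 1)) has_real_derivative E y) (at 0)"
  obtains a b where "0 \<le> a" "a \<le> s" "0 \<le> b" "b \<le> s"
    "f (x + s *\<^sub>R axis i 1 + s *\<^sub>R axis j 1) - f (x + s *\<^sub>R axis i 1) - f (x + s *\<^sub>R axis j 1) + f x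
       = s * s * E (x + a *\<^sub>R axis i 1 + b *\<^sub>R axis j 1)"
proof -
  have 1: "((\<lambda>t. f (x + b *\<^sub>R axis j 1 + t *\<^sub>R axis i 1)) has_real_derivative D i (x + b *\<^sub>R axis j 1 + t *\<^sub>R axis i 1)) (at t)"
    if "0 \<le> t" "t \<le> s" "0 \<le> b" "b \<le> s" for t b
    by (rule has_real_derivative_along_axis[where f=f], rule D) (use sub[OF that] in \<open>simp add: algebra_simps\<close>)
  have "\<exists>a>0. a < s \<and> (f (x + s *\<^sub>R axis j 1 + s *\<^sub>R axis i 1) - f (x + 0 *\<^sub>R axis j 1 + s *\<^sub>R axis i 1))
      - (f (x + s *\<^sub>R axis j 1 + 0 *\<^sub>R axis i 1) - f (x + 0 *\<^sub>R axis j 1 + 0 *\<^sub>R axis i 1))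
      = (s - 0) * (D i (x + s *\<^sub>R axis j 1 + a *\<^sub>R axis i 1) - D i (x + 0 *\<^sub>R axis j 1 + a *\<^sub>R axis i 1))"
    using s by (intro MVT2 DERIV_diff 1) auto
  then obtain a where a: "0 < a" "a < s" "(f (x + s *\<^sub>R axis j 1 + s *\<^sub>R axis i 1) - f (x + s *\<^sub>R axis i 1))
      - (f (x + s *\<^sub>R axis j 1) - f x)
      = s * (D i (x + s *\<^sub>R axis j 1 + a *\<^sub>R axis i 1) - D i (x + a *\<^sub>R axis i 1))" by auto
  have "\<exists>b>0. b < s \<and> D i (x + a *\<^sub>R axis i 1 + s *\<^sub>R axis j 1) - D i (x + a *\<^sub>R axis i 1 + 0 *\<^sub>R axis j 1)
     = (s - 0) * E (x + a *\<^sub>R axis i 1 + b *\<^sub>R axis j 1)"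
  proof (intro MVT2 s)
    fix b assume "0 \<le> b" "b \<le> s"
    then show "((\<lambda>b. D i (x + a *\<^sub>R axis i 1 + b *\<^sub>R axis j 1)) has_real_derivative E (x + a *\<^sub>R axis i 1 + b *\<^sub>R axis j 1)) (at b)"
      by (intro sub has_real_derivative_along_axis[where f="D i", OF E]) (use a in auto)
  qed
  then obtain b where b: "0 < b" "b < s" "D i (x + a *\<^sub>R axis i 1 + s *\<^sub>R axis j 1) - D i (x + a *\<^sub>R axis i 1)
     = s * E (x + a *\<^sub>R axis i 1 + b *\<^sub>R axis j 1)" by auto
  show thesis
    by (rule that[of a b]) (use a b in \<open>auto simp: algebra_simps\<close>)
qed

lemma mixed_partials_eq:
  fixes f :: "real^'n \<Rightarrow> real"
  assumes "open S" "x \<in> S"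
    and D: "\<And>y k. y \<in> S \<Longrightarrow> ((\<lambda>t. f (y + t *\<^sub>R axis k 1)) has_real_derivative D k y) (at 0)"
    and E: "\<And>y k l. y \<in> S \<Longrightarrow> ((\<lambda>t. D k (y + t *\<^sub>R axis l 1)) has_real_derivative E l k y) (at 0)"
    and cont: "\<And>k l. continuous (at x) (E k l)"
  shows "E i j x = E j i x"
proof (rule ccontr)
  assume ne: "E i j x \<noteq> E j i x"
  define e where "e = \<bar>E i j x - E j i x\<bar> / 2"
  have e: "e > 0" using ne by (simp add: e_def)
  have 1: "\<forall>\<^sub>F y in nhds x. \<bar>E k l y - E k l x\<bar> < e" for k l
    using cont[of k l] e by (auto simp: continuous_at_eps_delta eventually_nhds_metric dist_real_def)
  have "\<forall>\<^sub>F y in nhds x. y \<in> S"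
    using assms(1,2) by (rule eventually_nhds_in_open)
  with 1[of i j] 1[of j i] have "\<forall>\<^sub>F y in nhds x. y \<in> S \<and> \<bar>E i j y - E i j x\<bar> < e \<and> \<bar>E j i y - E j i x\<bar> < e"
    by eventually_elim auto
  then obtain d where d: "d > 0" "\<And>y. dist y x < d \<Longrightarrow> y \<in> S \<and> \<bar>E i j y - E i j x\<bar> < e \<and> \<bar>E j i y - E j i x\<bar> < e"
    unfolding eventually_nhds_metric by blast
  \<comment> \<open>A third of \<open>d\<close>, because points of the square lie up to
    \<open>2 * s\<close> away from \<open>x\<close>.\<close>
  define s where "s = d / 3"
  have s: "s > 0" using d by (simp add: s_def)
  have near: "dist (x + a *\<^sub>R axis k 1 + b *\<^sub>R axis l 1) x < d" if "0 \<le> a" "a \<le> s" "0 \<le> b" "b \<le> s" for a b k l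
  proof -
    have "norm (a *\<^sub>R axis k (1::real) + b *\<^sub>R axis l 1) \<le> a + b"
      using norm_triangle_ineq[of "a *\<^sub>R axis k (1::real)" "b *\<^sub>R axis l 1"] that by simp
    then show ?thesis using that d(1) by (simp add: dist_norm s_def add.assoc)
  qed
  obtain a b where ab: "0 \<le> a" "a \<le> s" "0 \<le> b" "b \<le> s"
    "f (x + s *\<^sub>R axis i 1 + s *\<^sub>R axis j 1) - f (x + s *\<^sub>R axis i 1) - f (x + s *\<^sub>R axis j 1) + f x
       = s * s * E j i (x + a *\<^sub>R axis i 1 + b *\<^sub>R axis j 1)"
    by (rule mixed_second_difference[where S=S and D=D and f=f and x=x and i=i and j=j and E="E j i", OF s])
       (use D E d near in auto)
  obtain a' b' where ab': "0 \<le> a'" "a' \<le> s" "0 \<le> b'" "b' \<le> s"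
    "f (x + s *\<^sub>R axis j 1 + s *\<^sub>R axis i 1) - f (x + s *\<^sub>R axis j 1) - f (x + s *\<^sub>R axis i 1) + f x
       = s * s * E i j (x + a' *\<^sub>R axis j 1 + b' *\<^sub>R axis i 1)"
    by (rule mixed_second_difference[where S=S and D=D and f=f and x=x and i=j and j=i and E="E i j", OF s])
       (use D E d near in auto)
  have cm: "x + s *\<^sub>R axis j 1 + s *\<^sub>R axis i 1 = x + s *\<^sub>R axis i (1::real) + s *\<^sub>R axis j 1" by simp
  from ab(5) ab'(5)[unfolded cm] have "s * s * E j i (x + a *\<^sub>R axis i 1 + b *\<^sub>R axis j 1) = s * s * E i j (x + a' *\<^sub>R axis j 1 + b' *\<^sub>R axis i 1)"
    by linarith
  then have "E j i (x + a *\<^sub>R axis i 1 + b *\<^sub>R axis j 1) = E i j (x + a' *\<^sub>R axis j 1 + b' *\<^sub>R axis i 1)"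
    using s by simp
  moreover have "\<bar>E j i (x + a *\<^sub>R axis i 1 + b *\<^sub>R axis j 1) - E j i x\<bar> < e"
    using d(2)[OF near[OF ab(1-4)]] by auto
  moreover have "\<bar>E i j (x + a' *\<^sub>R axis j 1 + b' *\<^sub>R axis i 1) - E i j x\<bar> < e"
    using d(2)[OF near[OF ab'(1-4)]] by auto
  moreover have "\<bar>E i j x - E j i x\<bar> = e + e" by (simp add: e_def)
  ultimately show False by linarith
qed

section \<open>Derivatives of C^k functions as linear maps\<close>

lemma Ck_on_partial_derivative:
  assumes "Ck_on k f S" "length is < k" "x \<in> S"
  shows "((\<lambda>t. Dp is f (x + t *\<^sub>R axis i 1)) has_real_derivative Dp (i # is) f x) (at 0)"
  using assms by (auto simp: Ck_on_def intro!: partial_has_real_derivative)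

lemma Ck_on_continuous_at:
  assumes "Ck_on k f S" "open S" "length is \<le> k" "x \<in> S"
  shows "continuous (at x) (Dp is f)"
  using assms by (auto simp: Ck_on_def continuous_on_eq_continuous_at)

lemma Ck_on_has_derivative:
  fixes f :: "real^'n \<Rightarrow> real"
  assumes "Ck_on k f S" "open S" "length is < k" "x \<in> S"
  shows "(Dp is f has_derivative (\<lambda>h. \<Sum>i\<in>UNIV. Dp (i # is) f x * h $ i)) (at x)"
  using assms
  by (intro has_derivative_continuous_partials[of S] Ck_on_partial_derivative Ck_on_continuous_at) auto

lemma Ck_on_Dp_swap:
  fixes f :: "real^'n \<Rightarrow> real"
  assumes "Ck_on k f S" "open S" "length is + 2 \<le> k" "x \<in> S"
  shows "Dp (i # j # is) f x = Dp (j # i # is) f x"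
  using assms
  by (intro mixed_partials_eq[where S=S and f="Dp is f" and D="\<lambda>k. Dp (k # is) f" and E="\<lambda>k l. Dp (k # l # is) f"]
       Ck_on_partial_derivative Ck_on_continuous_at) auto

text \<open>\<open>Dp [j, i]\<close> differentiates in \<open>i\<close> first, so row
  \<open>i\<close> belongs to the i-th component of the gradient, and \<open>hess f x *v h\<close>
  is the derivative of \<open>grad f\<close> along \<open>h\<close> even before symmetry is
  known.\<close>

definition hess :: "(real^'n::finite \<Rightarrow> real) \<Rightarrow> real^'n \<Rightarrow> real^'n^'n" where
  "hess f x = (\<chi> i j. Dp [j, i] f x)"

definition third :: "(real^'n::finite \<Rightarrow> real) \<Rightarrow> real^'n \<Rightarrow> real^'n \<Rightarrow> real^'n^'n" where
  "third f x h = (\<chi> i j. \<Sum>k\<in>UNIV. Dp [k, j, i] f x * h $ k)"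

lemma grad_nth: "grad f x $ i = Dp [i] f x"
  by (simp add: grad_def)

lemma Ck_on_has_derivative_grad:
  fixes f :: "real^'n \<Rightarrow> real"
  assumes "Ck_on k f S" "open S" "1 \<le> k" "x \<in> S"
  shows "(f has_derivative (\<lambda>h. grad f x \<bullet> h)) (at x)"
  using Ck_on_has_derivative[OF assms(1,2), of "[]" x] assms
  by (simp add: inner_vec_def grad_def)

lemma Ck_on_has_derivative_hess:
  fixes f :: "real^'n \<Rightarrow> real"
  assumes "Ck_on k f S" "open S" "2 \<le> k" "x \<in> S"
  shows "(grad f has_derivative (\<lambda>h. hess f x *v h)) (at x)"
proof -
  have "((\<lambda>y. grad f y $ i) has_derivative (\<lambda>h. (hess f x *v h) $ i)) (at x)" for i
    using Ck_on_has_derivative[OF assms(1,2), of "[i]" x] assms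
    by (simp add: grad_def hess_def matrix_vector_mult_def)
  then show ?thesis
    by (subst has_derivative_componentwise_within) (auto simp: Basis_vec_def inner_axis)
qed

lemma Ck_on_has_derivative_third:
  fixes f :: "real^'n \<Rightarrow> real"
  assumes "Ck_on k f S" "open S" "3 \<le> k" "x \<in> S"
  shows "(hess f has_derivative (\<lambda>h. third f x h)) (at x)"
proof -
  have "((\<lambda>y. hess f y $ i $ j) has_derivative (\<lambda>h. third f x h $ i $ j)) (at x)" for i j
    using Ck_on_has_derivative[OF assms(1,2), of "[j,i]" x] assms
    by (simp add: third_def hess_def)
  then show ?thesis
    by (subst has_derivative_componentwise_within) (auto simp: Basis_vec_def inner_axis)
qed

lemma hess_symmetric:
  assumes "Ck_on k f S" "open S" "2 \<le> k" "x \<in> S"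
  shows "hess f x $ i $ j = hess f x $ j $ i"
  using Ck_on_Dp_swap[OF assms(1,2), of "[]" x i j] assms by (simp add: hess_def)

lemma inner_hess_commute:
  assumes "Ck_on k f S" "open S" "2 \<le> k" "x \<in> S"
  shows "v \<bullet> (hess f x *v w) = (hess f x *v v) \<bullet> w"
proof -
  have "transpose (hess f x) = hess f x"
    using hess_symmetric[OF assms] by (simp add: transpose_def vec_eq_iff)
  then show ?thesis by (metis dot_lmul_matrix inner_commute transpose_matrix_vector)
qed

lemma third_commute:
  fixes f :: "real^'n \<Rightarrow> real"
  assumes "Ck_on k f S" "open S" "3 \<le> k" "x \<in> S"
  shows "third f x h *v v = third f x v *v h"
proof -
  have "Dp [k, j, i] f x = Dp [j, k, i] f x" for i j k
    using Ck_on_Dp_swap[OF assms(1,2), of "[i]" x] assms by simp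
  then have "(third f x h *v v) $ i = (third f x v *v h) $ i" for i
    unfolding third_def matrix_vector_mult_def
    apply (simp add: sum_distrib_right)
    apply (subst sum.swap)
    apply (intro sum.cong refl)
    by (simp add: mult_ac)
  then show ?thesis by (simp add: vec_eq_iff)
qed

text \<open>The commutation of derivatives behind Bochner-type formulas: the contracted third
  derivatives become the derivative of the trace of the Hessian along \<open>v\<close>, which the
  differentiated equation controls.\<close>

lemma trace_third:
  fixes f :: "real^'n \<Rightarrow> real"
  assumes "Ck_on k f S" "open S" "3 \<le> k" "x \<in> S"
  shows "(\<Sum>i\<in>UNIV. (third f x (axis i 1) *v v) $ i) = trace (third f x v)"
proof -
  have "(third f x (axis i 1) *v v) $ i = third f x v $ i $ i" for i
    by (simp add: third_commute[OF assms, of "axis i 1"] matrix_vector_mult_basis column_def)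
  then show ?thesis by (simp add: trace_def)
qed

section \<open>Bump functions and the pointwise equation\<close>

text \<open>The functions q(1/t) exp(-1/t), extended by zero, form a family closed under
  differentiation; smoothness of every order then follows by induction.\<close>

definition flat :: "real poly \<Rightarrow> real \<Rightarrow> real" where
  "flat q t = (if t > 0 then poly q (1 / t) * exp (- 1 / t) else 0)"

lemma tendsto_poly_div_exp_0: "((\<lambda>x. poly q x / exp x) \<longlongrightarrow> (0::real)) at_top"
proof -
  have "((\<lambda>x. \<Sum>i\<le>degree q. coeff q i * (x ^ i / exp x)) \<longlongrightarrow> (\<Sum>i\<le>degree q. coeff q i * 0)) at_top"
    by (intro tendsto_intros tendsto_power_div_exp_0)
  then show ?thesis by (simp add: poly_altdef sum_divide_distrib)
qed

text \<open>Differentiation sends the polynomial q to X^2 (q - q'): the argument 1/t and the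
  exponent -1/t each contribute a factor 1/t^2. At 0 the difference quotient from the right is X q
  at 1/h times exp(-1/h), which tends to 0.\<close>

lemma flat_has_derivative:
  "(flat q has_real_derivative flat (monom 1 2 * (q - pderiv q)) t) (at t)"
proof -
  consider "t > 0" | "t < 0" | "t = 0" by linarith
  then show ?thesis
  proof cases
    case 1
    have "((\<lambda>t. poly q (1 / t) * exp (- 1 / t)) has_real_derivative flat (monom 1 2 * (q - pderiv q)) t) (at t)"
      using 1
      by (auto intro!: derivative_eq_intros poly_DERIV simp: flat_def poly_monom power2_eq_square field_simps)
    moreover have "\<forall>\<^sub>F s in nhds t. poly q (1 / s) * exp (- 1 / s) = flat q s"
      using eventually_nhds_in_open[of "{0<..}" t] 1 by (auto simp: flat_def elim: eventually_mono)
    ultimately show ?thesis by (subst DERIV_cong_ev[symmetric]) auto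
  next
    case 2
    have "\<forall>\<^sub>F s in nhds t. 0 = flat q s"
      using eventually_nhds_in_open[of "{..<0}" t] 2 by (auto simp: flat_def elim: eventually_mono)
    moreover have "((\<lambda>s. 0) has_real_derivative flat (monom 1 2 * (q - pderiv q)) t) (at t)"
      using 2 by (simp add: flat_def)
    ultimately show ?thesis by (subst DERIV_cong_ev[symmetric]) auto
  next
    case 3
    have "((\<lambda>h. poly (monom 1 1 * q) h / exp h) \<longlongrightarrow> 0) at_top"
      by (rule tendsto_poly_div_exp_0)
    then have "((\<lambda>h. poly (monom 1 1 * q) (inverse h) / exp (inverse h)) \<longlongrightarrow> 0) (at_right 0)"
      by (rule filterlim_compose[OF _ filterlim_inverse_at_top_right])
    moreover have "\<forall>\<^sub>F h in at_right 0. poly (monom 1 1 * q) (inverse h) / exp (inverse h) = flat q h / h"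
      unfolding eventually_at_right_field
      by (intro exI[of _ 1]) (auto simp: flat_def poly_monom field_simps exp_minus)
    ultimately have "((\<lambda>h. flat q h / h) \<longlongrightarrow> 0) (at_right 0)"
      by (rule Lim_transform_eventually)
    moreover have "((\<lambda>h. flat q h / h) \<longlongrightarrow> 0) (at_left 0)"
      by (rule Lim_transform_eventually[where f="\<lambda>_. 0"])
         (auto simp: flat_def eventually_at_left_field intro!: exI[of _ "-1"])
    ultimately have "((\<lambda>h. flat q h / h) \<longlongrightarrow> 0) (at 0)"
      by (simp add: filterlim_at_split)
    then show ?thesis using 3 by (simp add: has_field_derivative_iff flat_def)
  qed
qed

inductive_set bumps :: "real \<Rightarrow> real \<Rightarrow> (real \<Rightarrow> real) set" for a b where
  base: "(\<lambda>t. flat q (t - a) * flat r (b - t)) \<in> bumps a b"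
| add: "\<phi> \<in> bumps a b \<Longrightarrow> \<psi> \<in> bumps a b \<Longrightarrow> (\<lambda>t. \<phi> t + \<psi> t) \<in> bumps a b"

lemma bumps_derivative:
  assumes "\<phi> \<in> bumps a b"
  shows "\<exists>\<phi>'\<in>bumps a b. \<forall>t. (\<phi> has_real_derivative \<phi>' t) (at t)"
  using assms
proof induction
  case (base q r)
  define D where "D q = monom 1 2 * (q - pderiv q)" for q :: "real poly"
  have neg: "flat (- q) t = - flat q t" for q t by (simp add: flat_def)
  have 1: "((\<lambda>t. flat q (t - a)) has_real_derivative flat (D q) (t - a)) (at t)" for t
  proof -
    have "((\<lambda>t. t - a) has_real_derivative 1) (at t)" by (auto intro!: derivative_eq_intros)
    from DERIV_chain2[where f="flat q", OF flat_has_derivative this] show ?thesis by (simp add: D_def)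
  qed
  have 2: "((\<lambda>t. flat r (b - t)) has_real_derivative flat (- D r) (b - t)) (at t)" for t
  proof -
    have "((\<lambda>t. b - t) has_real_derivative -1) (at t)" by (auto intro!: derivative_eq_intros)
    from DERIV_chain2[where f="flat r", OF flat_has_derivative this] show ?thesis by (simp add: D_def neg)
  qed
  show ?case
    by (rule bexI[of _ "\<lambda>t. flat (D q) (t - a) * flat r (b - t) + flat q (t - a) * flat (- D r) (b - t)"])
       (auto intro!: derivative_eq_intros 1 2 bumps.intros)
next
  case (add \<phi> \<psi>)
  then obtain \<phi>' \<psi>' where "\<phi>' \<in> bumps a b" "\<psi>' \<in> bumps a b"
    "\<forall>t. (\<phi> has_real_derivative \<phi>' t) (at t)" "\<forall>t. (\<psi> has_real_derivative \<psi>' t) (at t)" by blast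
  then show ?case
    by (intro bexI[of _ "\<lambda>t. \<phi>' t + \<psi>' t"]) (auto intro!: derivative_eq_intros bumps.intros)
qed

text \<open>A partial derivative replaces one factor only, so no sums are needed here and every
  \<open>Dp is\<close> maps the set into itself.\<close>

definition tensor_bumps :: "real^'n \<Rightarrow> real^'n \<Rightarrow> (real^'n::finite \<Rightarrow> real) set" where
  "tensor_bumps a b = {\<psi>. \<exists>\<phi>. (\<forall>i. \<phi> i \<in> bumps (a $ i) (b $ i)) \<and> \<psi> = (\<lambda>x. \<Prod>i\<in>UNIV. \<phi> i (x $ i))}"

lemma tensor_bumps_partial:
  assumes "\<psi> \<in> tensor_bumps a b"
  shows "partial i \<psi> \<in> tensor_bumps a b"
    "((\<lambda>t. \<psi> (x + t *\<^sub>R axis i 1)) has_real_derivative partial i \<psi> x) (at 0)"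
proof -
  obtain \<phi> where \<phi>: "\<And>i. \<phi> i \<in> bumps (a $ i) (b $ i)" and \<psi>: "\<psi> = (\<lambda>x. \<Prod>i\<in>UNIV. \<phi> i (x $ i))"
    using assms by (auto simp: tensor_bumps_def)
  obtain \<phi>' where \<phi>': "\<phi>' \<in> bumps (a $ i) (b $ i)" "\<And>t. (\<phi> i has_real_derivative \<phi>' t) (at t)"
    using bumps_derivative[OF \<phi>] by blast
  let ?D = "\<lambda>x. \<Prod>j\<in>UNIV. (\<phi>(i := \<phi>')) j (x $ j)"
  have eq: "(\<lambda>t. \<psi> (x + t *\<^sub>R axis i 1)) = (\<lambda>t. \<phi> i (x $ i + t) * (\<Prod>j\<in>UNIV-{i}. \<phi> j (x $ j)))" for x
    unfolding \<psi> by (subst prod.remove[of _ i]) (auto simp: axis_def intro!: ext prod.cong)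
  have Deq: "?D x = \<phi>' (x $ i) * (\<Prod>j\<in>UNIV-{i}. \<phi> j (x $ j))" for x
    by (subst prod.remove[of _ i]) (auto intro!: prod.cong)
  have "((\<lambda>t. \<phi> i (x $ i + t)) has_real_derivative \<phi>' (x $ i)) (at 0)" for x
    using \<phi>'(2)[of "x $ i + 0"] DERIV_shift[of "\<phi> i" _ 0 "x $ i"] by (simp add: add.commute)
  then have der: "((\<lambda>t. \<psi> (x + t *\<^sub>R axis i 1)) has_real_derivative ?D x) (at 0)" for x
    unfolding eq Deq by (rule DERIV_cmult_right)
  have "partial i \<psi> = ?D"
    by (rule ext) (simp only: partial_def DERIV_imp_deriv[OF der])
  with der show "((\<lambda>t. \<psi> (x + t *\<^sub>R axis i 1)) has_real_derivative partial i \<psi> x) (at 0)"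
    by simp
  show "partial i \<psi> \<in> tensor_bumps a b"
    unfolding \<open>partial i \<psi> = ?D\<close> tensor_bumps_def using \<phi> \<phi>' by (auto intro!: exI[of _ "\<phi>(i := \<phi>')"])
qed

lemma tensor_bumps_continuous:
  assumes "\<psi> \<in> tensor_bumps a b"
  shows "continuous_on S \<psi>"
proof -
  obtain \<phi> where \<phi>: "\<And>i. \<phi> i \<in> bumps (a $ i) (b $ i)" and \<psi>: "\<psi> = (\<lambda>x. \<Prod>i\<in>UNIV. \<phi> i (x $ i))"
    using assms by (auto simp: tensor_bumps_def)
  have "continuous_on UNIV (\<phi> i)" for i
    using bumps_derivative[OF \<phi>, of i] DERIV_isCont by (metis continuous_at_imp_continuous_on)
  then have "continuous_on S (\<lambda>x. \<phi> i (x $ i))" for i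
    by (rule continuous_on_compose2) (auto intro!: continuous_intros)
  then show ?thesis unfolding \<psi> by (intro continuous_on_prod)
qed

lemma bumps_zero: "\<phi> \<in> bumps a b \<Longrightarrow> \<not> (a < t \<and> t < b) \<Longrightarrow> \<phi> t = 0"
  by (induction rule: bumps.induct) (auto simp: flat_def)

lemma tensor_bumps_zero:
  assumes "\<psi> \<in> tensor_bumps a b" "x \<notin> box a b"
  shows "\<psi> x = 0"
proof -
  obtain \<phi> where \<phi>: "\<And>i. \<phi> i \<in> bumps (a $ i) (b $ i)" and \<psi>: "\<psi> = (\<lambda>x. \<Prod>i\<in>UNIV. \<phi> i (x $ i))"
    using assms by (auto simp: tensor_bumps_def)
  obtain i where "\<not> (a $ i < x $ i \<and> x $ i < b $ i)"
    using assms(2) by (auto simp: mem_box_cart)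
  then have "\<phi> i (x $ i) = 0" using \<phi> bumps_zero by blast
  then show ?thesis unfolding \<psi> by (auto intro: prod_zero)
qed

lemma Dp_tensor_bumps: "\<psi> \<in> tensor_bumps a b \<Longrightarrow> Dp is \<psi> \<in> tensor_bumps a b"
  by (induction "is") (auto simp: tensor_bumps_partial)

lemma tensor_bumps_test_fn:
  assumes "\<psi> \<in> tensor_bumps a b" "cbox a b \<subseteq> \<Omega>"
  shows "test_fn \<psi> \<Omega>"
proof -
  have "closure {x. \<psi> x \<noteq> 0} \<subseteq> cbox a b"
    using tensor_bumps_zero[OF assms(1)] box_subset_cbox by (intro closure_minimal) blast+
  moreover have "Ck_on k \<psi> UNIV" for k
    unfolding Ck_on_def
    using Dp_tensor_bumps[OF assms(1)] tensor_bumps_continuous tensor_bumps_partial(2)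
    by (auto simp: real_differentiable_def) blast+
  moreover have "bounded {x. \<psi> x \<noteq> 0}"
    using tensor_bumps_zero[OF assms(1)] box_subset_cbox by (intro bounded_subset[OF bounded_cbox[of a b]]) blast
  ultimately show ?thesis unfolding test_fn_def
    using assms(2) by auto
qed

text \<open>Translation invariance replaces iterated integration: the integral of \<open>h\<close>
  shifted along \<open>e\<close> does not depend on the shift, and differentiating it under the
  integral sign gives the integral of \<open>D\<close>.\<close>

lemma integral_directional_derivative_zero:
  fixes h D :: "'a::euclidean_space \<Rightarrow> real"
  assumes der: "\<And>x. ((\<lambda>t. h (x + t *\<^sub>R e)) has_real_derivative D x) (at 0)"
    and h: "continuous_on UNIV h" and D: "continuous_on UNIV D"
    and zero: "\<And>x. x \<notin> cbox a b \<Longrightarrow> h x = 0" "\<And>x. x \<notin> cbox a b \<Longrightarrow> D x = 0"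
  shows "integral (cbox a b) D = 0"
proof -
  define M where "M = norm e"
  \<comment> \<open>Contains the supports of all shifts with \<open>\<bar>t\<bar> \<le> 1\<close>,
    so that every integral runs over one fixed box.\<close>
  define C where "C = cbox (a - M *\<^sub>R One) (b + M *\<^sub>R One)"
  have C: "cbox (a - t *\<^sub>R e) (b - t *\<^sub>R e) \<subseteq> C" if "\<bar>t\<bar> \<le> 1" for t
  proof -
    have "\<bar>t * (e \<bullet> i)\<bar> \<le> M" if "i \<in> Basis" for i
    proof -
      have "\<bar>t\<bar> * \<bar>e \<bullet> i\<bar> \<le> 1 * norm e"
        using \<open>\<bar>t\<bar> \<le> 1\<close> Basis_le_norm[OF that, of e] by (intro mult_mono) auto
      then show ?thesis by (simp add: abs_mult M_def)
    qed
    then show ?thesis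
      unfolding C_def subset_box by (auto simp: inner_diff_left inner_add_left abs_le_iff)
  qed
  have int: "integral C (\<lambda>x. h (x + t *\<^sub>R e)) = integral (cbox a b) h" if "\<bar>t\<bar> \<le> 1" for t
  proof -
    have "(h has_integral integral (cbox a b) h) (cbox a b)"
      using h by (intro integrable_integral integrable_continuous) (auto intro: continuous_on_subset)
    from has_integral_affinity'[OF this, of 1 "t *\<^sub>R e"]
    have "((\<lambda>x. h (x + t *\<^sub>R e)) has_integral integral (cbox a b) h) (cbox (a - t *\<^sub>R e) (b - t *\<^sub>R e))"
      by simp
    moreover have "h (x + t *\<^sub>R e) = 0" if "x \<notin> cbox (a - t *\<^sub>R e) (b - t *\<^sub>R e)" for x
      using that by (intro zero) (auto simp: mem_box inner_diff_left inner_add_left algebra_simps)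
    ultimately have "((\<lambda>x. h (x + t *\<^sub>R e)) has_integral integral (cbox a b) h) C"
      by (rule has_integral_on_superset) (use C[OF that] in auto)
    then show ?thesis by (rule integral_unique)
  qed
  have "((\<lambda>t. integral C (\<lambda>x. h (x + t *\<^sub>R e))) has_real_derivative integral C (\<lambda>x. D (x + 0 *\<^sub>R e))) (at 0 within {-1..1})"
    unfolding C_def
  proof (rule leibniz_rule_field_derivative)
    fix t x
    have "((\<lambda>t. h (x + t *\<^sub>R e)) has_real_derivative D (x + t *\<^sub>R e)) (at t)"
    proof -
      have "((\<lambda>s. h (x + (s + t) *\<^sub>R e)) has_real_derivative D (x + t *\<^sub>R e)) (at 0)"
        using der[of "x + t *\<^sub>R e"] by (simp add: algebra_simps)
      then show ?thesis
        using DERIV_shift[of "\<lambda>t. h (x + t *\<^sub>R e)" _ 0 t] by simp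
    qed
    then show "((\<lambda>t. h (x + t *\<^sub>R e)) has_real_derivative D (x + t *\<^sub>R e)) (at t within {-1..1})"
      by (rule has_field_derivative_at_within)
  next
    fix t
    show "(\<lambda>x. h (x + t *\<^sub>R e)) integrable_on cbox (a - M *\<^sub>R One) (b + M *\<^sub>R One)"
      by (intro integrable_continuous continuous_on_compose2[OF h]) (auto intro!: continuous_intros)
  next
    show "continuous_on ({-1..1} \<times> cbox (a - M *\<^sub>R One) (b + M *\<^sub>R One)) (\<lambda>(t, x). D (x + t *\<^sub>R e))"
      unfolding split_beta by (intro continuous_on_compose2[OF D]) (auto intro!: continuous_intros)
  qed auto
  moreover have "((\<lambda>t. integral C (\<lambda>x. h (x + t *\<^sub>R e))) has_real_derivative 0) (at 0 within {-1..1})"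
  proof -
    have "\<forall>\<^sub>F t in nhds 0. integral C (\<lambda>x. h (x + t *\<^sub>R e)) = integral (cbox a b) h"
      using int by (auto simp: eventually_nhds_metric dist_real_def intro!: exI[of _ 1])
    then have "((\<lambda>t. integral C (\<lambda>x. h (x + t *\<^sub>R e))) has_real_derivative 0) (at 0)"
      by (subst DERIV_cong_ev[OF refl _ refl]) auto
    then show ?thesis by (rule has_field_derivative_at_within)
  qed
  ultimately have "integral C (\<lambda>x. D (x + 0 *\<^sub>R e)) = 0"
    by (rule has_field_derivative_unique) (auto simp: trivial_limit_within islimpt_Icc)
  moreover have "integral C D = integral (cbox a b) D"
  proof (rule integral_unique, rule has_integral_on_superset)
    show "(D has_integral integral (cbox a b) D) (cbox a b)"
      using D by (intro integrable_integral integrable_continuous) (auto intro: continuous_on_subset)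
    show "cbox a b \<subseteq> C" using C[of 0] by simp
  qed (use zero in auto)
  ultimately show ?thesis by simp
qed

text \<open>\<open>V\<close> is regular on \<open>S\<close> only. Its product with the bump extends
  by zero, and the extension is regular because the open set \<open>S\<close> and the complement of
  the box cover the space.\<close>

lemma integral_by_parts_bump:
  fixes V dV :: "real^'n \<Rightarrow> real"
  assumes \<psi>: "\<psi> \<in> tensor_bumps a b" and S: "open S" "cbox a b \<subseteq> S"
    and V: "continuous_on S V" "continuous_on S dV"
    and der: "\<And>x. x \<in> S \<Longrightarrow> ((\<lambda>t. V (x + t *\<^sub>R axis i 1)) has_real_derivative dV x) (at 0)"
  shows "integral (cbox a b) (\<lambda>x. V x * partial i \<psi> x) = - integral (cbox a b) (\<lambda>x. dV x * \<psi> x)"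
proof -
  note d\<psi> = tensor_bumps_partial[OF \<psi>, where i=i]
  have zero: "\<psi> x = 0" "partial i \<psi> x = 0" if "x \<notin> cbox a b" for x
    using that \<psi> d\<psi>(1) tensor_bumps_zero box_subset_cbox by blast+
  define h where "h x = (if x \<in> S then V x * \<psi> x else 0)" for x
  define D where "D x = (if x \<in> S then dV x * \<psi> x + V x * partial i \<psi> x else 0)" for x
  have un: "S \<union> - cbox a b = UNIV" using S by auto
  have openC: "open (- cbox a b)" by auto
  have cont: "continuous_on UNIV k" if "continuous_on S k" "\<And>x. x \<notin> cbox a b \<Longrightarrow> k x = 0" for k :: "real^'n \<Rightarrow> real"
  proof -
    have "continuous_on (- cbox a b) k"
      by (rule continuous_on_eq[of _ "\<lambda>_. 0"]) (auto simp: that)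
    then show ?thesis
      using continuous_on_open_Un[OF S(1) openC that(1)] un by simp
  qed
  have "continuous_on S (\<lambda>x. V x * \<psi> x)" "continuous_on S (\<lambda>x. dV x * \<psi> x + V x * partial i \<psi> x)"
    by (intro continuous_intros V tensor_bumps_continuous[OF \<psi>] tensor_bumps_continuous[OF d\<psi>(1)])+
  then have "continuous_on S h" "continuous_on S D"
    by (auto simp: h_def D_def cong: continuous_on_cong)
  then have contU: "continuous_on UNIV h" "continuous_on UNIV D"
    using zero by (auto intro!: cont simp: h_def D_def)
  have "((\<lambda>t. h (x + t *\<^sub>R axis i 1)) has_real_derivative D x) (at 0)" for x
  proof (cases "x \<in> S")
    case True
    have "((\<lambda>t. V (x + t *\<^sub>R axis i 1) * \<psi> (x + t *\<^sub>R axis i 1)) has_real_derivative D x) (at 0)"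
      using DERIV_mult[OF der[OF True] d\<psi>(2)[of x]] True by (simp add: D_def algebra_simps)
    moreover have "\<forall>\<^sub>F t in nhds 0. x + t *\<^sub>R axis i 1 \<in> S"
    proof -
      have "((\<lambda>t. x + t *\<^sub>R axis i 1) \<longlongrightarrow> x + 0 *\<^sub>R axis i 1) (nhds (0::real))"
        by (intro tendsto_intros filterlim_ident)
      then show ?thesis using S(1) True by (auto simp: tendsto_def)
    qed
    then have "\<forall>\<^sub>F t in nhds 0. h (x + t *\<^sub>R axis i 1) = V (x + t *\<^sub>R axis i 1) * \<psi> (x + t *\<^sub>R axis i 1)"
      by eventually_elim (simp add: h_def)
    ultimately show ?thesis by (subst DERIV_cong_ev[OF refl _ refl]) auto
  next
    case False
    then have "x \<in> - cbox a b" using S by auto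
    have "((\<lambda>t. x + t *\<^sub>R axis i 1) \<longlongrightarrow> x + 0 *\<^sub>R axis i 1) (nhds (0::real))"
      by (intro tendsto_intros filterlim_ident)
    then have "\<forall>\<^sub>F t in nhds 0. x + t *\<^sub>R axis i 1 \<in> - cbox a b"
      using \<open>x \<in> - cbox a b\<close> openC by (auto simp: tendsto_def)
    then have "\<forall>\<^sub>F t in nhds 0. h (x + t *\<^sub>R axis i 1) = 0"
      by eventually_elim (simp add: h_def zero)
    moreover have "D x = 0" using False by (simp add: D_def)
    ultimately show ?thesis by (subst DERIV_cong_ev[OF refl _ refl]) auto
  qed
  then have "integral (cbox a b) D = 0"
    by (rule integral_directional_derivative_zero) (use contU zero in \<open>auto simp: h_def D_def\<close>)
  moreover have "integral (cbox a b) D = integral (cbox a b) (\<lambda>x. dV x * \<psi> x + V x * partial i \<psi> x)"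
    using S(2) by (intro integral_cong) (auto simp: D_def)
  moreover have "integral (cbox a b) (\<lambda>x. dV x * \<psi> x + V x * partial i \<psi> x)
      = integral (cbox a b) (\<lambda>x. dV x * \<psi> x) + integral (cbox a b) (\<lambda>x. V x * partial i \<psi> x)"
    by (intro integral_add integrable_continuous continuous_intros continuous_on_subset[OF V(1) S(2)] continuous_on_subset[OF V(2) S(2)]
         tensor_bumps_continuous[OF \<psi>] tensor_bumps_continuous[OF d\<psi>(1)])
  ultimately show ?thesis by simp
qed

definition std_bump :: "real^'n \<Rightarrow> real^'n \<Rightarrow> real^'n::finite \<Rightarrow> real" where
  "std_bump a b x = (\<Prod>i\<in>UNIV. flat 1 (x $ i - a $ i) * flat 1 (b $ i - x $ i))"

lemma std_bump_in: "std_bump a b \<in> tensor_bumps a b"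
  unfolding tensor_bumps_def std_bump_def
  by (auto intro!: exI[of _ "\<lambda>i t. flat 1 (t - a $ i) * flat 1 (b $ i - t)"] bumps.base)

lemma std_bump_pos: "x \<in> box a b \<Longrightarrow> std_bump a b x > 0"
  by (auto simp: std_bump_def flat_def mem_box_cart intro!: prod_pos)

lemma du_Bois_Reymond_at:
  fixes h :: "real^'n \<Rightarrow> real"
  assumes S: "open S" "x0 \<in> S" and h: "continuous_on S h"
    and int: "\<And>a b \<psi>. cbox a b \<subseteq> S \<Longrightarrow> \<psi> \<in> tensor_bumps a b \<Longrightarrow> integral (cbox a b) (\<lambda>x. h x * \<psi> x) = 0"
  shows "h x0 = 0"
proof -
  have False if "s * h x0 > 0" "s = 1 \<or> s = -1" for s :: real
  proof -
    have "open {x\<in>S. s * h x > 0}"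
      using continuous_open_preimage[OF continuous_on_mult[OF continuous_on_const h] S(1), of "{0<..}" s]
      by (simp add: vimage_def Int_def)
    moreover have "x0 \<in> {x\<in>S. s * h x > 0}" using that S by auto
    \<comment> \<open>On a box where \<open>s * h\<close> is positive the standard bump would have a
      positive integral against it; the factor \<open>s\<close> treats both signs at once.\<close>
    ultimately obtain a b where ab: "cbox a b \<subseteq> {x\<in>S. s * h x > 0}" "x0 \<in> box a b" "\<forall>i\<in>Basis. a \<bullet> i < b \<bullet> i"
      by (rule open_contains_cbox)
    let ?\<psi> = "std_bump a b"
    have "integral (cbox a b) (\<lambda>x. 0) < integral (cbox a b) (\<lambda>x. s * (h x * ?\<psi> x))"
    proof (rule integral_less)
      show "continuous_on (cbox a b) (\<lambda>x. s * (h x * ?\<psi> x))"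
        using ab by (intro continuous_intros tensor_bumps_continuous[OF std_bump_in] continuous_on_subset[OF h]) auto
      fix x assume x: "x \<in> box a b"
      then have "s * h x > 0" using ab box_subset_cbox by blast
      then have "s * h x * ?\<psi> x > 0" using std_bump_pos[OF x] by (rule mult_pos_pos)
      then show "0 < s * (h x * ?\<psi> x)" by (simp add: mult.assoc)
    qed (use ab in auto)
    moreover have "integral (cbox a b) (\<lambda>x. s * (h x * ?\<psi> x)) = 0"
      using int[of a b ?\<psi>] ab std_bump_in by auto
    ultimately show False by auto
  qed
  from this[of 1] this[of "-1"] show ?thesis by (cases "h x0" "0::real" rule: linorder_cases) auto
qed

section \<open>From the weak to the pointwise equation\<close>

lemma integral_supported_cbox:
  fixes h :: "real^'n \<Rightarrow> real"
  assumes "cbox a b \<subseteq> \<Omega>" "\<And>x. x \<notin> cbox a b \<Longrightarrow> h x = 0"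
  shows "integral \<Omega> h = integral (cbox a b) h"
proof -
  have "(\<lambda>x. if x \<in> cbox a b then h x else 0) = h" using assms(2) by auto
  then show ?thesis
    using integral_restrict_Int[of \<Omega> "cbox a b" h] assms(1) by (simp add: Int_absorb1 Int_absorb2)
qed

lemma weak_divergence_pointwise:
  fixes V :: "real^'n \<Rightarrow> real^'n" and dV :: "'n \<Rightarrow> real^'n \<Rightarrow> real" and k :: "real^'n \<Rightarrow> real"
  assumes S: "open S" "S \<subseteq> \<Omega>" "x0 \<in> S"
    and V: "\<And>i. continuous_on S (\<lambda>x. V x $ i)" "\<And>i. continuous_on S (dV i)"
    and der: "\<And>i x. x \<in> S \<Longrightarrow> ((\<lambda>t. V (x + t *\<^sub>R axis i 1) $ i) has_real_derivative dV i x) (at 0)"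
    and k: "continuous_on S k"
    and weak: "\<And>\<psi>. test_fn \<psi> \<Omega> \<Longrightarrow> integral \<Omega> (\<lambda>x. V x \<bullet> grad \<psi> x) = integral \<Omega> (\<lambda>x. k x * \<psi> x)"
  shows "(\<Sum>i\<in>UNIV. dV i x0) + k x0 = 0"
proof (rule du_Bois_Reymond_at[OF S(1,3)])
  show "continuous_on S (\<lambda>x. (\<Sum>i\<in>UNIV. dV i x) + k x)"
    by (intro continuous_intros V k)
  fix a b \<psi> assume ab: "cbox a b \<subseteq> S" and \<psi>: "\<psi> \<in> tensor_bumps a b"
  let ?I = "integral (cbox a b)"
  have zero: "\<psi> x = 0" "grad \<psi> x = 0" if "x \<notin> cbox a b" for x
    using that \<psi> tensor_bumps_partial(1)[OF \<psi>] tensor_bumps_zero box_subset_cbox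
    by (auto simp: grad_def vec_eq_iff) blast+
  have V': "continuous_on (cbox a b) (\<lambda>x. V x $ i)" "continuous_on (cbox a b) (dV i)" for i
    using V ab continuous_on_subset by blast+
  have k': "continuous_on (cbox a b) k" using k ab continuous_on_subset by blast
  note c = V' k' tensor_bumps_continuous[OF \<psi>] tensor_bumps_continuous[OF tensor_bumps_partial(1)[OF \<psi>]]
  have "?I (\<lambda>x. k x * \<psi> x) = ?I (\<lambda>x. V x \<bullet> grad \<psi> x)"
  proof -
    have ab': "cbox a b \<subseteq> \<Omega>" using ab S(2) by auto
    have "integral \<Omega> (\<lambda>x. V x \<bullet> grad \<psi> x) = ?I (\<lambda>x. V x \<bullet> grad \<psi> x)"
      "integral \<Omega> (\<lambda>x. k x * \<psi> x) = ?I (\<lambda>x. k x * \<psi> x)"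
      by (rule integral_supported_cbox[OF ab']; simp add: zero)+
    then show ?thesis using weak[OF tensor_bumps_test_fn[OF \<psi> ab']] by simp
  qed
  also have "\<dots> = ?I (\<lambda>x. \<Sum>i\<in>UNIV. V x $ i * partial i \<psi> x)"
    by (simp add: inner_vec_def grad_def)
  also have "\<dots> = (\<Sum>i\<in>UNIV. ?I (\<lambda>x. V x $ i * partial i \<psi> x))"
    by (intro integral_sum integrable_continuous continuous_intros c) auto
  also have "\<dots> = (\<Sum>i\<in>UNIV. - ?I (\<lambda>x. dV i x * \<psi> x))"
    by (intro sum.cong refl integral_by_parts_bump[OF \<psi> S(1) ab]) (auto intro: V der)
  also have "\<dots> = - ?I (\<lambda>x. \<Sum>i\<in>UNIV. dV i x * \<psi> x)"
    by (subst integral_sum) (auto intro!: integrable_continuous continuous_intros c simp: sum_negf)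
  finally have "?I (\<lambda>x. \<Sum>i\<in>UNIV. dV i x * \<psi> x) + ?I (\<lambda>x. k x * \<psi> x) = 0" by simp
  moreover have "?I (\<lambda>x. (\<Sum>i\<in>UNIV. dV i x * \<psi> x) + k x * \<psi> x)
      = ?I (\<lambda>x. \<Sum>i\<in>UNIV. dV i x * \<psi> x) + ?I (\<lambda>x. k x * \<psi> x)"
    by (intro integral_add integrable_continuous continuous_intros c)
  ultimately show "?I (\<lambda>x. ((\<Sum>i\<in>UNIV. dV i x) + k x) * \<psi> x) = 0"
    by (simp add: sum_distrib_right distrib_right)
qed

lemma bounded_bilinear_matrix_vector_mult: "bounded_bilinear ((*v) :: real^'n^'m \<Rightarrow> real^'n \<Rightarrow> real^'m)"
  unfolding bilinear_conv_bounded_bilinear[symmetric] bilinear_def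
  by (auto intro!: linearI simp: matrix_vector_mult_add_rdistrib matrix_vector_right_distrib scaleR_matrix_vector_assoc
      matrix_vector_mult_scaleR)

lemma Ck_on_hess_continuous:
  fixes u :: "real^'n \<Rightarrow> real"
  assumes "Ck_on k u \<Omega>" "2 \<le> k"
  shows "continuous_on \<Omega> (hess u)" "continuous_on \<Omega> (grad u)" "continuous_on \<Omega> u"
proof -
  have *: "continuous_on \<Omega> (Dp is u)" if "length is \<le> 2" for "is"
    using assms that by (auto simp: Ck_on_def)
  show "continuous_on \<Omega> (hess u)" unfolding hess_def
    by (intro continuous_on_vec_lambda *) auto
  have "continuous_on \<Omega> (partial i u)" for i using *[of "[i]"] by simp
  then show "continuous_on \<Omega> (grad u)" unfolding grad_def
    by (intro continuous_on_vec_lambda)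
  show "continuous_on \<Omega> u" using *[of "[]"] by simp
qed

text \<open>The flux |grad u|^(p-2) grad u can be differentiated off the critical points, so the
  equation is tested on the open set \<open>S\<close> where \<open>W\<close> is positive. Powers of
  \<open>W\<close> instead of powers of the norm keep the chain rule polynomial in the
  gradient.\<close>

lemma p_laplace_pointwise:
  fixes u :: "real^'n \<Rightarrow> real"
  assumes \<Omega>: "open \<Omega>" and u: "Ck_on k u \<Omega>" "2 \<le> k" and eq: "p_laplace_eq p f u \<Omega>"
    and f: "continuous_on UNIV f" and x: "x \<in> \<Omega>" "grad u x \<noteq> 0"
  defines "W \<equiv> \<lambda>x. grad u x \<bullet> grad u x"
  shows "W x powr (p/2 - 1) * trace (hess u x)
     + (p - 2) * W x powr (p/2 - 2) * ((hess u x *v grad u x) \<bullet> grad u x) + f (u x) = 0"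
proof -
  note cont = Ck_on_hess_continuous[OF u]
  define S where "S = {x\<in>\<Omega>. W x > 0}"
  have Wc: "continuous_on \<Omega> W" unfolding W_def by (intro continuous_intros cont)
  have S: "open S" "S \<subseteq> \<Omega>" "x \<in> S"
    using continuous_open_preimage[OF Wc \<Omega>, of "{0<..}"] x
    by (auto simp: S_def vimage_def Int_def W_def)
  have cS: "continuous_on S (hess u)" "continuous_on S (grad u)" "continuous_on S u" "continuous_on S W"
    using cont Wc S(2) continuous_on_subset by blast+
  define V where "V y = norm (grad u y) powr (p - 2) *\<^sub>R grad u y" for y
  define dV where "dV i y = (p - 2) * W y powr (p/2 - 2) * ((hess u y *v grad u y) $ i * grad u y $ i)
     + W y powr (p/2 - 1) * hess u y $ i $ i" for i y
  have Weq: "V y = W y powr (p/2 - 1) *\<^sub>R grad u y" for y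
  proof -
    have "W y = norm (grad u y) powr 2"
      by (simp add: W_def power2_norm_eq_inner)
    then have "W y powr (p/2 - 1) = (norm (grad u y) powr 2) powr (p/2 - 1)" by (simp only:)
    also have "\<dots> = norm (grad u y) powr (2 * (p/2 - 1))" by (rule powr_powr)
    also have "2 * (p/2 - 1) = p - 2" by simp
    finally show ?thesis by (simp add: V_def)
  qed
  have Spos: "W y > 0" "y \<in> \<Omega>" if "y \<in> S" for y using that by (auto simp: S_def)
  have der: "((\<lambda>y. V y $ i) has_derivative (\<lambda>h. (p - 2) * W y powr (p/2 - 2) * ((hess u y *v grad u y) \<bullet> h) * grad u y $ i
      + W y powr (p/2 - 1) * (hess u y *v h) $ i)) (at y)" if "y \<in> S" for y i
  proof -
    have g: "(grad u has_derivative (\<lambda>h. hess u y *v h)) (at y)"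
      by (rule Ck_on_has_derivative_hess[OF u(1) \<Omega> u(2) Spos(2)[OF that]])
    have gi: "((\<lambda>z. grad u z $ i) has_derivative (\<lambda>h. (hess u y *v h) $ i)) (at y)"
      using bounded_linear.has_derivative[OF bounded_linear_vec_nth g] .
    have "(W has_derivative (\<lambda>h. grad u y \<bullet> (hess u y *v h) + (hess u y *v h) \<bullet> grad u y)) (at y)"
      unfolding W_def by (rule has_derivative_inner[OF g g])
    then have Wd: "(W has_derivative (\<lambda>h. 2 * ((hess u y *v grad u y) \<bullet> h))) (at y)"
      by (simp add: inner_commute[of "hess u y *v _" "grad u y"] inner_hess_commute[OF u(1) \<Omega> u(2) Spos(2)[OF that]])
    have "((\<lambda>z. W z powr (p/2 - 1)) has_derivative (\<lambda>h. (p/2 - 1) * W y powr (p/2 - 1 - 1) * (2 * ((hess u y *v grad u y) \<bullet> h)))) (at y)"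
      using has_derivative_compose[OF Wd, where g="\<lambda>w. w powr (p/2 - 1)" and g'="\<lambda>h. (p/2 - 1) * W y powr (p/2 - 1 - 1) * h"]
        has_real_derivative_powr[OF Spos(1)[OF that], of "p/2 - 1"]
      by (simp add: has_field_derivative_def)
    from has_derivative_mult[OF this gi] show ?thesis
      unfolding Weq by (simp add: algebra_simps)
  qed
  have "(\<Sum>i\<in>UNIV. dV i x) + f (u x) = 0"
  proof (rule weak_divergence_pointwise[where V=V and k="\<lambda>x. f (u x)", OF S])
    show "continuous_on S (\<lambda>x. V x $ i)" for i
      unfolding Weq using Spos by (intro continuous_intros cS) fastforce+
    show "continuous_on S (dV i)" for i
      unfolding dV_def using Spos
      by (intro continuous_intros cS bounded_bilinear.continuous_on[OF bounded_bilinear_matrix_vector_mult]) fastforce+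
    show "continuous_on S (\<lambda>x. f (u x))"
      by (rule continuous_on_compose2[OF f cS(3)]) auto
    show "integral \<Omega> (\<lambda>x. V x \<bullet> grad \<psi> x) = integral \<Omega> (\<lambda>x. f (u x) * \<psi> x)" if "test_fn \<psi> \<Omega>" for \<psi>
      using eq that by (simp add: p_laplace_eq_def V_def)
    show "((\<lambda>t. V (y + t *\<^sub>R axis i 1) $ i) has_real_derivative dV i y) (at 0)" if "y \<in> S" for i y
      using has_derivative_direction[OF der[OF that, of i], of "axis i 1"]
      by (simp add: matrix_vector_mult_basis column_def dV_def inner_axis algebra_simps)
  qed
  then show ?thesis
    by (simp add: dV_def sum.distrib trace_def inner_vec_def add_ac flip: sum_distrib_left)
qed

section \<open>Second-order contact and the operator\<close>

text \<open>The gradient field has to be differentiable at the single point \<open>x\<close> only,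
  which is all that a maximum test uses. \<open>H\<close> is a map and not a matrix, so that sums
  and compositions of such data are written down directly.\<close>

definition twice_at :: "('a::real_inner \<Rightarrow> real) \<Rightarrow> 'a \<Rightarrow> 'a \<Rightarrow> ('a \<Rightarrow> 'a) \<Rightarrow> bool" where
  "twice_at \<phi> x G H \<longleftrightarrow> (\<exists>Gf S. open S \<and> x \<in> S \<and> (\<forall>y\<in>S. (\<phi> has_derivative (\<lambda>h. Gf y \<bullet> h)) (at y)) \<and>
     Gf x = G \<and> (Gf has_derivative H) (at x))"

lemma eventually_line_in_open:
  fixes x :: "'a::real_normed_vector"
  assumes "open S" "x \<in> S"
  shows "\<forall>\<^sub>F t in nhds (0::real). x + t *\<^sub>R v \<in> S"
proof -
  have "((\<lambda>t. x + t *\<^sub>R v) \<longlongrightarrow> x + 0 *\<^sub>R v) (nhds (0::real))"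
    by (intro tendsto_intros filterlim_ident)
  then show ?thesis using assms by (auto simp: tendsto_def)
qed

lemma twice_atI:
  assumes "open S" "x \<in> S" "\<And>y. y \<in> S \<Longrightarrow> (\<phi> has_derivative (\<lambda>h. Gf y \<bullet> h)) (at y)"
    "Gf x = G" "(Gf has_derivative H) (at x)"
  shows "twice_at \<phi> x G H"
  unfolding twice_at_def using assms by blast

lemma twice_at_linear: "twice_at \<phi> x G H \<Longrightarrow> linear H"
  unfolding twice_at_def by (blast dest: has_derivative_linear)

lemma twice_at_has_derivative: "twice_at \<phi> x G H \<Longrightarrow> (\<phi> has_derivative (\<lambda>h. G \<bullet> h)) (at x)"
  unfolding twice_at_def by blast

lemma twice_at_local_max:
  fixes \<phi> :: "'a::euclidean_space \<Rightarrow> real"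
  assumes t: "twice_at \<phi> x G H" and max: "\<forall>\<^sub>F y in nhds x. \<phi> y \<le> \<phi> x"
  shows "G = 0" "v \<bullet> H v \<le> 0"
proof -
  obtain Gf S where S: "open S" "x \<in> S" "\<And>y. y \<in> S \<Longrightarrow> (\<phi> has_derivative (\<lambda>h. Gf y \<bullet> h)) (at y)"
    "Gf x = G" "(Gf has_derivative H) (at x)"
    using t unfolding twice_at_def by blast
  obtain e where e: "e > 0" "\<And>y. dist y x < e \<Longrightarrow> \<phi> y \<le> \<phi> x"
    using max by (auto simp: eventually_nhds_metric)
  have "(\<lambda>h. G \<bullet> h) = (\<lambda>h. 0)"
    by (rule has_derivative_local_max[of \<phi> _ x])
       (use max S in \<open>auto simp: eventually_at_filter elim: eventually_mono\<close>)
  then have "G \<bullet> G = 0" by meson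
  then show G: "G = 0" by simp
  show "v \<bullet> H v \<le> 0"
  proof (rule ccontr)
    assume "\<not> v \<bullet> H v \<le> 0"
    \<comment> \<open>The derivative along \<open>v\<close> vanishes at \<open>x\<close>; if its own
      derivative were positive, \<open>\<phi>\<close> would increase right after
      \<open>x\<close>.\<close>
    then have pos: "v \<bullet> H v > 0" by simp
    have "((\<lambda>y. Gf y \<bullet> v) has_derivative (\<lambda>h. H h \<bullet> v)) (at x)"
      by (rule has_derivative_inner_left[OF S(5)])
    from has_derivative_direction[OF this, of v]
    have "((\<lambda>t. Gf (x + t *\<^sub>R v) \<bullet> v) has_real_derivative v \<bullet> H v) (at 0)" by (simp add: inner_commute)
    from DERIV_pos_inc_right[OF this pos]
    obtain d where d: "d > 0" "\<And>h. 0 < h \<Longrightarrow> h < d \<Longrightarrow> Gf (x + h *\<^sub>R v) \<bullet> v > 0"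
      using S(4) G by auto
    have "\<forall>\<^sub>F t in nhds 0. x + t *\<^sub>R v \<in> S \<inter> ball x e"
      by (rule eventually_line_in_open) (use S e in auto)
    then obtain d' where d': "d' > 0" "\<And>t. \<bar>t\<bar> < d' \<Longrightarrow> x + t *\<^sub>R v \<in> S \<inter> ball x e"
      by (auto simp: eventually_nhds_metric)
    define s where "s = min d d' / 2"
    have s: "0 < s" "s < d" "s < d'" using d d' by (auto simp: s_def)
    have der: "((\<lambda>t. \<phi> (x + t *\<^sub>R v)) has_real_derivative Gf (x + t *\<^sub>R v) \<bullet> v) (at t)" if "\<bar>t\<bar> < d'" for t
    proof -
      have "((\<lambda>r. \<phi> (x + t *\<^sub>R v + r *\<^sub>R v)) has_real_derivative Gf (x + t *\<^sub>R v) \<bullet> v) (at 0)"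
        using has_derivative_direction[OF S(3), of "x + t *\<^sub>R v" v] d'(2)[OF that] by auto
      then have "((\<lambda>r. \<phi> (x + (r + t) *\<^sub>R v)) has_real_derivative Gf (x + t *\<^sub>R v) \<bullet> v) (at 0)"
        by (simp add: algebra_simps)
      then show ?thesis using DERIV_shift[of "\<lambda>t. \<phi> (x + t *\<^sub>R v)" _ 0 t] by simp
    qed
    have "\<exists>z>0. z < s \<and> \<phi> (x + s *\<^sub>R v) - \<phi> (x + 0 *\<^sub>R v) = (s - 0) * (Gf (x + z *\<^sub>R v) \<bullet> v)"
      by (rule MVT2[OF s(1)]) (use s der in auto)
    then obtain z where z: "0 < z" "z < s" "\<phi> (x + s *\<^sub>R v) - \<phi> x = s * (Gf (x + z *\<^sub>R v) \<bullet> v)" by auto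
    have "s * (Gf (x + z *\<^sub>R v) \<bullet> v) > 0" using d z s by (intro mult_pos_pos) auto
    moreover have "\<phi> (x + s *\<^sub>R v) \<le> \<phi> x" using d'(2)[of s] s e by (auto simp: dist_commute)
    ultimately show False using z by simp
  qed
qed

lemma twice_at_add:
  assumes "twice_at \<phi> x G H" "twice_at \<psi> x G' H'"
  shows "twice_at (\<lambda>y. \<phi> y + \<psi> y) x (G + G') (\<lambda>h. H h + H' h)"
proof -
  obtain Gf S where S: "open S" "x \<in> S" "\<And>y. y \<in> S \<Longrightarrow> (\<phi> has_derivative (\<lambda>h. Gf y \<bullet> h)) (at y)"
    "Gf x = G" "(Gf has_derivative H) (at x)"
    using assms unfolding twice_at_def by blast
  obtain Gf' S' where S': "open S'" "x \<in> S'" "\<And>y. y \<in> S' \<Longrightarrow> (\<psi> has_derivative (\<lambda>h. Gf' y \<bullet> h)) (at y)"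
    "Gf' x = G'" "(Gf' has_derivative H') (at x)"
    using assms unfolding twice_at_def by blast
  show ?thesis
  proof (rule twice_atI[of "S \<inter> S'"])
    fix y assume "y \<in> S \<inter> S'"
    then show "((\<lambda>y. \<phi> y + \<psi> y) has_derivative (\<lambda>h. (Gf y + Gf' y) \<bullet> h)) (at y)"
      using has_derivative_add[OF S(3)[of y] S'(3)[of y]] by (simp add: inner_add_left)
  qed (use S S' in \<open>auto intro!: has_derivative_add\<close>)
qed

lemma twice_at_compose:
  assumes "twice_at \<phi> x G H"
    and T: "open T" "\<phi> x \<in> T" "\<And>s. s \<in> T \<Longrightarrow> (k has_real_derivative k' s) (at s)"
    and k2: "(k' has_real_derivative k'') (at (\<phi> x))"
  shows "twice_at (\<lambda>y. k (\<phi> y)) x (k' (\<phi> x) *\<^sub>R G) (\<lambda>h. (k'' * (G \<bullet> h)) *\<^sub>R G + k' (\<phi> x) *\<^sub>R H h)"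
proof -
  obtain Gf S where S: "open S" "x \<in> S" "\<And>y. y \<in> S \<Longrightarrow> (\<phi> has_derivative (\<lambda>h. Gf y \<bullet> h)) (at y)"
    "Gf x = G" "(Gf has_derivative H) (at x)"
    using assms(1) unfolding twice_at_def by blast
  have "continuous_on S \<phi>"
    using S(3) by (intro continuous_at_imp_continuous_on) (blast intro: has_derivative_continuous)
  then have op: "open (S \<inter> \<phi> -` T)" using S(1) T(1) by (intro continuous_open_preimage)
  have 1: "((\<lambda>y. k (\<phi> y)) has_derivative (\<lambda>h. (k' (\<phi> y) *\<^sub>R Gf y) \<bullet> h)) (at y)" if "y \<in> S \<inter> \<phi> -` T" for y
    using has_derivative_compose[OF S(3)[of y], of k "\<lambda>h. k' (\<phi> y) * h"] T(3)[of "\<phi> y"] that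
    by (simp add: has_field_derivative_def)
  have "((\<lambda>y. k' (\<phi> y)) has_derivative (\<lambda>h. k'' * (G \<bullet> h))) (at x)"
    using has_derivative_compose[OF S(3)[OF S(2)], of k' "\<lambda>h. k'' * h"] k2 S(4)
    by (simp add: has_field_derivative_def)
  from has_derivative_scaleR[OF this S(5)] S(4)
  have 2: "((\<lambda>y. k' (\<phi> y) *\<^sub>R Gf y) has_derivative (\<lambda>h. (k'' * (G \<bullet> h)) *\<^sub>R G + k' (\<phi> x) *\<^sub>R H h)) (at x)"
    by (simp add: add.commute)
  show ?thesis
    by (rule twice_atI[OF op _ 1 _ 2]) (use S T in auto)
qed

lemma twice_at_cmult:
  assumes "twice_at \<phi> x G H"
  shows "twice_at (\<lambda>y. c * \<phi> y) x (c *\<^sub>R G) (\<lambda>h. c *\<^sub>R H h)"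
  using twice_at_compose[OF assms, of UNIV "\<lambda>s. c * s" "\<lambda>s. c" 0]
  by (auto intro!: derivative_eq_intros)

lemma twice_at_sqdist:
  "twice_at (\<lambda>y. (y - a) \<bullet> (y - a)) x (2 *\<^sub>R (x - a)) (\<lambda>h. 2 *\<^sub>R h)"
  by (rule twice_atI[of UNIV _ _ "\<lambda>y. 2 *\<^sub>R (y - a)"])
     (auto intro!: derivative_eq_intros simp: inner_diff_left inner_diff_right inner_commute algebra_simps)

text \<open>Contraction of \<open>H\<close> with I + (p - 2) g g^T / |g|^2, the coefficient matrix
  of the p-Laplacian in nondivergence form divided by |g|^(p-2). Its eigenvalue is p - 1 along
  \<open>g\<close> and 1 across.\<close>

definition ell :: "real \<Rightarrow> real^'n \<Rightarrow> (real^'n \<Rightarrow> real^'n::finite) \<Rightarrow> real" where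
  "ell p g H = (\<Sum>i\<in>UNIV. H (axis i 1) $ i) + (p - 2) * (g \<bullet> H g) / (g \<bullet> g)"

text \<open>The quadratic form of the same matrix; it is what \<open>ell\<close> makes of a rank-one
  Hessian.\<close>

definition aform :: "real \<Rightarrow> real^'n \<Rightarrow> real^'n::finite \<Rightarrow> real" where
  "aform p g v = v \<bullet> v + (p - 2) * (v \<bullet> g)\<^sup>2 / (g \<bullet> g)"

lemma ell_add: "ell p g (\<lambda>h. H h + K h) = ell p g H + ell p g K"
  by (simp add: ell_def sum.distrib inner_add_right algebra_simps add_divide_distrib diff_divide_distrib)

lemma ell_scaleR: "ell p g (\<lambda>h. c *\<^sub>R H h) = c * ell p g H"
  by (simp add: ell_def sum_distrib_left algebra_simps diff_divide_distrib)

lemma ell_id: "g \<noteq> 0 \<Longrightarrow> ell p g (\<lambda>h. h) = real CARD('n) + (p - 2)" for g :: "real^'n"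
  by (simp add: ell_def)

lemma ell_rank1: "ell p g (\<lambda>h. (v \<bullet> h) *\<^sub>R v) = aform p g v"
  by (simp add: ell_def aform_def inner_axis power2_eq_square inner_commute) (simp add: inner_vec_def)

lemma aform_bounds:
  assumes "g \<noteq> 0"
  shows "min 1 (p - 1) * (v \<bullet> v) \<le> aform p g v" "aform p g v \<le> max 1 (p - 1) * (v \<bullet> v)"
proof -
  define r where "r = (v \<bullet> g)\<^sup>2 / (g \<bullet> g)"
  have W: "g \<bullet> g > 0" using assms by simp
  have r: "0 \<le> r" "r \<le> v \<bullet> v"
    using W Cauchy_Schwarz_ineq[of v g] by (auto simp: r_def field_simps)
  have a: "aform p g v = v \<bullet> v + (p - 2) * r" by (simp add: aform_def r_def)
  show "min 1 (p - 1) * (v \<bullet> v) \<le> aform p g v"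
  proof (cases "p \<ge> 2")
    case True
    then have "(p - 2) * r \<ge> 0" using r by simp
    then show ?thesis using True a by (simp add: min_def)
  next
    case False
    then have "(2 - p) * r \<le> (2 - p) * (v \<bullet> v)" using r by (intro mult_left_mono) auto
    then show ?thesis using False a by (simp add: min_def algebra_simps)
  qed
  show "aform p g v \<le> max 1 (p - 1) * (v \<bullet> v)"
  proof (cases "p \<ge> 2")
    case True
    then have "(p - 2) * r \<le> (p - 2) * (v \<bullet> v)" using r by (intro mult_left_mono) auto
    then show ?thesis using True a by (simp add: max_def algebra_simps)
  next
    case False
    then have "(p - 2) * r \<le> 0" using r by (intro mult_nonpos_nonneg) auto
    then show ?thesis using False a by (simp add: max_def)
  qed
qed

text \<open>The vectors in the sum are the axes projected onto the orthogonal complement of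
  \<open>g\<close>, so the sum is the trace of \<open>H\<close> there. This yields the sign in
  \<open>ell_nonpos\<close> without symmetry of \<open>H\<close>; with p = 2 it later splits a plain
  trace into tangential and normal parts.\<close>

lemma ell_decomp:
  fixes H :: "real^'n \<Rightarrow> real^'n"
  assumes "linear H" "g \<noteq> 0"
  shows "ell p g H = (\<Sum>i\<in>UNIV. (axis i 1 - (g $ i / (g \<bullet> g)) *\<^sub>R g) \<bullet> H (axis i 1 - (g $ i / (g \<bullet> g)) *\<^sub>R g))
      + (p - 1) * (g \<bullet> H g) / (g \<bullet> g)"
proof -
  interpret linear H by fact
  define W where "W = g \<bullet> g"
  have W: "W > 0" using assms by (simp add: W_def)
  have g: "(\<Sum>i\<in>UNIV. g $ i *\<^sub>R axis i 1) = g"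
    by (simp add: vec_eq_iff axis_def if_distrib sum.delta cong: if_cong)
  have "(\<Sum>i\<in>UNIV. g $ i * (g \<bullet> H (axis i 1))) = g \<bullet> H (\<Sum>i\<in>UNIV. g $ i *\<^sub>R axis i 1)"
    by (simp add: sum scaleR inner_sum_right)
  then have 1: "(\<Sum>i\<in>UNIV. g $ i * (g \<bullet> H (axis i 1))) = g \<bullet> H g" by (simp add: g)
  have 2: "(\<Sum>i\<in>UNIV. g $ i * H g $ i) = g \<bullet> H g" by (simp add: inner_vec_def)
  have 3: "(\<Sum>i\<in>UNIV. g $ i * g $ i) = W" by (simp add: W_def inner_vec_def)
  have "(axis i 1 - (g $ i / W) *\<^sub>R g) \<bullet> H (axis i 1 - (g $ i / W) *\<^sub>R g)
     = H (axis i 1) $ i - (g $ i * H g $ i) / W - (g $ i * (g \<bullet> H (axis i 1))) / W + (g $ i * g $ i) * ((g \<bullet> H g) / (W * W))" for i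
    by (simp add: diff scaleR inner_diff_left inner_diff_right inner_axis' algebra_simps)
  then have "(\<Sum>i\<in>UNIV. (axis i 1 - (g $ i / W) *\<^sub>R g) \<bullet> H (axis i 1 - (g $ i / W) *\<^sub>R g))
     = (\<Sum>i\<in>UNIV. H (axis i 1) $ i) - (g \<bullet> H g) / W - (g \<bullet> H g) / W + W * ((g \<bullet> H g) / (W * W))"
    by (simp add: sum.distrib sum_subtractf 1 2 3 flip: sum_divide_distrib sum_distrib_right)
  also have "\<dots> = (\<Sum>i\<in>UNIV. H (axis i 1) $ i) - (g \<bullet> H g) / W"
    using W by simp
  finally show ?thesis using W
    by (simp add: ell_def algebra_simps diff_divide_distrib flip: W_def)
qed

lemma ell_nonpos:
  assumes "linear H" "g \<noteq> 0" "p > 1" "\<And>v. v \<bullet> H v \<le> 0"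
  shows "ell p g H \<le> 0"
proof -
  have "(p - 1) * (g \<bullet> H g) / (g \<bullet> g) \<le> 0"
    using assms by (intro divide_nonpos_nonneg mult_nonneg_nonpos) auto
  then show ?thesis unfolding ell_decomp[OF assms(1,2)]
    by (smt (verit) sum_nonpos assms(4))
qed

lemma ell_local_max:
  assumes "twice_at \<phi> x G H" "\<forall>\<^sub>F y in nhds x. \<phi> y \<le> \<phi> x" "g \<noteq> 0" "p > 1"
  shows "ell p g H \<le> 0" "G = 0"
  using twice_at_local_max[OF assms(1,2)] ell_nonpos[OF twice_at_linear[OF assms(1)] assms(3,4)] by auto

section \<open>The P-function\<close>

text \<open>The P-function computation stripped of calculus. With A the Hessian and g the gradient,
  \<open>\<tau>\<close>, \<open>\<sigma>\<close>, \<open>S\<close>, \<open>N\<close> stand for the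
  trace of A, the product of A g with g, |A g|^2 and |A|^2, and \<open>\<tau>3\<close>,
  \<open>\<theta>\<close> for contractions of the third derivatives along g. \<open>E1\<close> is
  the equation, \<open>E2\<close> its derivative along g; together they remove \<open>f'\<close> and
  the third derivatives and leave squares.\<close>

lemma P_function_algebra:
  fixes p w W \<sigma> \<tau> \<tau>3 \<theta> S N f f' :: real
  assumes W: "W > 0" "w > 0"
    and E1: "w / W * \<tau> + (p - 2) * (w / W\<^sup>2) * \<sigma> + f = 0"
    and E2: "(p - 2) * (w / W\<^sup>2) * \<sigma> * \<tau> + w / W * \<tau>3 + (p - 2) * ((p - 4) * (w / W ^ 3) * \<sigma>\<^sup>2 + w / W\<^sup>2 * (\<theta> + 2 * S)) + f' * W = 0"
  shows "(p - 1) * ((p - 2) * (w / W\<^sup>2) * (S + (p - 2) * \<sigma>\<^sup>2 / W) + w / W * (\<tau>3 + N + (p - 2) * (\<theta> + S) / W))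
      + f' * ((p - 1) * W) + f * (\<tau> + (p - 2) * \<sigma> / W) + p * f / w * ((p - 1) * (w / W) * \<sigma> + f * W)
    = (p - 1) * (w / W) * (2 * (S / W - \<sigma>\<^sup>2 / W\<^sup>2) + (N - 2 * S / W + \<sigma>\<^sup>2 / W\<^sup>2) + (\<tau> - \<sigma> / W)\<^sup>2)"
proof -
  \<comment> \<open>Named reciprocals turn the claim into a polynomial identity modulo the two
    equations and the relations \<open>qW\<close>, which is in the scope of
    \<open>algebra\<close>.\<close>
  define q v where "q = 1 / W" and "v = 1 / w"
  have qW: "q * W = 1" "v * w = 1" using W by (auto simp: q_def v_def)
  have E1': "w * q * \<tau> + (p - 2) * (w * q * q) * \<sigma> + f = 0"
    using E1 by (simp add: q_def power2_eq_square)
  have E2': "(p - 2) * (w * q * q) * \<sigma> * \<tau> + w * q * \<tau>3 + (p - 2) * ((p - 4) * (w * q * q * q) * \<sigma> * \<sigma> + w * q * q * (\<theta> + 2 * S)) + f' * W = 0"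
    using E2 by (simp add: q_def power2_eq_square power3_eq_cube mult.assoc)
  have "(p - 1) * ((p - 2) * (w * q * q) * (S + (p - 2) * \<sigma> * \<sigma> * q) + w * q * (\<tau>3 + N + (p - 2) * (\<theta> + S) * q))
      + f' * ((p - 1) * W) + f * (\<tau> + (p - 2) * \<sigma> * q) + p * f * v * ((p - 1) * (w * q) * \<sigma> + f * W)
    = (p - 1) * (w * q) * (2 * (S * q - \<sigma> * \<sigma> * q * q) + (N - 2 * S * q + \<sigma> * \<sigma> * q * q) + (\<tau> - \<sigma> * q) * (\<tau> - \<sigma> * q))"
    using E1' E2' qW by algebra
  then show ?thesis
    by (simp add: q_def v_def power2_eq_square power3_eq_cube mult.assoc)
qed

text \<open>Interior hypotheses only, enough for all differential identities and inequalities;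
  boundary data enter with \<open>overdet\<close>.\<close>

locale p_laplace =
  fixes \<Omega> :: "(real^'n) set" and u :: "real^'n \<Rightarrow> real" and f F :: "real \<Rightarrow> real" and p :: real
  assumes open_Omega: "open \<Omega>" and p1: "1 < p" and u3: "Ck_on 3 u \<Omega>"
    and f_diff: "\<And>s. f differentiable (at s)"
    and F_prim: "\<And>s. (F has_real_derivative f s) (at s)"
    and F_nonpos: "\<And>s. F s \<le> 0"
    and eq: "p_laplace_eq p f u \<Omega>"
begin

definition "W x = grad u x \<bullet> grad u x"
definition "w x = W x powr (p / 2)"
definition "P x = (p - 1) / p * w x + F (u x)"
definition "Ag x = hess u x *v grad u x"
definition "\<sigma> x = Ag x \<bullet> grad u x"

abbreviation "g \<equiv> grad u"
abbreviation "A \<equiv> hess u"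

section \<open>Derivatives of the quantities that make up the P-function\<close>

lemma f_deriv: "(f has_real_derivative deriv f s) (at s)"
  using f_diff[of s] by (metis DERIV_imp_deriv real_differentiable_def)

lemma f_cont: "continuous_on UNIV f"
  using f_deriv DERIV_isCont by (metis continuous_at_imp_continuous_on)

lemma W_nonneg: "W x \<ge> 0" by (simp add: W_def)
lemma W_pos: "W x > 0 \<longleftrightarrow> grad u x \<noteq> 0" by (simp add: W_def)
lemma w_pos: "W x > 0 \<Longrightarrow> w x > 0" by (simp add: w_def)

lemma W_powr:
  assumes "W x > 0"
  shows "W x powr (p / 2 - 1) = w x / W x" "W x powr (p / 2 - 2) = w x / (W x)\<^sup>2" "W x powr (p / 2 - 3) = w x / (W x) ^ 3"
  using assms by (simp_all add: w_def powr_diff)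

lemma has_derivative_u: "x \<in> \<Omega> \<Longrightarrow> (u has_derivative (\<lambda>h. g x \<bullet> h)) (at x)"
  using Ck_on_has_derivative_grad[OF u3 open_Omega] by simp

lemma has_derivative_g: "x \<in> \<Omega> \<Longrightarrow> (g has_derivative (\<lambda>h. A x *v h)) (at x)"
  using Ck_on_has_derivative_hess[OF u3 open_Omega] by simp

lemma has_derivative_A: "x \<in> \<Omega> \<Longrightarrow> (A has_derivative (\<lambda>h. third u x h)) (at x)"
  using Ck_on_has_derivative_third[OF u3 open_Omega] by simp

lemma A_commute: "x \<in> \<Omega> \<Longrightarrow> v \<bullet> (A x *v z) = (A x *v v) \<bullet> z"
  using inner_hess_commute[OF u3 open_Omega] by simp

lemma has_derivative_W: "x \<in> \<Omega> \<Longrightarrow> (W has_derivative (\<lambda>h. 2 * (Ag x \<bullet> h))) (at x)"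
proof -
  assume x: "x \<in> \<Omega>"
  have "(W has_derivative (\<lambda>h. g x \<bullet> (A x *v h) + (A x *v h) \<bullet> g x)) (at x)"
    unfolding W_def by (rule has_derivative_inner[OF has_derivative_g[OF x] has_derivative_g[OF x]])
  then show ?thesis
    by (simp add: inner_commute[of "A x *v _" "g x"] A_commute[OF x] Ag_def)
qed

lemma has_derivative_W_powr:
  assumes "x \<in> \<Omega>" "W x > 0"
  shows "((\<lambda>y. W y powr r) has_derivative (\<lambda>h. 2 * r * W x powr (r - 1) * (Ag x \<bullet> h))) (at x)"
proof -
  have "((\<lambda>w. w powr r) has_derivative (\<lambda>h. r * W x powr (r - 1) * h)) (at (W x))"
    using has_real_derivative_powr[OF assms(2), of r] by (simp add: has_field_derivative_def)
  from has_derivative_compose[OF has_derivative_W[OF assms(1)] this]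
  show ?thesis by (rule has_derivative_eq_rhs) auto
qed

lemma has_derivative_Ag:
  assumes x: "x \<in> \<Omega>"
  shows "(Ag has_derivative (\<lambda>h. third u x h *v g x + A x *v (A x *v h))) (at x)"
  unfolding Ag_def
  using bounded_bilinear.FDERIV[OF bounded_bilinear_matrix_vector_mult has_derivative_A[OF x] has_derivative_g[OF x]]
  by (simp add: add.commute)

lemma has_derivative_sigma:
  assumes x: "x \<in> \<Omega>"
  shows "(\<sigma> has_derivative (\<lambda>h. (third u x h *v g x) \<bullet> g x + 2 * ((A x *v Ag x) \<bullet> h))) (at x)"
proof -
  have "(\<sigma> has_derivative (\<lambda>h. Ag x \<bullet> (A x *v h) + (third u x h *v g x + A x *v (A x *v h)) \<bullet> g x)) (at x)"
    unfolding \<sigma>_def by (rule has_derivative_inner[OF has_derivative_Ag[OF x] has_derivative_g[OF x]])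
  moreover have "(A x *v (A x *v h)) \<bullet> g x = (A x *v Ag x) \<bullet> h" for h
    by (metis A_commute[OF x] inner_commute Ag_def)
  ultimately show ?thesis
    by (simp add: inner_add_left A_commute[OF x] algebra_simps)
qed

lemma has_derivative_trace_A:
  assumes x: "x \<in> \<Omega>"
  shows "((\<lambda>y. trace (A y)) has_derivative (\<lambda>h. trace (third u x h))) (at x)"
  unfolding trace_def
  by (intro has_derivative_sum bounded_linear.has_derivative[OF bounded_linear_vec_nth]
      bounded_linear.has_derivative[OF bounded_linear_vec_nth has_derivative_A[OF x]])

lemma continuous_W: "continuous_on \<Omega> W"
  using has_derivative_W by (intro continuous_at_imp_continuous_on) (blast intro: has_derivative_continuous)

lemma open_regular: "open {x\<in>\<Omega>. W x > 0}"
  using continuous_open_preimage[OF continuous_W open_Omega, of "{0<..}"] by (simp add: vimage_def Int_def)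

lemma pointwise_eq:
  assumes "x \<in> \<Omega>" "W x > 0"
  shows "W x powr (p/2 - 1) * trace (A x) + (p - 2) * W x powr (p/2 - 2) * \<sigma> x + f (u x) = 0"
  using p_laplace_pointwise[OF open_Omega u3 _ eq f_cont assms(1)] assms(2)
  by (simp add: \<sigma>_def Ag_def W_def)

lemma differentiated_eq:
  assumes x: "x \<in> \<Omega>" "W x > 0"
  shows "(p - 2) * (w x / (W x)\<^sup>2) * \<sigma> x * trace (A x) + w x / W x * trace (third u x (g x))
    + (p - 2) * ((p - 4) * (w x / (W x) ^ 3) * (\<sigma> x)\<^sup>2
        + w x / (W x)\<^sup>2 * ((third u x (g x) *v g x) \<bullet> g x + 2 * (Ag x \<bullet> Ag x)))
    + deriv f (u x) * W x = 0"
proof -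
  let ?E = "\<lambda>y. W y powr (p/2 - 1) * trace (A y) + (p - 2) * W y powr (p/2 - 2) * \<sigma> y + f (u y)"
  have fu: "((\<lambda>y. f (u y)) has_derivative (\<lambda>h. deriv f (u x) * (g x \<bullet> h))) (at x)"
    using has_derivative_compose[OF has_derivative_u[OF x(1)], of f "\<lambda>h. deriv f (u x) * h"] f_deriv[of "u x"]
    by (simp add: has_field_derivative_def)
  have "(?E has_derivative (\<lambda>h.
      (W x powr (p/2 - 1) * trace (third u x h) + 2 * (p/2 - 1) * W x powr (p/2 - 1 - 1) * (Ag x \<bullet> h) * trace (A x))
      + ((p - 2) * W x powr (p/2 - 2) * ((third u x h *v g x) \<bullet> g x + 2 * ((A x *v Ag x) \<bullet> h))
         + ((p - 2) * (2 * (p/2 - 2) * W x powr (p/2 - 2 - 1) * (Ag x \<bullet> h))) * \<sigma> x)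
      + deriv f (u x) * (g x \<bullet> h))) (at x)"
    by (intro has_derivative_add has_derivative_mult has_derivative_mult_right has_derivative_W_powr[OF x]
          has_derivative_trace_A[OF x(1)] has_derivative_sigma[OF x(1)] fu)
  moreover have "(?E has_derivative (\<lambda>h. 0)) (at x)"
    by (rule has_derivative_transform_within_open[OF has_derivative_const[of 0] open_regular])
       (use x pointwise_eq in auto)
  ultimately have "(\<lambda>h.
      (W x powr (p/2 - 1) * trace (third u x h) + 2 * (p/2 - 1) * W x powr (p/2 - 1 - 1) * (Ag x \<bullet> h) * trace (A x))
      + ((p - 2) * W x powr (p/2 - 2) * ((third u x h *v g x) \<bullet> g x + 2 * ((A x *v Ag x) \<bullet> h))
         + ((p - 2) * (2 * (p/2 - 2) * W x powr (p/2 - 2 - 1) * (Ag x \<bullet> h))) * \<sigma> x)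
      + deriv f (u x) * (g x \<bullet> h)) = (\<lambda>h. 0)"
    by (rule has_derivative_unique)
  \<comment> \<open>Along the gradient the third derivatives appear in exactly the contractions that
    \<open>ell p (g x) (HP x)\<close> contains.\<close>
  from fun_cong[OF this, of "g x"]
  have "(W x powr (p/2 - 1) * trace (third u x (g x)) + 2 * (p/2 - 1) * W x powr (p/2 - 2) * \<sigma> x * trace (A x))
      + ((p - 2) * W x powr (p/2 - 2) * ((third u x (g x) *v g x) \<bullet> g x + 2 * (Ag x \<bullet> Ag x))
         + ((p - 2) * (2 * (p/2 - 2) * W x powr (p/2 - 3) * \<sigma> x)) * \<sigma> x)
      + deriv f (u x) * W x = 0"
    by (simp add: \<sigma>_def W_def A_commute[OF x(1), symmetric] flip: Ag_def)
  then show ?thesis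
    by (simp add: W_powr[OF x(2)] power2_eq_square algebra_simps)
qed

lemma twice_u: "x \<in> \<Omega> \<Longrightarrow> twice_at u x (g x) (\<lambda>h. A x *v h)"
  by (rule twice_atI[OF open_Omega]) (auto intro: has_derivative_u has_derivative_g)

lemma ell_u:
  assumes "x \<in> \<Omega>" "W x > 0"
  shows "ell p (g x) (\<lambda>h. A x *v h) = - f (u x) * W x / w x"
proof -
  have "ell p (g x) (\<lambda>h. A x *v h) = trace (A x) + (p - 2) * \<sigma> x / W x"
    by (simp add: ell_def trace_def matrix_vector_mult_basis column_def \<sigma>_def Ag_def W_def A_commute[OF assms(1)])
  moreover have "w x / W x * (trace (A x) + (p - 2) * \<sigma> x / W x) = - f (u x)"
    using pointwise_eq[OF assms] by (simp add: W_powr[OF assms(2)] algebra_simps power2_eq_square diff_divide_distrib add_divide_distrib)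
  ultimately have "w x / W x * ell p (g x) (\<lambda>h. A x *v h) = - f (u x)" by simp
  then show ?thesis using assms(2) w_pos[OF assms(2)] by (simp add: field_simps)
qed

definition "GP x = ((p - 1) * (w x / W x)) *\<^sub>R Ag x + f (u x) *\<^sub>R g x"
definition "HP x h = (p - 1) *\<^sub>R (((p - 2) * (w x / (W x)\<^sup>2) * (Ag x \<bullet> h)) *\<^sub>R Ag x
   + (w x / W x) *\<^sub>R (third u x h *v g x + A x *v (A x *v h)))
   + (deriv f (u x) * (g x \<bullet> h)) *\<^sub>R g x + f (u x) *\<^sub>R (A x *v h)"

lemma twice_P:
  assumes x: "x \<in> \<Omega>" "W x > 0"
  shows "twice_at P x (GP x) (HP x)"
proof (rule twice_atI[OF open_regular])
  fix y assume "y \<in> {x\<in>\<Omega>. W x > 0}"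
  then have y: "y \<in> \<Omega>" "W y > 0" by auto
  have "(P has_derivative (\<lambda>h. (p - 1) / p * (2 * (p/2) * W y powr (p/2 - 1) * (Ag y \<bullet> h)) + f (u y) * (g y \<bullet> h))) (at y)"
    unfolding P_def w_def
    using has_derivative_compose[OF has_derivative_u[OF y(1)], of F "\<lambda>h. f (u y) * h"] F_prim[of "u y"]
    by (intro has_derivative_add has_derivative_mult_right has_derivative_W_powr[OF y]) (simp add: has_field_derivative_def)
  then show "(P has_derivative (\<lambda>h. GP y \<bullet> h)) (at y)"
    using p1 by (simp add: GP_def W_powr[OF y(2)] inner_add_left mult.assoc)
next
  have fu: "((\<lambda>y. f (u y)) has_derivative (\<lambda>h. deriv f (u x) * (g x \<bullet> h))) (at x)"
    using has_derivative_compose[OF has_derivative_u[OF x(1)], of f "\<lambda>h. deriv f (u x) * h"] f_deriv[of "u x"]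
    by (simp add: has_field_derivative_def)
  have "((\<lambda>y. ((p - 1) * W y powr (p/2 - 1)) *\<^sub>R Ag y + f (u y) *\<^sub>R g y) has_derivative
     (\<lambda>h. (((p - 1) * W x powr (p/2 - 1)) *\<^sub>R (third u x h *v g x + A x *v (A x *v h))
        + ((p - 1) * (2 * (p/2 - 1) * W x powr (p/2 - 1 - 1) * (Ag x \<bullet> h))) *\<^sub>R Ag x)
      + (f (u x) *\<^sub>R (A x *v h) + (deriv f (u x) * (g x \<bullet> h)) *\<^sub>R g x))) (at x)"
    by (intro has_derivative_add has_derivative_scaleR has_derivative_mult_right has_derivative_W_powr[OF x]
        has_derivative_Ag[OF x(1)] has_derivative_g[OF x(1)] fu)
  then have d: "((\<lambda>y. ((p - 1) * W y powr (p/2 - 1)) *\<^sub>R Ag y + f (u y) *\<^sub>R g y) has_derivative HP x) (at x)"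
    by (rule has_derivative_eq_rhs) (auto simp: HP_def W_powr[OF x(2)] algebra_simps)
  show "(GP has_derivative HP x) (at x)"
    by (rule has_derivative_transform_within_open[OF d open_regular])
       (use x in \<open>auto simp: GP_def W_powr\<close>)
qed (use x in auto)

definition "frob x = (\<Sum>i\<in>UNIV. \<Sum>j\<in>UNIV. (A x $ i $ j)\<^sup>2)"

text \<open>The Hessian compressed to the orthogonal complement of the gradient.\<close>
definition "tang x = (\<chi> i j. A x $ i $ j - (g x $ i * Ag x $ j + Ag x $ i * g x $ j) / W x + \<sigma> x * g x $ i * g x $ j / (W x)\<^sup>2)"

lemma tang_frob:
  assumes "W x > 0" "x \<in> \<Omega>"
  shows "(\<Sum>i\<in>UNIV. \<Sum>j\<in>UNIV. (tang x $ i $ j)\<^sup>2) = frob x - 2 * (Ag x \<bullet> Ag x) / W x + (\<sigma> x)\<^sup>2 / (W x)\<^sup>2"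
proof -
  let ?W = "W x" and ?g = "g x" and ?s = "Ag x" and ?A = "A x" and ?\<sigma> = "\<sigma> x"
  have Asym: "?A $ i $ j = ?A $ j $ i" for i j using hess_symmetric[OF u3 open_Omega _ assms(2)] by simp
  have s: "?s $ i = (\<Sum>j\<in>UNIV. ?A $ i $ j * ?g $ j)" for i by (simp add: Ag_def matrix_vector_mult_def)
  have s': "?s $ j = (\<Sum>i\<in>UNIV. ?A $ i $ j * ?g $ i)" for j unfolding s by (subst Asym) simp
  have 1: "(\<Sum>i\<in>UNIV. \<Sum>j\<in>UNIV. ?A $ i $ j * (?g $ i * ?s $ j)) = ?s \<bullet> ?s"
    by (subst sum.swap) (simp add: inner_vec_def mult.assoc[symmetric] s'[symmetric] flip: sum_distrib_right)
  have 2: "(\<Sum>i\<in>UNIV. \<Sum>j\<in>UNIV. ?A $ i $ j * (?s $ i * ?g $ j)) = ?s \<bullet> ?s"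
  proof -
    have "(\<Sum>j\<in>UNIV. ?A $ i $ j * (?s $ i * ?g $ j)) = ?s $ i * ?s $ i" for i
      by (subst (3) s) (simp add: sum_distrib_left mult_ac)
    then show ?thesis by (simp add: inner_vec_def)
  qed
  have 3: "(\<Sum>i\<in>UNIV. \<Sum>j\<in>UNIV. ?A $ i $ j * (?g $ i * ?g $ j)) = ?\<sigma>"
  proof -
    have "(\<Sum>j\<in>UNIV. ?A $ i $ j * (?g $ i * ?g $ j)) = ?s $ i * ?g $ i" for i
      by (subst s) (simp add: sum_distrib_left mult_ac)
    then show ?thesis by (simp add: inner_vec_def \<sigma>_def)
  qed
  have dbl: "(\<Sum>i\<in>UNIV. (a $ i * b $ i) * (\<Sum>j\<in>UNIV. c $ j * d $ j)) = (a \<bullet> b) * (c \<bullet> d)" for a b c d :: "real^'n"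
    by (simp add: inner_vec_def sum_distrib_right)
  \<comment> \<open>After expansion every double sum factors into inner products by
    \<open>1\<close>, \<open>2\<close>, \<open>3\<close> and \<open>dbl\<close>; with the reciprocal
    named, what remains is again polynomial.\<close>
  define q r where "q = 1 / ?W" and "r = ?\<sigma> / ?W\<^sup>2"
  have qW: "q * ?W = 1" using assms by (simp add: q_def)
  have r: "r = ?\<sigma> * q * q" by (simp add: r_def q_def power2_eq_square)
  have "(tang x $ i $ j)\<^sup>2 = (?A $ i $ j)\<^sup>2
     + q\<^sup>2 * ((?g $ i * ?g $ i) * (?s $ j * ?s $ j)) + q\<^sup>2 * ((?s $ i * ?s $ i) * (?g $ j * ?g $ j))
     + 2 * q\<^sup>2 * ((?g $ i * ?s $ i) * (?s $ j * ?g $ j))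
     + r\<^sup>2 * ((?g $ i * ?g $ i) * (?g $ j * ?g $ j))
     - 2 * q * (?A $ i $ j * (?g $ i * ?s $ j)) - 2 * q * (?A $ i $ j * (?s $ i * ?g $ j))
     + 2 * r * (?A $ i $ j * (?g $ i * ?g $ j))
     - 2 * q * r * ((?g $ i * ?g $ i) * (?s $ j * ?g $ j)) - 2 * q * r * ((?s $ i * ?g $ i) * (?g $ j * ?g $ j))" for i j
  proof -
    have te: "tang x $ i $ j = ?A $ i $ j - q * (?g $ i * ?s $ j) - q * (?s $ i * ?g $ j) + r * (?g $ i * ?g $ j)"
      by (simp add: tang_def q_def r_def add_divide_distrib)
    show ?thesis unfolding te by (simp add: power2_eq_square algebra_simps)
  qed
  then have "(\<Sum>i\<in>UNIV. \<Sum>j\<in>UNIV. (tang x $ i $ j)\<^sup>2) = frob x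
     + q\<^sup>2 * (?W * (?s \<bullet> ?s)) + q\<^sup>2 * ((?s \<bullet> ?s) * ?W) + 2 * q\<^sup>2 * (?\<sigma> * ?\<sigma>) + r\<^sup>2 * (?W * ?W)
     - 2 * q * (?s \<bullet> ?s) - 2 * q * (?s \<bullet> ?s) + 2 * r * ?\<sigma> - 2 * q * r * (?W * ?\<sigma>) - 2 * q * r * (?\<sigma> * ?W)"
    by (simp only: sum.distrib sum_subtractf frob_def sum_distrib_left[symmetric] 1 2 3 dbl)
       (simp add: W_def \<sigma>_def inner_commute)
  also have "\<dots> = frob x - 2 * q * (?s \<bullet> ?s) + q\<^sup>2 * ?\<sigma>\<^sup>2"
    unfolding r using qW by algebra
  finally show ?thesis by (simp add: q_def power2_eq_square)
qed

lemma aform_g: "W x > 0 \<Longrightarrow> aform p (g x) (g x) = (p - 1) * W x"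
  unfolding aform_def W_def[symmetric] by (simp add: power2_eq_square field_simps)

lemma ell_HP:
  assumes x: "x \<in> \<Omega>" "W x > 0"
  shows "ell p (g x) (HP x) = (p - 1) * ((p - 2) * (w x / (W x)\<^sup>2) * (Ag x \<bullet> Ag x + (p - 2) * (\<sigma> x)\<^sup>2 / W x)
    + w x / W x * (trace (third u x (g x)) + frob x + (p - 2) * ((third u x (g x) *v g x) \<bullet> g x + Ag x \<bullet> Ag x) / W x))
    + deriv f (u x) * ((p - 1) * W x) + f (u x) * (trace (A x) + (p - 2) * \<sigma> x / W x)"
proof -
  have HP: "HP x = (\<lambda>h. (((p - 1) * ((p - 2) * (w x / (W x)\<^sup>2))) *\<^sub>R ((Ag x \<bullet> h) *\<^sub>R Ag x)
     + ((p - 1) * (w x / W x)) *\<^sub>R (third u x h *v g x + A x *v (A x *v h)))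
     + deriv f (u x) *\<^sub>R ((g x \<bullet> h) *\<^sub>R g x) + f (u x) *\<^sub>R (A x *v h))"
    by (rule ext) (simp add: HP_def scaleR_add_right mult.assoc)
  have Asym: "A x $ i $ j = A x $ j $ i" for i j using hess_symmetric[OF u3 open_Omega _ x(1)] by simp
  have AA: "(A x *v (A x *v axis i 1)) $ i = (\<Sum>j\<in>UNIV. (A x $ i $ j)\<^sup>2)" for i
    by (simp add: matrix_vector_mult_basis column_def) (simp add: matrix_vector_mult_def power2_eq_square Asym[of _ i])
  have 1: "ell p (g x) (\<lambda>h. third u x h *v g x) = trace (third u x (g x)) + (p - 2) * ((third u x (g x) *v g x) \<bullet> g x) / W x"
    using trace_third[OF u3 open_Omega _ x(1), of "g x"] by (simp add: ell_def W_def inner_commute)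
  have 2: "ell p (g x) (\<lambda>h. A x *v (A x *v h)) = frob x + (p - 2) * (Ag x \<bullet> Ag x) / W x"
    unfolding ell_def AA by (simp add: frob_def W_def Ag_def A_commute[OF x(1)])
  have 3: "ell p (g x) (\<lambda>h. A x *v h) = trace (A x) + (p - 2) * \<sigma> x / W x"
    by (simp add: ell_def trace_def matrix_vector_mult_basis column_def \<sigma>_def Ag_def W_def A_commute[OF x(1)])
  have 4: "aform p (g x) (Ag x) = Ag x \<bullet> Ag x + (p - 2) * (\<sigma> x)\<^sup>2 / W x"
    by (simp add: aform_def W_def \<sigma>_def)
  have 5: "(p - 2) * ((third u x (g x) *v g x) \<bullet> g x + Ag x \<bullet> Ag x) / W x
      = (p - 2) * ((third u x (g x) *v g x) \<bullet> g x) / W x + (p - 2) * (Ag x \<bullet> Ag x) / W x"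
    by (simp add: distrib_left add_divide_distrib)
  show ?thesis
    unfolding HP ell_add ell_scaleR ell_rank1 1 2 3 4 5 aform_g[OF x(2)]
    by (simp only: distrib_left distrib_right mult_ac add_ac)
qed

text \<open>The drift coefficient is the one for which the identity in
  \<open>P_function_algebra\<close> closes up.\<close>

definition "L x G H = ell p (g x) H + p * f (u x) / w x * (g x \<bullet> G)"

text \<open>The squares measure the part of A g across g, the Hessian compressed to the complement
  of g, and the trace of that compression. If the first two vanish, the Hessian is a multiple of g
  g^T, which is the source of the rigidity.\<close>

lemma L_P:
  assumes x: "x \<in> \<Omega>" "W x > 0"
  shows "L x (GP x) (HP x) = (p - 1) * (w x / W x) * (2 * ((Ag x \<bullet> Ag x) / W x - (\<sigma> x)\<^sup>2 / (W x)\<^sup>2)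
      + (\<Sum>i\<in>UNIV. \<Sum>j\<in>UNIV. (tang x $ i $ j)\<^sup>2) + (trace (A x) - \<sigma> x / W x)\<^sup>2)"
proof -
  have "g x \<bullet> GP x = (p - 1) * (w x / W x) * \<sigma> x + f (u x) * W x"
    by (simp add: GP_def inner_add_right \<sigma>_def W_def inner_commute)
  then show ?thesis
    unfolding L_def ell_HP[OF x] tang_frob[OF x(2,1)]
    using P_function_algebra[OF x(2) w_pos[OF x(2)] _ differentiated_eq[OF x], of "f (u x)" "frob x"] pointwise_eq[OF x]
    by (simp add: W_powr[OF x(2)])
qed

lemma beta_nonneg:
  assumes "W x > 0" shows "(Ag x \<bullet> Ag x) / W x - (\<sigma> x)\<^sup>2 / (W x)\<^sup>2 \<ge> 0"
proof -
  have "(\<sigma> x)\<^sup>2 \<le> (Ag x \<bullet> Ag x) * W x"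
    unfolding \<sigma>_def W_def by (rule Cauchy_Schwarz_ineq)
  then show ?thesis using assms by (simp add: field_simps power2_eq_square)
qed

lemma L_P_nonneg:
  assumes x: "x \<in> \<Omega>" "W x > 0"
  shows "L x (GP x) (HP x) \<ge> 0"
  unfolding L_P[OF x] using x p1 w_pos[OF x(2)] beta_nonneg[OF x(2)]
  by (intro mult_nonneg_nonneg add_nonneg_nonneg sum_nonneg) auto

text \<open>\<open>k1\<close> and \<open>k2\<close> play the roles of k'(u) and k''(u) for a
  function k(u); the equation has replaced \<open>ell\<close> of the Hessian of \<open>u\<close> by
  \<open>- f (u x) * W x / w x\<close>. For k(u) = exp(K u) with K above a bound of |f| / w the
  result is positive, which makes \<open>u\<close> a source of strict subsolutions.\<close>

lemma L_compose_u:
  assumes "x \<in> \<Omega>" "W x > 0"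
  shows "L x (k1 *\<^sub>R g x) (\<lambda>h. (k2 * (g x \<bullet> h)) *\<^sub>R g x + k1 *\<^sub>R (A x *v h)) = (p - 1) * W x * (k2 + k1 * f (u x) / w x)"
proof -
  have "(\<lambda>h. (k2 * (g x \<bullet> h)) *\<^sub>R g x + k1 *\<^sub>R (A x *v h)) = (\<lambda>h. k2 *\<^sub>R ((g x \<bullet> h) *\<^sub>R g x) + k1 *\<^sub>R (A x *v h))"
    by auto
  then have "ell p (g x) (\<lambda>h. (k2 * (g x \<bullet> h)) *\<^sub>R g x + k1 *\<^sub>R (A x *v h)) = k2 * ((p - 1) * W x) + k1 * (- f (u x) * W x / w x)"
    by (simp only: ell_add ell_scaleR ell_rank1 aform_g[OF assms(2)] ell_u[OF assms])
  then show ?thesis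
    unfolding L_def using assms w_pos[OF assms(2)]
    by (simp add: W_def[symmetric] field_simps)
qed

lemma L_add: "L x (G + G') (\<lambda>h. H h + H' h) = L x G H + L x G' H'"
  by (simp add: L_def ell_add inner_add_right algebra_simps)

lemma L_scaleR: "L x (c *\<^sub>R G) (\<lambda>h. c *\<^sub>R H h) = c * L x G H"
  by (simp add: L_def ell_scaleR algebra_simps)

lemma L_local_max:
  assumes "twice_at \<phi> x G H" "\<forall>\<^sub>F y in nhds x. \<phi> y \<le> \<phi> x" "W x > 0"
  shows "L x G H \<le> 0" "G = 0"
  using ell_local_max[OF assms(1,2), of "g x" p] assms(3) p1 by (auto simp: L_def W_pos)

end

section \<open>The gradient estimate\<close>

context p_laplace begin

lemma P_le_w: "P x \<le> w x"
proof -
  have "(p - 1) / p * w x \<le> 1 * w x"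
    using p1 by (intro mult_right_mono) (auto simp: w_def)
  then show ?thesis using F_nonpos[of "u x"] by (simp add: P_def)
qed

text \<open>Here \<open>F \<le> 0\<close> is decisive: a positive value of \<open>P\<close> can only
  come from the gradient.\<close>

lemma W_pos_if_P_pos: "P x > 0 \<Longrightarrow> W x > 0"
  using P_le_w[of x] W_nonneg[of x] by (cases "W x = 0") (auto simp: w_def)

lemma W_eq_norm: "W x = (norm (g x))\<^sup>2" by (simp add: W_def power2_norm_eq_inner)

lemma w_eq_norm: "w x = norm (g x) powr p"
proof -
  have "w x = (norm (g x) powr 2) powr (p / 2)" by (simp add: w_def W_eq_norm)
  then show ?thesis by (simp only: powr_powr) simp
qed

text \<open>The summand \<open>\<eta> exp (K u)\<close> makes the differential inequality for \<open>ln P\<close> strict; this replaces the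
  usual compactness argument over translates of \<open>u\<close>.\<close>
lemma cutoff_max_estimate:
  fixes x0 :: "real^'n"
  defines "m \<equiv> max 1 (p - 1)"
  assumes x: "x \<in> \<Omega>" and P: "P x > 0" and R: "R > 0" "norm (x - x0) < R"
    and f: "\<bar>f (u x)\<bar> \<le> M" and w0: "0 < w0" "w0 \<le> w x"
    and K: "K \<ge> 1" "K \<ge> 2 * M / w0" and \<eta>: "\<eta> > 0" "\<eta> * exp (K * u x) \<le> (p - 1) / (8 * m)" "u x \<ge> 0"
    and max: "\<forall>\<^sub>F y in nhds x. ln (P y) + (\<eta> * exp (K * u y) + p * ln (1 - (y - x0) \<bullet> (y - x0) / R\<^sup>2))
       \<le> ln (P x) + (\<eta> * exp (K * u x) + p * ln (1 - (x - x0) \<bullet> (x - x0) / R\<^sup>2))"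
  defines "D \<equiv> R\<^sup>2 - (x - x0) \<bullet> (x - x0)"
  shows "(p - 1) / 4 * \<eta> * W x \<le> (8 * m * p\<^sup>2 + 4 * p * m + 2 * p * (CARD('n) + p)) * (R / D)\<^sup>2 + 2 * p\<^sup>2 * M / w0 * (norm (g x) * (R / D))"
proof -
  have W: "W x > 0" using P by (rule W_pos_if_P_pos)
  have g0: "g x \<noteq> 0" using W by (simp add: W_pos)
  have m: "m \<ge> 1" "m > 0" by (auto simp: m_def)
  have wp: "w x > 0" using W by (rule w_pos)
  define z where "z = x - x0"
  have zz: "z \<bullet> z = (norm z)\<^sup>2" by (simp add: power2_norm_eq_inner)
  have zR: "norm z < R" using R by (simp add: z_def)
  have "(norm z)\<^sup>2 < R\<^sup>2" using zR by (intro power_strict_mono) auto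
  then have D: "D > 0" "D \<le> R\<^sup>2" by (auto simp: D_def zz simp flip: z_def)
  define t where "t = \<eta> * exp (K * u x)"
  have t: "t > 0" "t \<ge> \<eta>" "t \<le> (p - 1) / (8 * m)"
    using \<eta> K by (auto simp: t_def)
  have tw1: "twice_at (\<lambda>y. ln (P y)) x ((1 / P x) *\<^sub>R GP x) (\<lambda>h. (- (1 / (P x)\<^sup>2) * (GP x \<bullet> h)) *\<^sub>R GP x + (1 / P x) *\<^sub>R HP x h)"
    by (rule twice_at_compose[OF twice_P[OF x W], where T="{0<..}" and k'="\<lambda>s. 1 / s"])
       (use P in \<open>auto intro!: derivative_eq_intros simp: power2_eq_square field_simps\<close>)
  have tw2: "twice_at (\<lambda>y. \<eta> * exp (K * u y)) x ((t * K) *\<^sub>R g x) (\<lambda>h. ((t * K\<^sup>2) * (g x \<bullet> h)) *\<^sub>R g x + (t * K) *\<^sub>R (A x *v h))"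
    unfolding t_def
    by (rule twice_at_compose[OF twice_u[OF x], where T=UNIV and k="\<lambda>s. \<eta> * exp (K * s)" and k'="\<lambda>s. \<eta> * exp (K * s) * K"])
       (auto intro!: derivative_eq_intros simp: power2_eq_square)
  have tw3: "twice_at (\<lambda>y. p * ln (1 - (y - x0) \<bullet> (y - x0) / R\<^sup>2)) x ((- (p / D)) *\<^sub>R (2 *\<^sub>R z))
      (\<lambda>h. (- (p / D\<^sup>2) * (2 *\<^sub>R z \<bullet> h)) *\<^sub>R (2 *\<^sub>R z) + (- (p / D)) *\<^sub>R (2 *\<^sub>R h))"
    unfolding D_def z_def
  proof (rule twice_at_compose[OF twice_at_sqdist, where T="{..<R\<^sup>2}" and k="\<lambda>s. p * ln (1 - s / R\<^sup>2)" and k'="\<lambda>s. - (p / (R\<^sup>2 - s))"])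
    show "((\<lambda>s. p * ln (1 - s / R\<^sup>2)) has_real_derivative - (p / (R\<^sup>2 - s))) (at s)" if "s \<in> {..<R\<^sup>2}" for s
      using that R by (auto intro!: derivative_eq_intros simp: field_simps)
    show "((\<lambda>s. - (p / (R\<^sup>2 - s))) has_real_derivative - (p / (R\<^sup>2 - (x - x0) \<bullet> (x - x0))\<^sup>2)) (at ((x - x0) \<bullet> (x - x0)))"
      using D by (auto intro!: derivative_eq_intros simp: D_def power2_eq_square field_simps)
  qed (use D in \<open>auto simp: D_def\<close>)
  note tw = twice_at_add[OF tw1 twice_at_add[OF tw2 tw3]]
  note mx = L_local_max[OF tw max W]
  \<comment> \<open>\<open>Q\<close> is the gradient of ln P. The first-order condition at the
    maximum trades it for the gradients of the exponential and of the cutoff, both of which are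
    explicit.\<close>
  define Q where "Q = (1 / P x) *\<^sub>R GP x"
  define b where "b = (t * K) *\<^sub>R g x + (- (p / D)) *\<^sub>R (2 *\<^sub>R z)"
  have "Q + b = 0" using mx(2) unfolding Q_def b_def .
  then have Qb: "Q = - b" by (simp add: eq_neg_iff_add_eq_0)
  have RD: "R / D > 0" using R D by simp
  have nz: "norm (2 *\<^sub>R z) \<le> 2 * R" using zR by simp
  have g3: "norm ((p / D) *\<^sub>R (2 *\<^sub>R z)) \<le> 2 * p * (R / D)"
  proof -
    have "norm ((p / D) *\<^sub>R (2 *\<^sub>R z)) = p / D * norm (2 *\<^sub>R z)" using p1 D by simp
    also have "\<dots> \<le> p / D * (2 * R)" using nz p1 D by (intro mult_left_mono) auto
    finally show ?thesis by (simp add: mult_ac)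
  qed
  have QQ: "Q \<bullet> Q \<le> 2 * t\<^sup>2 * K\<^sup>2 * W x + 8 * p\<^sup>2 * (R / D)\<^sup>2"
  proof -
    have "norm Q \<le> t * K * norm (g x) + 2 * p * (R / D)"
      unfolding Qb b_def norm_minus_cancel
      using norm_triangle_ineq4[of "(t * K) *\<^sub>R g x" "(p / D) *\<^sub>R (2 *\<^sub>R z)"] g3 t K by simp
    then have "(norm Q)\<^sup>2 \<le> (t * K * norm (g x) + 2 * p * (R / D))\<^sup>2" by (intro power_mono) auto
    also have "\<dots> \<le> 2 * (t * K * norm (g x))\<^sup>2 + 2 * (2 * p * (R / D))\<^sup>2"
      using zero_le_power2[of "t * K * norm (g x) - 2 * p * (R / D)"] by (simp add: power2_sum power2_diff)
    finally show ?thesis by (simp add: power2_norm_eq_inner[of Q] W_eq_norm power_mult_distrib power_divide)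
  qed
  \<comment> \<open>The logarithm costs a quadratic term in \<open>Q\<close>; the contribution of
    \<open>L\<close> applied to \<open>P\<close> itself has the good sign.\<close>
  have L1: "L x Q (\<lambda>h. (- (1 / (P x)\<^sup>2) * (GP x \<bullet> h)) *\<^sub>R GP x + (1 / P x) *\<^sub>R HP x h) \<ge> - m * (Q \<bullet> Q)"
  proof -
    have "(\<lambda>h. (- (1 / (P x)\<^sup>2) * (GP x \<bullet> h)) *\<^sub>R GP x + (1 / P x) *\<^sub>R HP x h)
       = (\<lambda>h. (-1) *\<^sub>R ((Q \<bullet> h) *\<^sub>R Q) + (1 / P x) *\<^sub>R HP x h)"
      using P by (auto simp: Q_def power2_eq_square)
    then have "L x Q (\<lambda>h. (- (1 / (P x)\<^sup>2) * (GP x \<bullet> h)) *\<^sub>R GP x + (1 / P x) *\<^sub>R HP x h)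
       = - aform p (g x) Q + L x Q (\<lambda>h. (1 / P x) *\<^sub>R HP x h)"
      by (simp only: L_def ell_add ell_scaleR ell_rank1)
    also have "L x Q (\<lambda>h. (1 / P x) *\<^sub>R HP x h) = 1 / P x * L x (GP x) (HP x)"
      unfolding Q_def by (rule L_scaleR)
    finally have "L x Q (\<lambda>h. (- (1 / (P x)\<^sup>2) * (GP x \<bullet> h)) *\<^sub>R GP x + (1 / P x) *\<^sub>R HP x h)
       = - aform p (g x) Q + 1 / P x * L x (GP x) (HP x)" .
    moreover have "1 / P x * L x (GP x) (HP x) \<ge> 0" using L_P_nonneg[OF x W] P by simp
    moreover have "aform p (g x) Q \<le> m * (Q \<bullet> Q)" unfolding m_def by (rule aform_bounds(2)[OF g0])
    ultimately show ?thesis by linarith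
  qed
  have L2: "L x ((t * K) *\<^sub>R g x) (\<lambda>h. ((t * K\<^sup>2) * (g x \<bullet> h)) *\<^sub>R g x + (t * K) *\<^sub>R (A x *v h)) \<ge> (p - 1) / 2 * (t * K\<^sup>2 * W x)"
  proof -
    \<comment> \<open>\<open>K\<close> is at least twice this bound, so the first-order part
      destroys at most half of the second-order gain.\<close>
    have "\<bar>f (u x) / w x\<bar> \<le> M / w0"
      using f w0 wp by (auto simp: abs_divide intro!: frac_le)
    moreover have "2 * (M / w0) \<le> K" using K by simp
    ultimately have "f (u x) / w x \<ge> - (K / 2)" using abs_ge_minus_self[of "f (u x) / w x"] by linarith
    then have "t * K * (f (u x) / w x) \<ge> t * K * (- (K / 2))" using t K by (intro mult_left_mono) auto
    moreover have "t * K * (- (K / 2)) = - (t * K\<^sup>2 / 2)" by (simp add: power2_eq_square)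
    moreover have "t * K * (f (u x) / w x) = t * K * f (u x) / w x" by simp
    ultimately have "t * K\<^sup>2 + t * K * f (u x) / w x \<ge> t * K\<^sup>2 / 2" by linarith
    then have "(p - 1) * W x * (t * K\<^sup>2 + t * K * f (u x) / w x) \<ge> (p - 1) * W x * (t * K\<^sup>2 / 2)"
      using p1 W by (intro mult_left_mono) auto
    then show ?thesis unfolding L_compose_u[OF x W] by (simp add: mult_ac)
  qed
  have L3: "L x ((- (p / D)) *\<^sub>R (2 *\<^sub>R z)) (\<lambda>h. (- (p / D\<^sup>2) * (2 *\<^sub>R z \<bullet> h)) *\<^sub>R (2 *\<^sub>R z) + (- (p / D)) *\<^sub>R (2 *\<^sub>R h))
     \<ge> - (4 * p * m + 2 * p * (CARD('n) + p)) * (R / D)\<^sup>2 - 2 * p\<^sup>2 * M / w0 * (norm (g x) * (R / D))"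
  proof -
    have "(\<lambda>h. (- (p / D\<^sup>2) * (2 *\<^sub>R z \<bullet> h)) *\<^sub>R (2 *\<^sub>R z) + (- (p / D)) *\<^sub>R (2 *\<^sub>R h))
      = (\<lambda>h. (- (p / D\<^sup>2)) *\<^sub>R ((2 *\<^sub>R z \<bullet> h) *\<^sub>R (2 *\<^sub>R z)) + (- (2 * p / D)) *\<^sub>R h)" by (auto simp: mult_ac)
    then have e: "ell p (g x) (\<lambda>h. (- (p / D\<^sup>2) * (2 *\<^sub>R z \<bullet> h)) *\<^sub>R (2 *\<^sub>R z) + (- (p / D)) *\<^sub>R (2 *\<^sub>R h))
      = - (p / D\<^sup>2) * aform p (g x) (2 *\<^sub>R z) - 2 * p / D * (CARD('n) + (p - 2))"
      by (simp only: ell_add ell_scaleR ell_rank1 ell_id[OF g0]; simp)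
    have "aform p (g x) (2 *\<^sub>R z) \<le> m * (2 *\<^sub>R z \<bullet> 2 *\<^sub>R z)"
      unfolding m_def by (rule aform_bounds(2)[OF g0])
    also have "2 *\<^sub>R z \<bullet> 2 *\<^sub>R z \<le> (2 * R)\<^sup>2"
      using power_mono[OF nz norm_ge_zero, of 2] by (simp add: power2_norm_eq_inner)
    finally have "aform p (g x) (2 *\<^sub>R z) \<le> m * (2 * R)\<^sup>2" using m by simp
    then have "p / D\<^sup>2 * aform p (g x) (2 *\<^sub>R z) \<le> p / D\<^sup>2 * (m * (2 * R)\<^sup>2)"
      using p1 by (intro mult_left_mono) auto
    then have a: "p / D\<^sup>2 * aform p (g x) (2 *\<^sub>R z) \<le> 4 * p * m * (R / D)\<^sup>2"
      by (simp add: power_divide mult_ac)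
    have "real CARD('n) \<ge> 1" by (simp add: Suc_leI)
    then have n1: "0 \<le> real CARD('n) + (p - 2)" using p1 by linarith
    have "1 / D \<le> (R / D)\<^sup>2" using D by (simp add: power2_eq_square field_simps)
    then have "2 * p * (CARD('n) + (p - 2)) * (1 / D) \<le> 2 * p * (CARD('n) + p) * (R / D)\<^sup>2"
      using p1 D n1 by (intro mult_mono) (auto intro!: mult_nonneg_nonneg)
    then have b: "2 * p / D * (CARD('n) + (p - 2)) \<le> 2 * p * (CARD('n) + p) * (R / D)\<^sup>2"
      by (simp add: mult_ac)
    have "\<bar>p * f (u x) / w x * (g x \<bullet> ((- (p / D)) *\<^sub>R (2 *\<^sub>R z)))\<bar>
        = p * (\<bar>f (u x)\<bar> / w x) * \<bar>g x \<bullet> ((p / D) *\<^sub>R (2 *\<^sub>R z))\<bar>"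
      using p1 wp by (simp add: abs_mult)
    also have "\<dots> \<le> p * (M / w0) * (norm (g x) * (2 * p * (R / D)))"
    proof (intro mult_mono)
      show "\<bar>f (u x)\<bar> / w x \<le> M / w0" using f w0 wp by (intro frac_le) auto
      show "\<bar>g x \<bullet> ((p / D) *\<^sub>R (2 *\<^sub>R z))\<bar> \<le> norm (g x) * (2 * p * (R / D))"
        using Cauchy_Schwarz_ineq2[of "g x" "(p / D) *\<^sub>R (2 *\<^sub>R z)"] mult_left_mono[OF g3 norm_ge_zero[of "g x"]] by linarith
    qed (use p1 w0 wp f in auto)
    also have "\<dots> = 2 * p\<^sup>2 * M / w0 * (norm (g x) * (R / D))" by (simp add: power2_eq_square)
    finally have c: "\<bar>p * f (u x) / w x * (g x \<bullet> ((- (p / D)) *\<^sub>R (2 *\<^sub>R z)))\<bar> \<le> 2 * p\<^sup>2 * M / w0 * (norm (g x) * (R / D))" .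
    have d1: "- (4 * p * m + 2 * p * (CARD('n) + p)) * (R / D)\<^sup>2 = - (4 * p * m * (R / D)\<^sup>2) - 2 * p * (CARD('n) + p) * (R / D)\<^sup>2"
      by (simp add: algebra_simps)
    have d2: "- (p / D\<^sup>2) * aform p (g x) (2 *\<^sub>R z) = - (p / D\<^sup>2 * aform p (g x) (2 *\<^sub>R z))" by simp
    have lin: "m1 - y \<le> m2 - b1 + X" if "m1 = - c1 - c2" "m2 = - a1" "a1 \<le> c1" "b1 \<le> c2" "\<bar>X\<bar> \<le> y"
      for m1 m2 a1 b1 c1 c2 X y :: real using that by linarith
    show ?thesis unfolding L_def e by (rule lin[OF d1 d2 a b c])
  qed
  have "L x Q (\<lambda>h. (- (1 / (P x)\<^sup>2) * (GP x \<bullet> h)) *\<^sub>R GP x + (1 / P x) *\<^sub>R HP x h)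
    + (L x ((t * K) *\<^sub>R g x) (\<lambda>h. ((t * K\<^sup>2) * (g x \<bullet> h)) *\<^sub>R g x + (t * K) *\<^sub>R (A x *v h))
    + L x ((- (p / D)) *\<^sub>R (2 *\<^sub>R z)) (\<lambda>h. (- (p / D\<^sup>2) * (2 *\<^sub>R z \<bullet> h)) *\<^sub>R (2 *\<^sub>R z) + (- (p / D)) *\<^sub>R (2 *\<^sub>R h))) \<le> 0"
    using mx(1) unfolding Q_def by (simp only: L_add)
  note ineq = this
  \<comment> \<open>This is the purpose of \<open>t \<le> (p - 1) / (8 * m)\<close>: the quadratic
    term in \<open>Q\<close> eats at most half of the gain in \<open>L2\<close>, up to cutoff
    errors.\<close>
  have i1: "- m * (Q \<bullet> Q) \<ge> - (p - 1) / 4 * (t * K\<^sup>2 * W x) - 8 * m * p\<^sup>2 * (R / D)\<^sup>2"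
  proof -
    have "m * (Q \<bullet> Q) \<le> m * (2 * t\<^sup>2 * K\<^sup>2 * W x + 8 * p\<^sup>2 * (R / D)\<^sup>2)"
      using QQ m by (intro mult_left_mono) auto
    also have "\<dots> = (2 * m * t) * (t * K\<^sup>2 * W x) + 8 * m * p\<^sup>2 * (R / D)\<^sup>2"
      by (simp add: power2_eq_square algebra_simps)
    also have "(2 * m * t) * (t * K\<^sup>2 * W x) \<le> (p - 1) / 4 * (t * K\<^sup>2 * W x)"
      using t m W by (intro mult_right_mono) (auto simp: field_simps)
    finally show ?thesis by (simp add: field_simps)
  qed
  have i2: "(p - 1) / 4 * \<eta> * W x \<le> (p - 1) / 4 * (t * K\<^sup>2 * W x)"
  proof -
    have "1 \<le> K\<^sup>2" using K by (simp add: one_le_power)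
    then have "\<eta> * 1 \<le> t * K\<^sup>2" using t \<eta> by (intro mult_mono) auto
    then have "\<eta> * W x \<le> t * K\<^sup>2 * W x" using W by simp
    then have "(p - 1) / 4 * (\<eta> * W x) \<le> (p - 1) / 4 * (t * K\<^sup>2 * W x)" using p1 by (intro mult_left_mono) auto
    then show ?thesis by (simp add: mult.assoc)
  qed
  have i3: "(p - 1) / 2 * (t * K\<^sup>2 * W x) = (p - 1) / 4 * (t * K\<^sup>2 * W x) + (p - 1) / 4 * (t * K\<^sup>2 * W x)"
    by (simp add: field_simps)
  have i4: "- (p - 1) / 4 * (t * K\<^sup>2 * W x) = - ((p - 1) / 4 * (t * K\<^sup>2 * W x))"
    by (simp only: minus_divide_left[symmetric] mult_minus_left)
  have i5: "(8 * m * p\<^sup>2 + 4 * p * m + 2 * p * (CARD('n) + p)) * (R / D)\<^sup>2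
      = 8 * m * p\<^sup>2 * (R / D)\<^sup>2 - (- (4 * p * m + 2 * p * (CARD('n) + p)) * (R / D)\<^sup>2)"
    by (simp add: algebra_simps)
  have lin: "e \<le> r + y" if "l1 + (l2 + l3) \<le> 0" "mq \<ge> ma - q" "e \<le> a" "a2 = a + a" "ma = - a" "r = q - d"
      "l1 \<ge> mq" "l2 \<ge> a2" "l3 \<ge> d - y" for e r y l1 l2 l3 mq ma q a a2 d :: real using that by linarith
  show ?thesis by (rule lin[OF ineq i1 i2 i3 i4 i5 L1 L2 L3])
qed

end

text \<open>\<open>U\<close> is the continuous extension of the gradient to the closure. The values
  of \<open>u\<close> outside the closure are arbitrary, so partial derivatives taken at a frontier
  point carry no information. The Neumann condition appears as the length of \<open>U\<close> on the
  frontier.\<close>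

locale overdet = p_laplace \<Omega> u f F p
  for \<Omega> :: "(real^'n) set" and u :: "real^'n \<Rightarrow> real" and f F :: "real \<Rightarrow> real" and p :: real +
  fixes U :: "real^'n \<Rightarrow> real^'n" and \<kappa> :: real
  assumes kappa: "\<kappa> > 0"
    and U_cont: "continuous_on (closure \<Omega>) U" and U_eq: "\<And>x. x \<in> \<Omega> \<Longrightarrow> U x = grad u x"
    and u_cont: "continuous_on (closure \<Omega>) u" and u_bdd: "bounded (u ` \<Omega>)"
    and u_pos: "\<And>x. x \<in> \<Omega> \<Longrightarrow> u x > 0"
    and u_zero: "\<And>q. q \<in> frontier \<Omega> \<Longrightarrow> u q = 0"
    and U_norm: "\<And>q. q \<in> frontier \<Omega> \<Longrightarrow> norm (U q) = \<kappa>"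
    and F0: "F 0 \<ge> - ((p - 1) / p) * \<kappa> powr p"
begin

section \<open>Boundary values and the upper bound of the P-function\<close>

definition "c = (p - 1) / p * \<kappa> powr p + F 0"
definition "Pb x = (p - 1) / p * norm (U x) powr p + F (u x)"

lemma c_nonneg: "c \<ge> 0" using F0 by (simp add: c_def)

lemma F_cont: "continuous_on S F"
  using F_prim DERIV_isCont by (metis continuous_at_imp_continuous_on)

lemma Pb_cont: "continuous_on (closure \<Omega>) Pb"
  unfolding Pb_def using p1
  by (intro continuous_intros U_cont continuous_on_powr' continuous_on_compose2[OF F_cont u_cont]) auto

lemma Pb_eq: "x \<in> \<Omega> \<Longrightarrow> Pb x = P x"
  by (simp add: Pb_def P_def w_eq_norm U_eq)

lemma P_cont: "continuous_on \<Omega> P"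
  by (rule continuous_on_eq[OF continuous_on_subset[OF Pb_cont closure_subset]]) (rule Pb_eq)

lemma Pb_frontier: "q \<in> frontier \<Omega> \<Longrightarrow> Pb q = c"
  by (simp add: Pb_def c_def U_norm u_zero)

lemma f_u_bound: "\<exists>M\<ge>0. \<forall>x\<in>\<Omega>. \<bar>f (u x)\<bar> \<le> M"
proof -
  have "compact (closure (u ` \<Omega>))" using u_bdd by simp
  then have "compact (f ` closure (u ` \<Omega>))"
    by (rule compact_continuous_image[rotated]) (use f_cont continuous_on_subset in blast)
  then have "bounded (f ` closure (u ` \<Omega>))" by (rule compact_imp_bounded)
  then obtain M where M: "M > 0" "\<forall>y\<in>f ` closure (u ` \<Omega>). norm y \<le> M"
    unfolding bounded_pos by blast
  show ?thesis
  proof (intro exI[of _ M] conjI ballI)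
    show "M \<ge> 0" using M by simp
    fix x assume "x \<in> \<Omega>"
    then have "f (u x) \<in> f ` closure (u ` \<Omega>)" using closure_subset[of "u ` \<Omega>"] by blast
    then show "\<bar>f (u x)\<bar> \<le> M" using M by auto
  qed
qed

text \<open>The maximum of \<open>Pb \<rho>\<^sup>p exp (\<eta> exp (K u))\<close> over the ball of radius \<open>R\<close> about \<open>x0\<close> is
  attained inside \<open>\<Omega>\<close> whenever \<open>P x0 > c\<close>, and letting \<open>R\<close> grow contradicts the estimate there.\<close>
theorem P_le_c:
  assumes x0: "x0 \<in> \<Omega>"
  shows "P x0 \<le> c"
proof (rule ccontr)
  assume "\<not> P x0 \<le> c"
  then have P0: "P x0 > c" "P x0 > 0" using c_nonneg by auto
  define m where "m = max 1 (p - 1)"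
  have m: "m \<ge> 1" by (simp add: m_def)
  obtain M where M: "M \<ge> 0" "\<And>x. x \<in> \<Omega> \<Longrightarrow> \<bar>f (u x)\<bar> \<le> M"
    using f_u_bound by blast
  obtain B where B: "B > 0" "\<And>x. x \<in> \<Omega> \<Longrightarrow> u x \<le> B"
    using u_bdd unfolding bounded_pos by (metis abs_le_D1 imageI real_norm_def)
  \<comment> \<open>At the maximum \<open>P x0\<close> is at most
    \<open>\<rho> x powr p * w x\<close> times an exponential bounded by 2, so half of
    \<open>P x0\<close> bounds this product, and with it \<open>w x\<close>, from below.\<close>
  define w0 where "w0 = P x0 / 2"
  have w0: "w0 > 0" using P0 by (simp add: w0_def)
  define K where "K = 1 + 2 * M / w0"
  have K: "K \<ge> 1" "K \<ge> 2 * M / w0" using M w0 by (auto simp: K_def)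
  \<comment> \<open>The bound \<open>ln 2\<close> provides that factor 2, the bound
    \<open>(p - 1) / (8 * m)\<close> serves the estimate at the maximum, and
    \<open>c * exp \<epsilon> < P x0\<close> keeps the maximum off the frontier, where
    \<open>Pb\<close> equals \<open>c\<close>.\<close>
  obtain \<epsilon> where e: "\<epsilon> > 0" "\<epsilon> \<le> ln 2" "\<epsilon> \<le> (p - 1) / (8 * m)" "c * exp \<epsilon> < P x0"
  proof (rule that)
    define e1 where "e1 = (if c > 0 then ln (P x0 / c) / 2 else 1)"
    let ?e = "min (min (ln 2) ((p - 1) / (8 * m))) e1"
    have e1: "e1 > 0" "c * exp e1 < P x0"
    proof -
      show "e1 > 0" using P0 by (auto simp: e1_def)
      show "c * exp e1 < P x0"
      proof (cases "c > 0")
        case True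
        then have "ln (P x0 / c) > 0" using P0 by simp
        then have "e1 < ln (P x0 / c)" using True by (simp add: e1_def)
        then have "exp e1 < exp (ln (P x0 / c))" by (simp only: exp_less_cancel_iff)
        also have "\<dots> = P x0 / c" using True P0 by simp
        finally show ?thesis using True by (simp add: field_simps)
      next
        case False
        then show ?thesis using c_nonneg P0 by simp
      qed
    qed
    show "?e > 0" using p1 m e1 by simp
    have "c * exp ?e \<le> c * exp e1" using c_nonneg by (intro mult_left_mono) auto
    then show "c * exp ?e < P x0" using e1 by linarith
  qed auto
  \<comment> \<open>Normalised by the bound \<open>B\<close> of \<open>u\<close>, so that
    \<open>\<eta> * exp (K * u)\<close> never exceeds \<open>\<epsilon>\<close>.\<close>
  define \<eta> where "\<eta> = \<epsilon> * exp (- K * B)"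
  have \<eta>: "\<eta> > 0" using e by (simp add: \<eta>_def)
  define k where "k s = \<eta> * exp (K * s)" for s
  have k: "k s \<le> \<epsilon>" if "s \<le> B" for s
  proof -
    have "k s = \<epsilon> * exp (K * (s - B))" by (simp add: k_def \<eta>_def mult_exp_exp algebra_simps)
    also have "\<dots> \<le> \<epsilon> * 1" using e K that by (intro mult_left_mono) (auto simp: mult_nonneg_nonpos)
    finally show ?thesis by simp
  qed
  have kpos: "k s > 0" for s using \<eta> by (simp add: k_def)
  have ee: "exp \<epsilon> \<le> 2" using e by (metis exp_le_cancel_iff exp_ln zero_less_numeral)
  define C3 where "C3 = 8 * m * p\<^sup>2 + 4 * p * m + 2 * p * (CARD('n) + p)"
  define C2 where "C2 = 2 * p\<^sup>2 * M / w0"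
  define \<theta> where "\<theta> = (p - 1) / 4 * \<eta>"
  have C: "C3 \<ge> 0" "C2 \<ge> 0" "\<theta> > 0" using p1 m M w0 \<eta> by (auto simp: C3_def C2_def \<theta>_def)
  define y where "y = w0 powr (1 / p)"
  have y: "y > 0" using w0 by (simp add: y_def)
  \<comment> \<open>Fixed by the final contradiction: \<open>X\<close> below is at least
    \<open>R * y\<close>, whereas the estimate allows at most \<open>(C2 + C3) / \<theta>\<close>.
    The extra 1 makes \<open>X\<close> exceed 1, so that \<open>C3\<close> is absorbed by
    \<open>C3 * X\<close>.\<close>
  define R where "R = (1 + (C2 + C3) / \<theta>) / y + 1"
  have R: "R > 0" "R * y > 1" "R * y > (C2 + C3) / \<theta>"
  proof -
    have "(C2 + C3) / \<theta> \<ge> 0" using C by simp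
    then show "R > 0" using y by (auto simp: R_def intro!: add_nonneg_pos)
    have "R * y = 1 + (C2 + C3) / \<theta> + y" using y by (simp add: R_def field_simps)
    then show "R * y > 1" "R * y > (C2 + C3) / \<theta>" using y \<open>(C2 + C3) / \<theta> \<ge> 0\<close> by linarith+
  qed
  define \<rho> where "\<rho> x = 1 - (x - x0) \<bullet> (x - x0) / R\<^sup>2" for x
  define Mf where "Mf x = Pb x * \<rho> x powr p * exp (k (u x))" for x
  define CC where "CC = closure \<Omega> \<inter> cball x0 R"
  have \<rho>: "0 \<le> \<rho> x" "\<rho> x \<le> 1" if "x \<in> CC" for x
  proof -
    have "norm (x - x0) \<le> R" using that by (simp add: CC_def dist_norm norm_minus_commute)
    then have "(norm (x - x0))\<^sup>2 \<le> R\<^sup>2" by (intro power_mono) auto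
    then have "(x - x0) \<bullet> (x - x0) \<le> R\<^sup>2" by (simp add: power2_norm_eq_inner)
    then show "0 \<le> \<rho> x" "\<rho> x \<le> 1" using R by (auto simp: \<rho>_def field_simps)
  qed
  have "compact CC" unfolding CC_def by (intro closed_Int_compact) auto
  moreover have "x0 \<in> CC" using x0 R closure_subset by (auto simp: CC_def)
  moreover have "continuous_on CC Mf"
  proof -
    have "continuous_on CC Pb" "continuous_on CC u"
      using Pb_cont u_cont by (auto simp: CC_def intro: continuous_on_subset)
    then show ?thesis unfolding Mf_def k_def \<rho>_def
      using \<rho> p1 R by (intro continuous_intros continuous_on_powr') (auto simp: \<rho>_def)
  qed
  ultimately obtain x where x: "x \<in> CC" "\<And>y. y \<in> CC \<Longrightarrow> Mf y \<le> Mf x"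
    using continuous_attains_sup[of CC Mf] by blast
  have "Mf x0 = P x0 * exp (k (u x0))" using x0 by (simp add: Mf_def \<rho>_def Pb_eq)
  then have "Mf x0 \<ge> P x0 * 1"
    using P0 kpos[of "u x0"] by (auto intro!: mult_left_mono)
  then have Mx: "Mf x \<ge> P x0" using x(2)[OF \<open>x0 \<in> CC\<close>] by simp
  then have Mpos: "Mf x > 0" using P0 by simp
  have \<rho>pos: "\<rho> x > 0" using Mpos \<rho>[OF x(1)] by (cases "\<rho> x = 0") (auto simp: Mf_def)
  have rp: "0 < \<rho> x powr p" "\<rho> x powr p \<le> 1"
    using \<rho>pos \<rho>[OF x(1)] p1 powr_le1[of p "\<rho> x"] by auto
  have Pbpos: "Pb x > 0"
    using Mpos rp by (simp add: Mf_def zero_less_mult_iff)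
  have xO: "x \<in> \<Omega>"
  proof (rule ccontr)
    assume "x \<notin> \<Omega>"
    then have q: "x \<in> frontier \<Omega>" using x(1) open_Omega by (auto simp: CC_def frontier_def interior_open)
    have "Mf x = c * (\<rho> x powr p * exp (k 0))" using q by (simp add: Mf_def Pb_frontier u_zero)
    also have "\<dots> \<le> c * (1 * exp \<epsilon>)"
      using c_nonneg rp k[of 0] B by (intro mult_left_mono mult_mono) auto
    finally show False using e Mx by simp
  qed
  have Px: "P x > 0" using Pbpos Pb_eq[OF xO] by simp
  have wle: "\<rho> x powr p * w x \<ge> w0"
  proof -
    have "P x0 \<le> P x * \<rho> x powr p * exp (k (u x))" using Mx Pb_eq[OF xO] by (simp add: Mf_def)
    also have "\<dots> \<le> w x * \<rho> x powr p * 2"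
      using P_le_w[of x] Px rp order_trans[OF exp_le_cancel_iff[THEN iffD2, OF k[OF B(2)[OF xO]]] ee]
      by (intro mult_mono) (auto simp: w_def)
    finally show ?thesis by (simp add: w0_def mult.commute)
  qed
  have ww: "w0 \<le> w x"
    using wle mult_right_mono[OF rp(2), of "w x"] by (simp add: w_def)
  have nR: "norm (x - x0) < R"
  proof -
    have "(norm (x - x0))\<^sup>2 < R\<^sup>2" using \<rho>pos R by (simp add: \<rho>_def power2_norm_eq_inner field_simps)
    then show ?thesis by (rule power2_less_imp_less) (use R in simp)
  qed
  have ev: "\<forall>\<^sub>F z in nhds x. ln (P z) + (\<eta> * exp (K * u z) + p * ln (1 - (z - x0) \<bullet> (z - x0) / R\<^sup>2))
       \<le> ln (P x) + (\<eta> * exp (K * u x) + p * ln (1 - (x - x0) \<bullet> (x - x0) / R\<^sup>2))"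
  proof -
    have "continuous_on (\<Omega> \<inter> ball x0 R) P"
      by (rule continuous_on_subset[OF P_cont]) auto
    then have "open ((\<Omega> \<inter> ball x0 R) \<inter> P -` {0<..})"
      using open_Omega by (intro continuous_open_preimage) auto
    moreover have "x \<in> (\<Omega> \<inter> ball x0 R) \<inter> P -` {0<..}"
      using xO nR Px by (auto simp: dist_norm norm_minus_commute)
    ultimately have "\<forall>\<^sub>F z in nhds x. z \<in> (\<Omega> \<inter> ball x0 R) \<inter> P -` {0<..}"
      by (rule eventually_nhds_in_open)
    then show ?thesis
    proof eventually_elim
      case (elim z)
      have lnM: "ln (Mf z) = ln (P z) + (k (u z) + p * ln (\<rho> z))" if "z \<in> \<Omega>" "P z > 0" "\<rho> z > 0" for z
        using that by (simp add: Mf_def Pb_eq ln_mult ln_powr)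
      have "(norm (z - x0))\<^sup>2 < R\<^sup>2" using elim R by (intro power_strict_mono) (auto simp: dist_norm norm_minus_commute)
      then have zr: "\<rho> z > 0" using R by (simp add: \<rho>_def power2_norm_eq_inner field_simps)
      have "z \<in> CC" using elim closure_subset[of \<Omega>] by (auto simp: CC_def)
      then have "Mf z \<le> Mf x" by (rule x(2))
      moreover have "Mf z > 0" using elim zr by (simp add: Mf_def Pb_eq)
      ultimately have "ln (Mf z) \<le> ln (Mf x)" using Mpos by simp
      then show ?case
        using lnM[of z] lnM[of x] elim zr xO Px \<rho>pos by (simp add: k_def \<rho>_def)
    qed
  qed
  define D where "D = R\<^sup>2 - (x - x0) \<bullet> (x - x0)"
  have DR: "D = \<rho> x * R\<^sup>2" using R by (simp add: D_def \<rho>_def field_simps)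
  have Dpos: "D > 0" using DR \<rho>pos R by simp
  have est: "\<theta> * W x \<le> C3 * (R / D)\<^sup>2 + C2 * (norm (g x) * (R / D))"
    unfolding \<theta>_def C3_def C2_def m_def D_def
    by (rule cutoff_max_estimate[OF xO Px R(1) nR M(2)[OF xO] w0 ww K \<eta> _ _ ev])
       (use k[OF B(2)[OF xO]] e u_pos[OF xO] in \<open>auto simp: k_def m_def\<close>)
  \<comment> \<open>Multiplying the estimate by the square of \<open>D / R\<close> turns it into a
    quadratic inequality for \<open>X\<close>, which is \<open>R\<close> times the cutoff gradient
    \<open>\<rho> x * norm (g x)\<close>. The exponent \<open>p\<close> on the cutoff makes
    \<open>\<rho> x powr p * w x\<close> the p-th power of that cutoff gradient.\<close>
  define X where "X = norm (g x) * (D / R)"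
  have X: "X = R * (\<rho> x * norm (g x))" using R by (simp add: X_def DR power2_eq_square)
  have "(\<rho> x * norm (g x)) powr p \<ge> w0"
    using wle \<rho>pos by (simp add: w_eq_norm powr_mult)
  then have "((\<rho> x * norm (g x)) powr p) powr (1 / p) \<ge> y"
    unfolding y_def using w0 p1 by (intro powr_mono2) auto
  then have "\<rho> x * norm (g x) \<ge> y"
    using \<rho>pos p1 by (simp add: powr_powr)
  then have Xy: "X \<ge> R * y" using R by (simp add: X)
  have "\<theta> * W x * (D / R)\<^sup>2 \<le> (C3 * (R / D)\<^sup>2 + C2 * (norm (g x) * (R / D))) * (D / R)\<^sup>2"
    using est by (intro mult_right_mono) auto
  also have "\<dots> = C3 + C2 * X"
    using Dpos R by (simp add: X_def field_simps power2_eq_square)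
  also have "\<theta> * W x * (D / R)\<^sup>2 = \<theta> * X\<^sup>2"
    by (simp add: X_def W_eq_norm power_mult_distrib power_divide)
  finally have "\<theta> * X\<^sup>2 \<le> C3 + C2 * X" .
  moreover have "X > 1" using Xy R by linarith
  then have "C3 * 1 \<le> C3 * X" using C by (intro mult_left_mono) auto
  ultimately have "\<theta> * X * X \<le> (C2 + C3) * X" by (simp add: power2_eq_square algebra_simps)
  then have "\<theta> * X \<le> C2 + C3" using \<open>X > 1\<close> by simp
  then have "X \<le> (C2 + C3) / \<theta>" using C by (simp add: field_simps)
  then show False using Xy R by linarith
qed

end

section \<open>Rigidity\<close>

text \<open>\<open>u\<close> does not decrease in directions \<open>v\<close> with
  \<open>a \<bullet> v \<ge> 0\<close>, so a ray in such a direction cannot leave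
  \<open>\<Omega>\<close>: at the exit point \<open>u\<close> would vanish. Invariance of
  \<open>\<Omega>\<close> under all these translations makes it a half-space, and comparing
  \<open>v\<close> with \<open>- v\<close> makes \<open>u\<close> constant across
  \<open>a\<close>.\<close>

lemma parallel_solI:
  fixes \<Omega> :: "(real^'n) set"
  assumes op: "open \<Omega>" and a: "norm a = 1"
    and der: "\<And>x. x \<in> \<Omega> \<Longrightarrow> (u has_derivative (\<lambda>h. r x * (a \<bullet> h))) (at x)" and r: "\<And>x. x \<in> \<Omega> \<Longrightarrow> r x > 0"
    and cont: "continuous_on (closure \<Omega>) u" and pos: "\<And>x. x \<in> \<Omega> \<Longrightarrow> u x > 0"
    and zero: "\<And>q. q \<in> frontier \<Omega> \<Longrightarrow> u q = 0" and q: "q \<in> frontier \<Omega>"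
  shows "parallel_sol \<Omega> u"
proof -
  have aa: "a \<bullet> a = 1" using a by (simp add: norm_eq_1)
  have mono: "u x \<le> u (x + t *\<^sub>R v)"
    if v: "a \<bullet> v \<ge> 0" and t: "t \<ge> 0" and mem: "\<And>s. 0 \<le> s \<Longrightarrow> s \<le> t \<Longrightarrow> x + s *\<^sub>R v \<in> \<Omega>" for x v t
  proof -
    have "((\<lambda>s. u (x + s *\<^sub>R v)) has_real_derivative r (x + s *\<^sub>R v) * (a \<bullet> v)) (at s)" if "0 \<le> s" "s \<le> t" for s
    proof -
      have "((\<lambda>k. u (x + s *\<^sub>R v + k *\<^sub>R v)) has_real_derivative r (x + s *\<^sub>R v) * (a \<bullet> v)) (at 0)"
        by (rule has_derivative_direction[OF der[OF mem[OF that]]])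
      then have "((\<lambda>k. u (x + (k + s) *\<^sub>R v)) has_real_derivative r (x + s *\<^sub>R v) * (a \<bullet> v)) (at 0)"
        by (simp add: algebra_simps)
      then show ?thesis using DERIV_shift[of "\<lambda>k. u (x + k *\<^sub>R v)" _ 0 s] by simp
    qed
    moreover have "r (x + s *\<^sub>R v) * (a \<bullet> v) \<ge> 0" if "0 \<le> s" "s \<le> t" for s
      using r[OF mem[OF that]] v by simp
    ultimately have "u (x + 0 *\<^sub>R v) \<le> u (x + t *\<^sub>R v)"
      by (intro DERIV_nonneg_imp_nondecreasing[OF t, of "\<lambda>s. u (x + s *\<^sub>R v)"]) blast
    then show ?thesis by simp
  qed
  have stay: "x + v \<in> \<Omega>" if x: "x \<in> \<Omega>" and v: "a \<bullet> v \<ge> 0" for x v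
  proof (rule ccontr)
    assume out: "x + v \<notin> \<Omega>"
    define N where "N = {0..1} \<inter> (\<lambda>t. x + t *\<^sub>R v) -` (- \<Omega>)"
    have "closed N" unfolding N_def
      by (intro continuous_closed_preimage continuous_intros) (use op in auto)
    moreover have "bounded N" unfolding N_def by (rule bounded_subset[of "{0..1}"]) auto
    ultimately have "compact N" by (simp add: compact_eq_bounded_closed)
    moreover have "1 \<in> N" using out by (simp add: N_def)
    \<comment> \<open>The first exit time. Monotonicity is available before it and reaches the exit
      point through continuity of \<open>u\<close> on the closure.\<close>
    ultimately obtain t where t: "t \<in> N" "\<And>s. s \<in> N \<Longrightarrow> t \<le> s"
      using compact_attains_inf[of N] by blast
    have t0: "t > 0"
    proof -
      have "t \<noteq> 0" using t(1) x by (auto simp: N_def)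
      then show ?thesis using t(1) by (auto simp: N_def)
    qed
    have mem: "x + s *\<^sub>R v \<in> \<Omega>" if "0 \<le> s" "s < t" for s
      using t that by (force simp: N_def)
    have lim: "((\<lambda>s. x + s *\<^sub>R v) \<longlongrightarrow> x + t *\<^sub>R v) (at_left t)"
      by (intro tendsto_intros)
    have ev: "\<forall>\<^sub>F s in at_left t. 0 \<le> s \<and> s < t"
      using eventually_at_left_real[OF t0] by (auto elim: eventually_mono)
    have cl: "x + t *\<^sub>R v \<in> closure \<Omega>"
      using ev mem closure_subset by (intro Lim_in_closed_set[OF closed_closure _ _ lim]) (auto elim!: eventually_mono)
    then have "x + t *\<^sub>R v \<in> frontier \<Omega>"
      using t(1) op by (auto simp: N_def frontier_def interior_open)
    then have "u (x + t *\<^sub>R v) = 0" by (rule zero)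
    moreover have "((\<lambda>s. u (x + s *\<^sub>R v)) \<longlongrightarrow> u (x + t *\<^sub>R v)) (at_left t)"
      by (rule continuous_on_tendsto_compose[OF cont lim cl])
         (use ev mem closure_subset in \<open>auto elim!: eventually_mono\<close>)
    then have "u x \<le> u (x + t *\<^sub>R v)"
      by (rule tendsto_lowerbound)
         (use ev mem in \<open>auto elim!: eventually_mono intro!: mono[OF v]\<close>)
    ultimately show False using pos[OF x] by simp
  qed
  have incr: "u x \<le> u (x + v)" if x: "x \<in> \<Omega>" and v: "a \<bullet> v \<ge> 0" for x v
    using mono[OF v, of 1 x] stay[OF x, of "_ *\<^sub>R v"] v by auto
  have const: "u (x + v) = u x" if x: "x \<in> \<Omega>" and v: "a \<bullet> v = 0" for x v
    using incr[OF x, of v] incr[OF stay[OF x, of v], of "- v"] v by simp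
  have qn: "q \<notin> \<Omega>" and qc: "q \<in> closure \<Omega>" using q op by (auto simp: frontier_def interior_open)
  have half: "\<Omega> = {x. a \<bullet> (x - q) > 0}"
  proof (intro set_eqI iffI; clarsimp)
    fix x assume x: "x \<in> \<Omega>"
    show "a \<bullet> (x - q) > 0"
    proof (rule ccontr)
      assume "\<not> a \<bullet> (x - q) > 0"
      then have "a \<bullet> (q - x) \<ge> 0" by (simp add: inner_diff_right)
      from stay[OF x this] qn show False by simp
    qed
  next
    fix x assume x: "a \<bullet> (x - q) > 0"
    \<comment> \<open>The open half-space of points below \<open>x\<close> contains the frontier
      point \<open>q\<close> and hence a point \<open>y\<close> of \<open>\<Omega>\<close>, from
      which \<open>x\<close> is reached in an admissible direction.\<close>
    have op': "open {y. a \<bullet> (x - y) > 0}"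
      by (intro open_Collect_less continuous_intros)
    have "{y. a \<bullet> (x - y) > 0} \<inter> closure \<Omega> \<noteq> {}" using qc x by auto
    then have "{y. a \<bullet> (x - y) > 0} \<inter> \<Omega> \<noteq> {}" using open_Int_closure_eq_empty[OF op', of \<Omega>] by blast
    then obtain y where y: "y \<in> \<Omega>" "a \<bullet> (x - y) > 0" by blast
    from stay[OF y(1), of "x - y"] y(2) show "x \<in> \<Omega>" by simp
  qed
  have "u x = u (q + (a \<bullet> (x - q)) *\<^sub>R a)" if x: "x \<in> \<Omega>" for x
  proof -
    have "u (x + ((q + (a \<bullet> (x - q)) *\<^sub>R a) - x)) = u x"
      by (rule const[OF x]) (simp add: inner_diff_right inner_add_right aa)
    then show ?thesis by simp
  qed
  then show ?thesis unfolding parallel_sol_def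
    using half by (intro exI[of _ q] exI[of _ a] exI[of _ "\<lambda>s. u (q + s *\<^sub>R a)"]) auto
qed

context overdet begin

text \<open>A constant has a local maximum at every point, so \<open>L\<close> of \<open>P\<close>
  is nonpositive and the squares in \<open>L_P\<close> vanish one by one.\<close>

lemma P_const_rigid:
  assumes const: "\<And>x. x \<in> \<Omega> \<Longrightarrow> P x = c" and W: "\<And>x. x \<in> \<Omega> \<Longrightarrow> W x > 0" and x: "x \<in> \<Omega>"
  shows "A x *v h = (\<sigma> x / (W x)\<^sup>2 * (g x \<bullet> h)) *\<^sub>R g x" "Ag x = (\<sigma> x / W x) *\<^sub>R g x"
proof -
  have Wx: "W x > 0" by (rule W[OF x])
  have "\<forall>\<^sub>F y in nhds x. y \<in> \<Omega>" using open_Omega x by (rule eventually_nhds_in_open)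
  then have "\<forall>\<^sub>F y in nhds x. P y \<le> P x" by eventually_elim (simp add: const x)
  from L_local_max(1)[OF twice_P[OF x Wx] this Wx]
  have "L x (GP x) (HP x) \<le> 0" .
  define b1 where "b1 = (Ag x \<bullet> Ag x) / W x - (\<sigma> x)\<^sup>2 / (W x)\<^sup>2"
  define b2 where "b2 = (\<Sum>i\<in>UNIV. \<Sum>j\<in>UNIV. (tang x $ i $ j)\<^sup>2)"
  define b3 where "b3 = (trace (A x) - \<sigma> x / W x)\<^sup>2"
  have nn: "b1 \<ge> 0" "b2 \<ge> 0" "b3 \<ge> 0" using beta_nonneg[OF Wx] by (auto simp: b1_def b2_def b3_def intro!: sum_nonneg)
  have "(p - 1) * (w x / W x) * (2 * b1 + b2 + b3) \<le> 0"
    using \<open>L x (GP x) (HP x) \<le> 0\<close> unfolding L_P[OF x Wx] b1_def b2_def b3_def .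
  moreover have "(p - 1) * (w x / W x) > 0" using p1 Wx w_pos[OF Wx] by simp
  ultimately have "2 * b1 + b2 + b3 \<le> 0" by (meson mult_pos_pos not_le)
  then have z: "b1 = 0" "b2 = 0" using nn by auto
  have "(Ag x - (\<sigma> x / W x) *\<^sub>R g x) \<bullet> (Ag x - (\<sigma> x / W x) *\<^sub>R g x) = W x * b1"
  proof -
    have "(Ag x - (\<sigma> x / W x) *\<^sub>R g x) \<bullet> (Ag x - (\<sigma> x / W x) *\<^sub>R g x)
      = Ag x \<bullet> Ag x - 2 * (\<sigma> x / W x) * \<sigma> x + (\<sigma> x / W x)\<^sup>2 * W x"
      by (simp add: inner_diff_left inner_diff_right \<sigma>_def W_def inner_commute power2_eq_square algebra_simps)
    also have "\<dots> = W x * b1" using Wx by (simp add: b1_def field_simps power2_eq_square)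
    finally show ?thesis .
  qed
  then show s: "Ag x = (\<sigma> x / W x) *\<^sub>R g x" using z by simp
  have "tang x $ i $ j = 0" for i j
  proof -
    have "\<forall>i\<in>UNIV. (\<Sum>j\<in>UNIV. (tang x $ i $ j)\<^sup>2) = 0"
      using z(2) unfolding b2_def by (subst (asm) sum_nonneg_eq_0_iff) (auto intro: sum_nonneg)
    then have "\<forall>j\<in>UNIV. (tang x $ i $ j)\<^sup>2 = 0"
      by (subst (asm) sum_nonneg_eq_0_iff) auto
    then show ?thesis by simp
  qed
  then have "A x $ i $ j = \<sigma> x / (W x)\<^sup>2 * (g x $ i * g x $ j)" for i j
    using Wx by (auto simp: tang_def s field_simps power2_eq_square)
  then show "A x *v h = (\<sigma> x / (W x)\<^sup>2 * (g x \<bullet> h)) *\<^sub>R g x"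
    by (simp add: vec_eq_iff matrix_vector_mult_def inner_vec_def sum_distrib_left sum_distrib_right mult_ac)
qed

lemma P_const_parallel:
  assumes const: "\<And>x. x \<in> \<Omega> \<Longrightarrow> P x = c" and W: "\<And>x. x \<in> \<Omega> \<Longrightarrow> W x > 0"
    and conn: "connected \<Omega>" "\<Omega> \<noteq> {}" and q: "q \<in> frontier \<Omega>"
  shows "parallel_sol \<Omega> u"
proof -
  \<comment> \<open>The normalised gradient. By rigidity both terms of its derivative are multiples
    of \<open>g x\<close>, and they cancel.\<close>
  let ?\<nu> = "\<lambda>x. W x powr (-1/2) *\<^sub>R g x"
  have der: "(?\<nu> has_derivative (\<lambda>h. 0)) (at x)" if x: "x \<in> \<Omega>" for x
  proof -
    have "(?\<nu> has_derivative (\<lambda>h. W x powr (-1/2) *\<^sub>R (A x *v h) + (2 * (-1/2) * W x powr (-1/2 - 1) * (Ag x \<bullet> h)) *\<^sub>R g x)) (at x)"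
      by (intro has_derivative_scaleR has_derivative_W_powr[OF x W[OF x]] has_derivative_g[OF x])
    moreover have "W x powr (-1/2) *\<^sub>R (A x *v h) + (2 * (-1/2) * W x powr (-1/2 - 1) * (Ag x \<bullet> h)) *\<^sub>R g x = 0" for h
    proof -
      have "W x powr (-1/2 - 1) = W x powr (-1/2) / W x" using W[OF x] by (subst powr_diff) simp
      moreover have "Ag x \<bullet> h = \<sigma> x / W x * (g x \<bullet> h)"
        by (subst P_const_rigid(2)[OF const W x]) simp_all
      ultimately show ?thesis
        using P_const_rigid(1)[OF const W x, of h] by (simp add: power2_eq_square flip: scaleR_add_left)
    qed
    ultimately show ?thesis by simp
  qed
  obtain x0 where x0: "x0 \<in> \<Omega>" using conn by auto
  define a where "a = ?\<nu> x0"
  have aeq: "?\<nu> x = a" if "x \<in> \<Omega>" for x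
    unfolding a_def using has_derivative_zero_unique_connected[OF open_Omega conn(1) der that x0] by simp
  have ga: "g x = W x powr (1/2) *\<^sub>R a" if "x \<in> \<Omega>" for x
  proof -
    have "W x powr (1/2) *\<^sub>R a = (W x powr (1/2) * W x powr (-1/2)) *\<^sub>R g x"
      using aeq[OF that, symmetric] by simp
    also have "W x powr (1/2) * W x powr (-1/2) = 1"
      using W[OF that] by (simp flip: powr_add)
    finally show ?thesis by simp
  qed
  show ?thesis
  proof (rule parallel_solI[OF open_Omega _ _ _ u_cont u_pos u_zero q, where a=a and r="\<lambda>x. W x powr (1/2)"])
    have "W x0 powr (1/2) = norm (g x0)"
      using W_eq_norm[of x0] by (simp add: powr_half_sqrt)
    then have "norm (g x0) = norm (g x0) * norm a"
      by (subst ga[OF x0]) simp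
    then show "norm a = 1" using W[OF x0] by (simp add: W_pos)
  next
    fix x assume x: "x \<in> \<Omega>"
    show "(u has_derivative (\<lambda>h. W x powr (1/2) * (a \<bullet> h))) (at x)"
      using has_derivative_u[OF x] ga[OF x] by simp
    show "W x powr (1/2) > 0" using W[OF x] by simp
  qed
qed

text \<open>For \<open>p > 2\<close> this is the growth assumption. For \<open>p \<le> 2\<close> it
  is automatic: a zero of the nonpositive \<open>F\<close> is a maximum, so \<open>f u0 = 0\<close>,
  differentiability of \<open>f\<close> bounds \<open>F\<close> quadratically, and below distance 1
  a square is dominated by the p-th power.\<close>

lemma potential_growth:
  assumes F_deg: "p > 2 \<Longrightarrow> \<forall>u0. F u0 = 0 \<longrightarrow> F \<in> O[at u0](\<lambda>s. \<bar>s - u0\<bar> powr p)"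
    and u0: "F u0 = 0"
  obtains C \<delta> where "C > 0" "\<delta> > 0" "\<And>s. \<bar>s - u0\<bar> < \<delta> \<Longrightarrow> - F s \<le> C * \<bar>s - u0\<bar> powr p"
proof (cases "p > 2")
  case True
  then have "F \<in> O[at u0](\<lambda>s. \<bar>s - u0\<bar> powr p)" using F_deg u0 by blast
  then obtain C where C: "C > 0" "\<forall>\<^sub>F s in at u0. norm (F s) \<le> C * norm (\<bar>s - u0\<bar> powr p)"
    by (rule landau_o.bigE)
  then obtain \<delta> where \<delta>: "\<delta> > 0" "\<And>s. s \<noteq> u0 \<Longrightarrow> \<bar>s - u0\<bar> < \<delta> \<Longrightarrow> \<bar>F s\<bar> \<le> C * \<bar>s - u0\<bar> powr p"
    unfolding eventually_at by (auto simp: dist_real_def)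
  show thesis
  proof (rule that[OF C(1) \<delta>(1)])
    fix s assume "\<bar>s - u0\<bar> < \<delta>"
    then show "- F s \<le> C * \<bar>s - u0\<bar> powr p"
      using \<delta>(2)[of s] u0 by (cases "s = u0") auto
  qed
next
  case False
  have f0: "f u0 = 0"
    using DERIV_local_max[OF F_prim[of u0], of 1] F_nonpos u0 by simp
  have "((\<lambda>s. (f s - f u0) / (s - u0)) \<longlongrightarrow> deriv f u0) (at u0)"
    using f_deriv[of u0] by (simp add: has_field_derivative_iff)
  then have "\<forall>\<^sub>F s in at u0. dist ((f s - f u0) / (s - u0)) (deriv f u0) < 1"
    by (auto simp: tendsto_iff)
  then obtain \<delta> where \<delta>: "\<delta> > 0" "\<And>s. s \<noteq> u0 \<Longrightarrow> \<bar>s - u0\<bar> < \<delta> \<Longrightarrow> \<bar>f s / (s - u0) - deriv f u0\<bar> < 1"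
    unfolding eventually_at using f0 by (auto simp: dist_real_def)
  define C where "C = \<bar>deriv f u0\<bar> + 1"
  have fb: "\<bar>f s\<bar> \<le> C * \<bar>s - u0\<bar>" if "\<bar>s - u0\<bar> < \<delta>" for s
  proof (cases "s = u0")
    case False
    then have "\<bar>f s / (s - u0)\<bar> \<le> C" using \<delta>(2)[OF False that] unfolding C_def by linarith
    then show ?thesis using False by (simp add: abs_divide pos_divide_le_eq)
  qed (simp add: f0)
  show thesis
  proof (rule that[of C "min \<delta> 1"])
    show "C > 0" "min \<delta> 1 > 0" using \<delta> by (auto simp: C_def)
    fix s assume s: "\<bar>s - u0\<bar> < min \<delta> 1"
    have "norm (F s - F u0) \<le> C * \<bar>s - u0\<bar> * norm (s - u0)"
    proof (rule field_differentiable_bound[where S="closed_segment u0 s" and f'=f])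
      fix z assume z: "z \<in> closed_segment u0 s"
      have zs: "\<bar>z - u0\<bar> \<le> \<bar>s - u0\<bar>" using z by (auto simp: closed_segment_eq_real_ivl split: if_splits)
      have "\<bar>f z\<bar> \<le> C * \<bar>z - u0\<bar>" using zs s by (intro fb) auto
      also have "\<dots> \<le> C * \<bar>s - u0\<bar>" using zs by (intro mult_left_mono) (auto simp: C_def)
      finally show "norm (f z) \<le> C * \<bar>s - u0\<bar>" by simp
    qed (auto intro!: has_field_derivative_at_within[OF F_prim])
    then have "- F s \<le> C * \<bar>s - u0\<bar>\<^sup>2" using u0 by (simp add: power2_eq_square)
    also have "\<bar>s - u0\<bar>\<^sup>2 = \<bar>s - u0\<bar> powr 2" by (cases "s = u0") simp_all
    also have "C * \<bar>s - u0\<bar> powr 2 \<le> C * \<bar>s - u0\<bar> powr p"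
      using False s by (intro mult_left_mono powr_mono') (auto simp: C_def)
    finally show "- F s \<le> C * \<bar>s - u0\<bar> powr p" .
  qed
qed

text \<open>At a critical point the signs of \<open>F\<close> and \<open>c\<close> force both to be
  zero. Then \<open>P \<le> 0\<close> and the growth of the potential bound the gradient by a
  multiple of the distance of \<open>u\<close> to the value \<open>u x\<close>, so this level set is
  open as well as closed; \<open>u\<close> would be constant, against the nonzero boundary
  gradient.\<close>

lemma regular_where_P_eq_c:
  assumes F_deg: "p > 2 \<Longrightarrow> \<forall>u0. F u0 = 0 \<longrightarrow> F \<in> O[at u0](\<lambda>s. \<bar>s - u0\<bar> powr p)"
    and conn: "connected \<Omega>" and q: "q \<in> frontier \<Omega>" and x: "x \<in> \<Omega>" and Px: "P x = c"
  shows "W x > 0"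
proof (rule ccontr)
  assume "\<not> W x > 0"
  then have "W x = 0" using W_nonneg[of x] by simp
  then have "F (u x) = c" using Px by (simp add: P_def w_def)
  then have Fx: "F (u x) = 0" and c0: "c = 0" using c_nonneg F_nonpos[of "u x"] by auto
  obtain C \<delta> where C: "C > 0" "\<delta> > 0" "\<And>s. \<bar>s - u x\<bar> < \<delta> \<Longrightarrow> - F s \<le> C * \<bar>s - u x\<bar> powr p"
    using potential_growth[OF F_deg Fx] by blast
  define C' where "C' = (p / (p - 1) * C) powr (1 / p)"
  have C': "C' > 0" using C p1 by (simp add: C'_def)
  have gb: "norm (g y) \<le> C' * \<bar>u y - u x\<bar>" if y: "y \<in> \<Omega>" "\<bar>u y - u x\<bar> < \<delta>" for y
  proof -
    have "(p - 1) / p * w y \<le> - F (u y)" using P_le_c[OF y(1)] c0 by (simp add: P_def)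
    also have "\<dots> \<le> C * \<bar>u y - u x\<bar> powr p" using C(3)[OF y(2)] .
    finally have "norm (g y) powr p \<le> p / (p - 1) * C * \<bar>u y - u x\<bar> powr p"
      using p1 by (simp add: w_eq_norm field_simps)
    then have "(norm (g y) powr p) powr (1 / p) \<le> (p / (p - 1) * C * \<bar>u y - u x\<bar> powr p) powr (1 / p)"
      using p1 by (intro powr_mono2) auto
    also have "\<dots> = C' * (\<bar>u y - u x\<bar> powr p) powr (1 / p)"
      unfolding C'_def by (rule powr_mult)
    finally show ?thesis using p1 by (simp add: powr_powr)
  qed
  define Z where "Z = {y\<in>\<Omega>. u y = u x}"
  have uc: "continuous_on \<Omega> u" by (rule continuous_on_subset[OF u_cont closure_subset])
  have "open Z"
  proof (subst open_contains_cball, intro ballI)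
    fix z assume z: "z \<in> Z"
    have "open (\<Omega> \<inter> (\<lambda>y. \<bar>u y - u x\<bar>) -` {..<\<delta>})"
      using open_Omega uc by (intro continuous_open_preimage continuous_intros) auto
    moreover have "z \<in> \<Omega> \<inter> (\<lambda>y. \<bar>u y - u x\<bar>) -` {..<\<delta>}" using z C by (auto simp: Z_def)
    ultimately obtain r0 where r0: "r0 > 0" "cball z r0 \<subseteq> \<Omega> \<inter> (\<lambda>y. \<bar>u y - u x\<bar>) -` {..<\<delta>}"
      using open_contains_cball by blast
    \<comment> \<open>On a ball of this radius the largest deviation of \<open>u\<close> from
      \<open>u x\<close> is at most half of itself, hence zero.\<close>
    define r where "r = min r0 (1 / (2 * C'))"
    have r: "r > 0" "C' * r \<le> 1 / 2"
    proof -
      show "r > 0" using r0 C' by (simp add: r_def)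
      have "C' * r \<le> C' * (1 / (2 * C'))" using C' by (intro mult_left_mono) (auto simp: r_def)
      then show "C' * r \<le> 1 / 2" using C' by simp
    qed
    have sub: "cball z r \<subseteq> \<Omega>" "\<And>y. y \<in> cball z r \<Longrightarrow> \<bar>u y - u x\<bar> < \<delta>"
      using r0 by (auto simp: r_def)
    have "compact (cball z r)" "cball z r \<noteq> {}" "continuous_on (cball z r) (\<lambda>y. \<bar>u y - u x\<bar>)"
      using r continuous_on_subset[OF uc sub(1)] by (auto intro!: continuous_intros)
    then obtain y where y: "y \<in> cball z r" "\<And>y'. y' \<in> cball z r \<Longrightarrow> \<bar>u y' - u x\<bar> \<le> \<bar>u y - u x\<bar>"
      using continuous_attains_sup[of "cball z r" "\<lambda>y. \<bar>u y - u x\<bar>"] by blast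
    have "norm (u y - u z) \<le> C' * \<bar>u y - u x\<bar> * norm (y - z)"
    proof (rule differentiable_bound[of "cball z r" u "\<lambda>y h. g y \<bullet> h"])
      fix v assume v: "v \<in> cball z r"
      show "(u has_derivative (\<lambda>h. g v \<bullet> h)) (at v within cball z r)"
        using has_derivative_u sub(1) v by (blast intro: has_derivative_at_withinI)
      have "onorm (\<lambda>h. g v \<bullet> h) \<le> norm (g v)"
        by (rule onorm_le) (simp add: Cauchy_Schwarz_ineq2)
      also have "\<dots> \<le> C' * \<bar>u v - u x\<bar>" using sub v by (intro gb) auto
      also have "\<dots> \<le> C' * \<bar>u y - u x\<bar>" using y(2)[OF v] C' by (intro mult_left_mono) auto
      finally show "onorm (\<lambda>h. g v \<bullet> h) \<le> C' * \<bar>u y - u x\<bar>" .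
    qed (use y r in auto)
    also have "\<dots> \<le> C' * \<bar>u y - u x\<bar> * r"
      using y(1) C' by (intro mult_left_mono) (auto simp: dist_norm norm_minus_commute)
    also have "\<dots> \<le> 1 / 2 * \<bar>u y - u x\<bar>"
      using mult_right_mono[OF r(2), of "\<bar>u y - u x\<bar>"] by (simp add: mult_ac)
    finally have "\<bar>u y - u x\<bar> \<le> 1 / 2 * \<bar>u y - u x\<bar>" using z by (simp add: Z_def)
    then have "\<bar>u y - u x\<bar> = 0" by simp
    then have "u y' = u x" if "y' \<in> cball z r" for y' using y(2)[OF that] by simp
    then show "\<exists>e>0. cball z e \<subseteq> Z" using r sub by (auto simp: Z_def intro!: exI[of _ r])
  qed
  then have "openin (top_of_set \<Omega>) Z" by (auto simp: Z_def intro: open_openin_trans open_Omega)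
  moreover have "closedin (top_of_set \<Omega>) Z"
    unfolding Z_def by (rule continuous_closedin_preimage_constant[OF uc])
  ultimately have Z: "Z = \<Omega>"
    using conn x unfolding connected_clopen by (auto simp: Z_def)
  have g0: "g y = 0" if "y \<in> \<Omega>" for y
    using gb[OF that] that C by (simp add: Z_def[symmetric] flip: Z) (auto simp: Z_def)
  have "U q = 0"
  proof (rule continuous_constant_on_closure[OF U_cont])
    show "q \<in> closure \<Omega>" using q by (auto simp: frontier_def)
  qed (use g0 U_eq in auto)
  then show False using U_norm[OF q] kappa by simp
qed

text \<open>The classical barrier exp(-\<alpha> |x - y|^2) on the annulus between d / 2 and 3 d / 2:
  its rank-one part is of order \<alpha>^2, whereas trace and drift are of order \<alpha>. The
  condition on \<open>\<alpha>\<close> compares them after division by the common factor.\<close>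

lemma L_gauss:
  assumes x: "x \<in> \<Omega>" "W x > 0" and N: "\<bar>p * f (u x) / w x\<bar> * norm (g x) \<le> N"
    and d: "d > 0" "norm (x - y) \<ge> d / 2" "norm (x - y) \<le> 3 * d / 2"
    and \<alpha>: "\<alpha> > 0" "\<alpha> * min 1 (p - 1) * d\<^sup>2 > 2 * (CARD('n) + p) + 3 * N * d"
  defines "E \<equiv> exp (- \<alpha> * ((x - y) \<bullet> (x - y)))"
  shows "L x ((- \<alpha> * E) *\<^sub>R (2 *\<^sub>R (x - y))) (\<lambda>h. (\<alpha>\<^sup>2 * E * (2 *\<^sub>R (x - y) \<bullet> h)) *\<^sub>R (2 *\<^sub>R (x - y)) + (- \<alpha> * E) *\<^sub>R (2 *\<^sub>R h)) > 0"
proof -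
  define z where "z = x - y"
  define m where "m = min 1 (p - 1)"
  have m: "m > 0" using p1 by (simp add: m_def)
  have g0: "g x \<noteq> 0" using x W_pos by simp
  have E: "E > 0" by (simp add: E_def)
  have "(\<lambda>h. (\<alpha>\<^sup>2 * E * (2 *\<^sub>R z \<bullet> h)) *\<^sub>R (2 *\<^sub>R z) + (- \<alpha> * E) *\<^sub>R (2 *\<^sub>R h))
     = (\<lambda>h. (\<alpha>\<^sup>2 * E) *\<^sub>R ((2 *\<^sub>R z \<bullet> h) *\<^sub>R (2 *\<^sub>R z)) + (- 2 * \<alpha> * E) *\<^sub>R h)" by (auto simp: mult_ac)
  then have "L x ((- \<alpha> * E) *\<^sub>R (2 *\<^sub>R z)) (\<lambda>h. (\<alpha>\<^sup>2 * E * (2 *\<^sub>R z \<bullet> h)) *\<^sub>R (2 *\<^sub>R z) + (- \<alpha> * E) *\<^sub>R (2 *\<^sub>R h))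
     = \<alpha>\<^sup>2 * E * aform p (g x) (2 *\<^sub>R z) + (- 2 * \<alpha> * E) * (CARD('n) + (p - 2)) + p * f (u x) / w x * (g x \<bullet> ((- \<alpha> * E) *\<^sub>R (2 *\<^sub>R z)))"
    by (simp only: L_def ell_add ell_scaleR ell_rank1 ell_id[OF g0])
  also have "\<dots> = \<alpha> * E * (\<alpha> * aform p (g x) (2 *\<^sub>R z) - 2 * (CARD('n) + (p - 2)) - 2 * (p * f (u x) / w x * (g x \<bullet> z)))"
    by (simp add: power2_eq_square algebra_simps)
  finally have eq: "L x ((- \<alpha> * E) *\<^sub>R (2 *\<^sub>R z)) (\<lambda>h. (\<alpha>\<^sup>2 * E * (2 *\<^sub>R z \<bullet> h)) *\<^sub>R (2 *\<^sub>R z) + (- \<alpha> * E) *\<^sub>R (2 *\<^sub>R h))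
    = \<alpha> * E * (\<alpha> * aform p (g x) (2 *\<^sub>R z) - 2 * (CARD('n) + (p - 2)) - 2 * (p * f (u x) / w x * (g x \<bullet> z)))" .
  have "d\<^sup>2 \<le> (2 * norm z)\<^sup>2" using d by (intro power_mono) (auto simp: z_def)
  also have "\<dots> = 2 *\<^sub>R z \<bullet> 2 *\<^sub>R z" by (simp add: power_mult_distrib power2_norm_eq_inner)
  finally have "m * d\<^sup>2 \<le> m * (2 *\<^sub>R z \<bullet> 2 *\<^sub>R z)" using m by (intro mult_left_mono) auto
  also have "\<dots> \<le> aform p (g x) (2 *\<^sub>R z)" unfolding m_def by (rule aform_bounds(1)[OF g0])
  finally have a: "\<alpha> * m * d\<^sup>2 \<le> \<alpha> * aform p (g x) (2 *\<^sub>R z)" using \<alpha> by simp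
  have "\<bar>p * f (u x) / w x * (g x \<bullet> z)\<bar> \<le> \<bar>p * f (u x) / w x\<bar> * (norm (g x) * norm z)"
    unfolding abs_mult[of "p * f (u x) / w x"] by (intro mult_left_mono Cauchy_Schwarz_ineq2) auto
  also have "\<dots> = \<bar>p * f (u x) / w x\<bar> * norm (g x) * norm z" by simp
  also have "\<dots> \<le> N * (3 * d / 2)"
    using N d order_trans[OF _ N, of 0] by (intro mult_mono) (auto simp: z_def)
  finally have b: "\<bar>p * f (u x) / w x * (g x \<bullet> z)\<bar> \<le> 3 * N * d / 2" by simp
  have "\<alpha> * aform p (g x) (2 *\<^sub>R z) - 2 * (CARD('n) + (p - 2)) - 2 * (p * f (u x) / w x * (g x \<bullet> z)) > 0"
  proof -
    have lin: "0 < k - 2 * (n + (p - 2)) - 2 * X" if "md \<le> k" "\<bar>X\<bar> \<le> nd / 2" "2 * (n + p) + nd < md" for k n X md nd :: real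
    proof -
      have "2 * X \<le> nd" using that(2) by auto
      then show ?thesis using that(1,3) unfolding distrib_left right_diff_distrib by simp
    qed
    show ?thesis by (rule lin[OF a b \<alpha>(2)[folded m_def]])
  qed
  then show ?thesis using eq \<alpha> E unfolding z_def by simp
qed

end

section \<open>Strong maximum principle and boundary point lemma\<close>

context overdet begin

lemma g_cont: "continuous_on \<Omega> g"
  by (rule continuous_on_eq[OF continuous_on_subset[OF U_cont closure_subset]]) (rule U_eq)

lemma u_cont_Omega: "continuous_on \<Omega> u"
  by (rule continuous_on_subset[OF u_cont closure_subset])

text \<open>Hopf's argument. A ball outside the contact set is shrunk until it touches the set at
  the single point \<open>z\<close>; near \<open>z\<close> a small multiple of the Gaussian barrier
  is added to \<open>P\<close>, and the sum would have an interior maximum although \<open>L\<close>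
  of it is positive.\<close>

lemma strong_maximum_principle:
  assumes reg: "\<And>x. x \<in> \<Omega> \<Longrightarrow> P x = c \<Longrightarrow> W x > 0" and conn: "connected \<Omega>"
    and x0: "x0 \<in> \<Omega>" "P x0 = c" and x: "x \<in> \<Omega>"
  shows "P x = c"
proof -
  define S where "S = {x\<in>\<Omega>. P x = c}"
  have "open S"
  proof (subst open_contains_ball, intro ballI, rule ccontr)
    fix z0 assume z0: "z0 \<in> S" and no: "\<not> (\<exists>e>0. ball z0 e \<subseteq> S)"
    have "z0 \<in> {x\<in>\<Omega>. W x > 0}" using z0 reg by (auto simp: S_def)
    then obtain r0 where r0: "r0 > 0" "cball z0 r0 \<subseteq> {x\<in>\<Omega>. W x > 0}"
      using open_regular open_contains_cball by blast
    \<comment> \<open>A third, because \<open>y\<close> is within \<open>r\<close> of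
      \<open>z0\<close>, \<open>z\<close> within \<open>2 * r\<close>, and a small ball around
      \<open>z\<close> must still fit where \<open>W\<close> is positive.\<close>
    define r where "r = r0 / 3"
    have r: "r > 0" using r0 by (simp add: r_def)
    obtain y where y: "dist z0 y < r" "y \<notin> S" using no r by (auto simp: subset_iff)
    define S' where "S' = {x\<in>cball z0 r0. P x = c}"
    have Pc: "continuous_on (cball z0 r0) P" using r0 by (intro continuous_on_subset[OF P_cont]) auto
    have "closed S'" unfolding S'_def
      using continuous_closed_preimage_constant[OF Pc closed_cball] by simp
    moreover have "z0 \<in> S'" using z0 r0 by (auto simp: S'_def S_def)
    then have "S' \<noteq> {}" by blast
    ultimately obtain z where z: "z \<in> S'" "\<And>x. x \<in> S' \<Longrightarrow> dist y z \<le> dist y x"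
      using distance_attains_inf[of S' y] by blast
    have zS: "z \<in> S" using z(1) r0 by (auto simp: S'_def S_def)
    define d where "d = dist y z"
    have d: "d > 0" "d < r"
    proof -
      show "d > 0" using zS y by (auto simp: d_def)
      have "z0 \<in> S'" using z0 r0 by (auto simp: S'_def S_def)
      from z(2)[OF this] show "d < r" using y by (simp add: d_def dist_commute)
    qed
    have zz0: "dist z z0 < 2 * r"
      using dist_triangle[of z z0 y] y d by (simp add: d_def dist_commute)
    define y' where "y' = (1/2) *\<^sub>R (y + z)"
    define d' where "d' = d / 2"
    have d': "d' > 0" using d by (simp add: d'_def)
    have nzy: "norm (z - y') = d'"
    proof -
      have "z - y' = (1/2) *\<^sub>R (z - y)" by (simp add: y'_def algebra_simps flip: scaleR_add_left)
      then show ?thesis by (simp add: d'_def d_def dist_norm norm_minus_commute)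
    qed
    have uniq: "x = z" if x: "x \<in> S" "norm (x - y') \<le> d'" for x
    proof -
      \<comment> \<open>Parallelogram law. A point of the ball with diameter from \<open>y\<close>
        to \<open>z\<close> satisfies |x - y|^2 + |x - z|^2 \<le> d^2, while a contact point has |x
        - y| \<ge> d; so the halved ball touches at \<open>z\<close> alone.\<close>
      have par: "(x - y) \<bullet> (x - y) + (x - z) \<bullet> (x - z) = 2 * ((x - y') \<bullet> (x - y')) + (y - z) \<bullet> (y - z) / 2"
        by (simp add: y'_def inner_diff_left inner_diff_right inner_add_left inner_add_right inner_commute field_simps)
      have "(norm (x - y'))\<^sup>2 \<le> d'\<^sup>2" using x by (intro power_mono) auto
      then have 1: "(norm (x - y))\<^sup>2 + (norm (x - z))\<^sup>2 \<le> d\<^sup>2"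
        using par by (simp add: power2_norm_eq_inner d'_def d_def dist_norm power_divide)
      then have "(norm (x - y))\<^sup>2 \<le> d\<^sup>2" by (smt (verit) zero_le_power2)
      then have xy: "dist x y \<le> d" unfolding dist_norm by (rule power2_le_imp_le) (use d in simp)
      have "dist x z0 \<le> r0" using dist_triangle[of x z0 y] xy y d by (simp add: r_def dist_commute)
      then have "x \<in> S'" using x by (auto simp: S'_def S_def dist_commute)
      from z(2)[OF this] have "d \<le> norm (x - y)" by (simp add: d_def dist_norm norm_minus_commute)
      then have "d\<^sup>2 \<le> (norm (x - y))\<^sup>2" using d by (intro power_mono) auto
      then have "(norm (x - z))\<^sup>2 \<le> 0" using 1 by linarith
      then show ?thesis by simp
    qed
    define s where "s = d' / 2"
    have s: "s > 0" using d' by (simp add: s_def)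
    have sub: "cball z s \<subseteq> {x\<in>\<Omega>. W x > 0}"
    proof -
      have "cball z s \<subseteq> cball z0 r0"
      proof
        fix x assume "x \<in> cball z s"
        then have "dist x z \<le> s" by (simp add: dist_commute)
        then show "x \<in> cball z0 r0"
          using dist_triangle[of x z0 z] zz0 d by (simp add: s_def d'_def r_def dist_commute)
      qed
      then show ?thesis using r0 by auto
    qed
    have rng: "d' / 2 \<le> norm (x - y')" "norm (x - y') \<le> 3 * d' / 2" if "x \<in> cball z s" for x
    proof -
      have 1: "norm (x - z) \<le> s" using that by (simp add: dist_norm norm_minus_commute)
      have "norm (z - y') \<le> norm (x - y') + norm (x - z)"
        using norm_triangle_ineq4[of "x - y'" "x - z"] by simp
      then show "d' / 2 \<le> norm (x - y')" using 1 nzy by (simp add: s_def)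
      have "norm (x - y') \<le> norm (x - z) + norm (z - y')"
        using norm_triangle_ineq[of "x - z" "z - y'"] by simp
      then show "norm (x - y') \<le> 3 * d' / 2" using 1 nzy by (simp add: s_def)
    qed
    have cO: "continuous_on (cball z s) u" "continuous_on (cball z s) g" "continuous_on (cball z s) P"
      using sub by (auto intro: continuous_on_subset[OF u_cont_Omega] continuous_on_subset[OF g_cont] continuous_on_subset[OF P_cont])
    have "continuous_on (cball z s) (\<lambda>x. \<bar>p * f (u x) / w x\<bar> * norm (g x))"
      unfolding w_def W_def using sub
      by (intro continuous_intros cO continuous_on_compose2[OF f_cont cO(1)]) (auto simp: W_def)
    then have "compact ((\<lambda>x. \<bar>p * f (u x) / w x\<bar> * norm (g x)) ` cball z s)"
      by (rule compact_continuous_image) simp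
    then have "bounded ((\<lambda>x. \<bar>p * f (u x) / w x\<bar> * norm (g x)) ` cball z s)" by (rule compact_imp_bounded)
    then obtain N where N0: "N > 0" "\<forall>v\<in>(\<lambda>x. \<bar>p * f (u x) / w x\<bar> * norm (g x)) ` cball z s. norm v \<le> N"
      unfolding bounded_pos by blast
    have N: "\<bar>p * f (u x) / w x\<bar> * norm (g x) \<le> N" if "x \<in> cball z s" for x
      using bspec[OF N0(2) imageI[OF that]] by simp
    define m where "m = min 1 (p - 1)"
    have m: "m > 0" using p1 by (simp add: m_def)
    define \<alpha> where "\<alpha> = (2 * (CARD('n) + p) + 3 * N * d') / (m * d'\<^sup>2) + 1"
    have \<alpha>: "\<alpha> > 0" "\<alpha> * min 1 (p - 1) * d'\<^sup>2 > 2 * (CARD('n) + p) + 3 * N * d'"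
    proof -
      show "\<alpha> > 0" unfolding \<alpha>_def using p1 N0(1) d' m by (intro add_nonneg_pos) auto
      have "\<alpha> * m * d'\<^sup>2 = 2 * (CARD('n) + p) + 3 * N * d' + m * d'\<^sup>2"
        using m d' by (simp add: \<alpha>_def field_simps)
      then show "\<alpha> * min 1 (p - 1) * d'\<^sup>2 > 2 * (CARD('n) + p) + 3 * N * d'"
        using m d' by (simp add: m_def[symmetric])
    qed
    define b where "b x = exp (- \<alpha> * ((x - y') \<bullet> (x - y')))" for x
    have b1: "b x \<le> 1" for x using \<alpha> by (simp add: b_def)
    have bz: "b z = exp (- \<alpha> * d'\<^sup>2)" using nzy by (simp add: b_def flip: power2_norm_eq_inner)
    \<comment> \<open>This cap of the small sphere is compact and misses the contact set, so
      \<open>P\<close> is below \<open>c\<close> by a fixed amount on it. On the rest of the sphere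
      the barrier is smaller than at \<open>z\<close>.\<close>
    have "\<exists>\<sigma>>0. \<forall>x\<in>sphere z s \<inter> cball y' d'. P x \<le> c - \<sigma>"
    proof (cases "sphere z s \<inter> cball y' d' = {}")
      case True
      then show ?thesis by (intro exI[of _ 1]) auto
    next
      case False
      have "compact (sphere z s \<inter> cball y' d')" by (simp add: compact_Int_closed)
      moreover have "continuous_on (sphere z s \<inter> cball y' d') P"
        by (rule continuous_on_subset[OF cO(3)]) auto
      ultimately obtain x where x: "x \<in> sphere z s \<inter> cball y' d'" "\<And>x'. x' \<in> sphere z s \<inter> cball y' d' \<Longrightarrow> P x' \<le> P x"
        using continuous_attains_sup[of "sphere z s \<inter> cball y' d'" P] False by blast
      have "x \<in> \<Omega>" using x(1) sub by auto
      moreover have "x \<noteq> z" using x(1) s by auto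
      then have "x \<notin> S" using uniq[of x] x(1) by (auto simp: dist_norm norm_minus_commute)
      ultimately have "P x < c" using P_le_c[of x] by (force simp: S_def)
      then show ?thesis using x(2) by (intro exI[of _ "c - P x"]) auto
    qed
    then obtain \<sigma>0 where \<sigma>0: "\<sigma>0 > 0" "\<And>x. x \<in> sphere z s \<Longrightarrow> x \<in> cball y' d' \<Longrightarrow> P x \<le> c - \<sigma>0" by blast
    define \<epsilon> where "\<epsilon> = \<sigma>0 / 2"
    have \<epsilon>: "\<epsilon> > 0" "\<epsilon> < \<sigma>0" using \<sigma>0 by (auto simp: \<epsilon>_def)
    define \<phi> where "\<phi> x = P x + \<epsilon> * b x" for x
    have "continuous_on (cball z s) \<phi>" unfolding \<phi>_def b_def
      by (intro continuous_intros cO)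
    then obtain x1 where x1: "x1 \<in> cball z s" "\<And>x. x \<in> cball z s \<Longrightarrow> \<phi> x \<le> \<phi> x1"
      using continuous_attains_sup[of "cball z s" \<phi>] s by auto
    have phiz: "\<phi> z = c + \<epsilon> * b z" using zS by (simp add: \<phi>_def S_def)
    have "x1 \<notin> sphere z s"
    proof
      assume sp: "x1 \<in> sphere z s"
      have "\<phi> x1 < \<phi> z"
      proof (cases "x1 \<in> cball y' d'")
        case True
        have "\<epsilon> * b x1 \<le> \<epsilon> * 1" using b1 \<epsilon> by (intro mult_left_mono) auto
        then have "\<phi> x1 < c" using \<sigma>0(2)[OF sp True] \<epsilon> unfolding \<phi>_def by linarith
        moreover have "\<epsilon> * b z > 0" using \<epsilon> by (simp add: b_def)
        ultimately show ?thesis using phiz by simp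
      next
        case False
        then have "d' < norm (x1 - y')" by (simp add: dist_norm norm_minus_commute)
        then have "d'\<^sup>2 < (norm (x1 - y'))\<^sup>2" using d' by (intro power_strict_mono) auto
        then have "b x1 < b z" unfolding bz using \<alpha> by (simp add: b_def power2_norm_eq_inner)
        then have "\<epsilon> * b x1 < \<epsilon> * b z" using \<epsilon> by simp
        moreover have "P x1 \<le> c" using x1(1) sub by (intro P_le_c) auto
        ultimately show ?thesis using phiz by (simp add: \<phi>_def)
      qed
      then show False using x1(2)[of z] s by simp
    qed
    then have x1b: "x1 \<in> ball z s" using x1(1) by auto
    have x1O: "x1 \<in> \<Omega>" "W x1 > 0" using x1(1) sub by auto
    have "\<forall>\<^sub>F x in nhds x1. x \<in> ball z s" using x1b by (intro eventually_nhds_in_open) auto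
    then have ev: "\<forall>\<^sub>F x in nhds x1. \<phi> x \<le> \<phi> x1" by eventually_elim (use x1(2) in auto)
    have twb: "twice_at b x1 ((- \<alpha> * b x1) *\<^sub>R (2 *\<^sub>R (x1 - y')))
       (\<lambda>h. (\<alpha>\<^sup>2 * b x1 * (2 *\<^sub>R (x1 - y') \<bullet> h)) *\<^sub>R (2 *\<^sub>R (x1 - y')) + (- \<alpha> * b x1) *\<^sub>R (2 *\<^sub>R h))"
      unfolding b_def
      by (rule twice_at_compose[OF twice_at_sqdist, where T=UNIV and k="\<lambda>s. exp (- \<alpha> * s)" and k'="\<lambda>s. - \<alpha> * exp (- \<alpha> * s)"])
         (auto intro!: derivative_eq_intros simp: power2_eq_square)
    have "L x1 (GP x1 + \<epsilon> *\<^sub>R ((- \<alpha> * b x1) *\<^sub>R (2 *\<^sub>R (x1 - y'))))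
       (\<lambda>h. HP x1 h + \<epsilon> *\<^sub>R ((\<alpha>\<^sup>2 * b x1 * (2 *\<^sub>R (x1 - y') \<bullet> h)) *\<^sub>R (2 *\<^sub>R (x1 - y')) + (- \<alpha> * b x1) *\<^sub>R (2 *\<^sub>R h))) \<le> 0"
      by (rule L_local_max(1)[OF _ ev x1O(2)], unfold \<phi>_def)
         (rule twice_at_add[OF twice_P[OF x1O] twice_at_cmult[OF twb]])
    moreover have "L x1 ((- \<alpha> * b x1) *\<^sub>R (2 *\<^sub>R (x1 - y')))
       (\<lambda>h. (\<alpha>\<^sup>2 * b x1 * (2 *\<^sub>R (x1 - y') \<bullet> h)) *\<^sub>R (2 *\<^sub>R (x1 - y')) + (- \<alpha> * b x1) *\<^sub>R (2 *\<^sub>R h)) > 0"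
      unfolding b_def by (rule L_gauss[OF x1O N[OF x1(1)] d' rng[OF x1(1)] \<alpha>])
    then have "\<epsilon> * L x1 ((- \<alpha> * b x1) *\<^sub>R (2 *\<^sub>R (x1 - y')))
       (\<lambda>h. (\<alpha>\<^sup>2 * b x1 * (2 *\<^sub>R (x1 - y') \<bullet> h)) *\<^sub>R (2 *\<^sub>R (x1 - y')) + (- \<alpha> * b x1) *\<^sub>R (2 *\<^sub>R h)) > 0"
      using \<epsilon> by (intro mult_pos_pos)
    ultimately show False using L_P_nonneg[OF x1O] unfolding L_add L_scaleR by linarith
  qed
  then have "openin (top_of_set \<Omega>) S" by (auto simp: S_def intro: open_openin_trans open_Omega)
  moreover have "closedin (top_of_set \<Omega>) S"
    unfolding S_def by (rule continuous_closedin_preimage_constant[OF P_cont])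
  ultimately have "S = \<Omega>"
    using conn x0 unfolding connected_clopen by (auto simp: S_def)
  then show ?thesis using x by (auto simp: S_def)
qed

text \<open>Hopf barrier: \<open>u\<close> itself replaces the usual interior ball.\<close>
lemma hopf_barrier:
  assumes q: "q \<in> frontier \<Omega>" and less: "\<And>x. x \<in> \<Omega> \<Longrightarrow> P x < c"
  shows "\<exists>\<rho> \<epsilon> K \<beta>. \<rho> > 0 \<and> \<epsilon> > 0 \<and> K > 0 \<and> \<beta> > 0 \<and>
     (\<forall>x\<in>\<Omega> \<inter> ball q \<rho>. P x + \<epsilon> * (exp (K * u x) - 1 - \<beta> * ((x - q) \<bullet> (x - q))) \<le> c)"
proof -
  have qc: "q \<in> closure \<Omega>" using q by (simp add: frontier_def)
  have "continuous (at q within closure \<Omega>) U" using U_cont qc by (simp add: continuous_on_eq_continuous_within)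
  then have "continuous (at q within closure \<Omega>) (\<lambda>x. norm (U x))" by (intro continuous_intros)
  moreover have "\<kappa> / 2 > 0" using kappa by simp
  ultimately obtain \<rho>0 where \<rho>0: "\<rho>0 > 0" "\<And>x. x \<in> closure \<Omega> \<Longrightarrow> dist x q < \<rho>0 \<Longrightarrow> \<bar>norm (U x) - \<kappa>\<bar> < \<kappa> / 2"
    using U_norm[OF q] unfolding continuous_within_eps_delta dist_real_def by metis
  define \<rho> where "\<rho> = min 1 (\<rho>0 / 2)"
  have \<rho>: "\<rho> > 0" "\<rho> \<le> 1" "\<rho> < \<rho>0" using \<rho>0 by (auto simp: \<rho>_def min_def)
  have gb: "\<kappa> / 2 \<le> norm (g x)" "norm (g x) \<le> 2 * \<kappa>" if "x \<in> \<Omega>" "dist q x \<le> \<rho>" for x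
  proof -
    have "x \<in> closure \<Omega>" using that closure_subset by blast
    moreover have "dist x q < \<rho>0" using that \<rho> by (simp add: dist_commute)
    ultimately have "\<bar>norm (U x) - \<kappa>\<bar> < \<kappa> / 2" by (rule \<rho>0(2))
    then show "\<kappa> / 2 \<le> norm (g x)" "norm (g x) \<le> 2 * \<kappa>" using kappa unfolding U_eq[OF that(1)] abs_less_iff by linarith+
  qed
  obtain M where M: "M \<ge> 0" "\<And>x. x \<in> \<Omega> \<Longrightarrow> \<bar>f (u x)\<bar> \<le> M"
    using f_u_bound by blast
  obtain B where B: "B > 0" "\<And>x. x \<in> \<Omega> \<Longrightarrow> u x \<le> B"
    using u_bdd unfolding bounded_pos by (metis abs_le_D1 imageI real_norm_def)
  define w0 where "w0 = (\<kappa> / 2) powr p"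
  have w0: "w0 > 0" using kappa by (simp add: w0_def)
  have ww: "w0 \<le> w x" if "x \<in> \<Omega>" "dist q x \<le> \<rho>" for x
    unfolding w0_def w_eq_norm using gb[OF that] kappa p1 by (intro powr_mono2) auto
  \<comment> \<open>Makes \<open>K + f (u x) / w x\<close> at least 1 near \<open>q\<close>, so that
    \<open>L\<close> of exp(K u) is at least \<open>\<mu>\<close>.\<close>
  define K where "K = 1 + M / w0"
  have K: "K \<ge> 1" using M w0 by (simp add: K_def)
  define \<mu> where "\<mu> = (p - 1) * (\<kappa> / 2)\<^sup>2"
  have \<mu>: "\<mu> > 0" using p1 kappa by (simp add: \<mu>_def)
  define \<Lambda> where "\<Lambda> = 2 * (CARD('n) + p) + 4 * p * (M / w0) * \<kappa>"
  have \<Lambda>: "\<Lambda> > 0" unfolding \<Lambda>_def using p1 M w0 kappa by (intro add_pos_nonneg) auto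
  \<comment> \<open>\<open>\<Lambda>\<close> bounds \<open>L\<close> of the squared distance to
    \<open>q\<close>; with this \<open>\<beta>\<close> the quadratic term spends half of the gain
    \<open>\<mu>\<close>.\<close>
  define \<beta> where "\<beta> = \<mu> / (2 * \<Lambda>)"
  have \<beta>: "\<beta> > 0" "\<beta> * \<Lambda> < \<mu>" using \<mu> \<Lambda> by (auto simp: \<beta>_def)
  define \<tau> where "\<tau> = ln (1 + \<beta> * \<rho>\<^sup>2) / K"
  have "ln (1 + \<beta> * \<rho>\<^sup>2) > 0" using \<beta> \<rho> by (intro ln_gt_zero) simp
  then have \<tau>: "\<tau> > 0" using K by (simp add: \<tau>_def)
  define D where "D = closure \<Omega> \<inter> cball q \<rho>"
  have cD: "compact D" unfolding D_def by (intro closed_Int_compact) auto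
  have contD: "continuous_on D u" "continuous_on D Pb"
    by (auto simp: D_def intro: continuous_on_subset[OF u_cont] continuous_on_subset[OF Pb_cont])
  have inO: "x \<in> \<Omega> \<or> x \<in> frontier \<Omega>" if "x \<in> D" for x
    using that open_Omega by (auto simp: D_def frontier_def interior_open)
  \<comment> \<open>On the sphere around \<open>q\<close> the barrier can be positive only where
    \<open>u\<close> reaches \<open>\<tau>\<close>. That part is compact and lies inside
    \<open>\<Omega>\<close>, so \<open>P < c\<close> becomes uniform on it. At frontier points,
    where \<open>u\<close> vanishes, the barrier is never positive.\<close>
  define E where "E = {x\<in>D. dist q x = \<rho> \<and> \<tau> \<le> u x}"
  have "compact E"
  proof -
    have "E = (D \<inter> u -` {\<tau>..}) \<inter> sphere q \<rho>" by (auto simp: E_def)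
    moreover have "closed (D \<inter> u -` {\<tau>..})"
      using contD(1) compact_imp_closed[OF cD] by (intro continuous_closed_preimage) auto
    ultimately show ?thesis by (simp add: closed_Int_compact)
  qed
  have EO: "x \<in> \<Omega>" if "x \<in> E" for x
    using inO[of x] that u_zero[of x] \<tau> by (auto simp: E_def)
  have "\<exists>\<sigma>>0. \<forall>x\<in>E. P x \<le> c - \<sigma>"
  proof (cases "E = {}")
    case True
    then show ?thesis by (intro exI[of _ 1]) auto
  next
    case False
    have "continuous_on E P" using EO by (intro continuous_on_subset[OF P_cont]) auto
    then obtain x where "x \<in> E" "\<And>x'. x' \<in> E \<Longrightarrow> P x' \<le> P x"
      using continuous_attains_sup[OF \<open>compact E\<close> False] by blast
    then show ?thesis using less[OF EO] by (intro exI[of _ "c - P x"]) auto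
  qed
  then obtain \<sigma>0 where \<sigma>0: "\<sigma>0 > 0" "\<And>x. x \<in> E \<Longrightarrow> P x \<le> c - \<sigma>0" by blast
  \<comment> \<open>The barrier is at most exp(K B), so its multiple by \<open>\<epsilon>\<close>
    cannot exceed the deficit \<open>\<sigma>0\<close> on \<open>E\<close>.\<close>
  define \<epsilon> where "\<epsilon> = \<sigma>0 * exp (- K * B)"
  have \<epsilon>: "\<epsilon> > 0" using \<sigma>0 by (simp add: \<epsilon>_def)
  define b where "b x = exp (K * u x) - 1 - \<beta> * ((x - q) \<bullet> (x - q))" for x
  define \<phi> where "\<phi> x = Pb x + \<epsilon> * b x" for x
  have "continuous_on D \<phi>" unfolding \<phi>_def b_def by (intro continuous_intros contD)
  moreover have "q \<in> D" using qc \<rho> by (simp add: D_def)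
  ultimately obtain x1 where x1: "x1 \<in> D" "\<And>x. x \<in> D \<Longrightarrow> \<phi> x \<le> \<phi> x1"
    using continuous_attains_sup[OF cD] by blast
  have "\<phi> x1 \<le> c"
  proof (rule ccontr)
    assume "\<not> \<phi> x1 \<le> c"
    then have big: "\<phi> x1 > c" by simp
    have x1O: "x1 \<in> \<Omega>"
    proof (rule ccontr)
      assume "x1 \<notin> \<Omega>"
      then have fr: "x1 \<in> frontier \<Omega>" using inO[OF x1(1)] by auto
      have "b x1 \<le> 0" using \<beta> u_zero[OF fr] by (simp add: b_def)
      then have "\<epsilon> * b x1 \<le> 0" using \<epsilon> by (simp add: mult_nonneg_nonpos)
      then show False using big Pb_frontier[OF fr] by (simp add: \<phi>_def)
    qed
    have bpos: "b x1 > 0"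
    proof (rule ccontr)
      assume "\<not> b x1 > 0"
      then have "\<epsilon> * b x1 \<le> 0" using \<epsilon> by (simp add: mult_nonneg_nonpos)
      then show False using big less[OF x1O] by (simp add: \<phi>_def Pb_eq[OF x1O])
    qed
    have dle: "dist q x1 \<le> \<rho>" using x1(1) by (simp add: D_def)
    have "dist q x1 \<noteq> \<rho>"
    proof
      assume eq: "dist q x1 = \<rho>"
      have "(x1 - q) \<bullet> (x1 - q) = \<rho>\<^sup>2" using eq by (simp add: dist_norm norm_minus_commute flip: power2_norm_eq_inner)
      then have "exp (K * u x1) > 1 + \<beta> * \<rho>\<^sup>2" using bpos by (simp add: b_def)
      moreover have "1 + \<beta> * \<rho>\<^sup>2 > 0" using \<beta> by (simp add: add_pos_nonneg)
      ultimately have "ln (1 + \<beta> * \<rho>\<^sup>2) < K * u x1" by (metis ln_less_cancel_iff ln_exp exp_gt_zero)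
      then have "\<tau> \<le> u x1" using K by (simp add: \<tau>_def field_simps)
      then have "x1 \<in> E" using eq x1(1) by (simp add: E_def)
      then have "P x1 \<le> c - \<sigma>0" by (rule \<sigma>0(2))
      moreover have "\<epsilon> * b x1 \<le> \<sigma>0"
      proof -
        have "\<beta> * ((x1 - q) \<bullet> (x1 - q)) \<ge> 0" using \<beta> by simp
        then have "b x1 \<le> exp (K * u x1)" unfolding b_def by linarith
        also have "\<dots> \<le> exp (K * B)" using K B(2)[OF x1O] by simp
        finally have "\<epsilon> * b x1 \<le> \<epsilon> * exp (K * B)" using \<epsilon> by (intro mult_left_mono) auto
        also have "\<dots> = \<sigma>0" by (simp add: \<epsilon>_def exp_minus)
        finally show ?thesis .
      qed
      ultimately show False using big by (simp add: \<phi>_def Pb_eq[OF x1O])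
    qed
    then have dl: "dist q x1 < \<rho>" using dle by simp
    have g1: "\<kappa> / 2 \<le> norm (g x1)" "norm (g x1) \<le> 2 * \<kappa>" using gb[OF x1O dle] by auto
    have W1: "W x1 \<ge> (\<kappa> / 2)\<^sup>2" unfolding W_eq_norm using g1 kappa by (intro power_mono) auto
    then have Wp: "W x1 > 0" using kappa by (smt (verit) half_gt_zero zero_less_power)
    have g0: "g x1 \<noteq> 0" using Wp W_pos by simp
    have fw: "\<bar>f (u x1) / w x1\<bar> \<le> M / w0"
      using M(2)[OF x1O] M(1) w0 ww[OF x1O dle] by (auto simp: abs_divide intro!: frac_le)
    have "\<forall>\<^sub>F x in nhds x1. x \<in> \<Omega> \<inter> ball q \<rho>"
      using x1O dl open_Omega by (intro eventually_nhds_in_open) auto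
    then have ev: "\<forall>\<^sub>F x in nhds x1. P x + \<epsilon> * (exp (K * u x) + - \<beta> * ((x - q) \<bullet> (x - q))) \<le> P x1 + \<epsilon> * (exp (K * u x1) + - \<beta> * ((x1 - q) \<bullet> (x1 - q)))"
    proof eventually_elim
      case (elim x)
      then have "x \<in> D" using closure_subset by (auto simp: D_def)
      from x1(2)[OF this] show ?case
        using elim x1O by (simp add: \<phi>_def b_def Pb_eq algebra_simps)
    qed
    define t where "t = exp (K * u x1)"
    have tw1: "twice_at (\<lambda>x. exp (K * u x)) x1 ((t * K) *\<^sub>R g x1) (\<lambda>h. ((t * K\<^sup>2) * (g x1 \<bullet> h)) *\<^sub>R g x1 + (t * K) *\<^sub>R (A x1 *v h))"
      unfolding t_def
      by (rule twice_at_compose[OF twice_u[OF x1O], where T=UNIV and k="\<lambda>s. exp (K * s)" and k'="\<lambda>s. exp (K * s) * K"])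
         (auto intro!: derivative_eq_intros simp: power2_eq_square)
    note tw = twice_at_add[OF twice_P[OF x1O Wp] twice_at_cmult[OF twice_at_add[OF tw1 twice_at_cmult[OF twice_at_sqdist, of "- \<beta>" q]], of \<epsilon>]]
    from L_local_max(1)[OF tw ev Wp]
    have "L x1 (GP x1) (HP x1) + \<epsilon> * (L x1 ((t * K) *\<^sub>R g x1) (\<lambda>h. ((t * K\<^sup>2) * (g x1 \<bullet> h)) *\<^sub>R g x1 + (t * K) *\<^sub>R (A x1 *v h))
        + - \<beta> * L x1 (2 *\<^sub>R (x1 - q)) (\<lambda>h. 2 *\<^sub>R h)) \<le> 0"
      by (simp only: L_add L_scaleR)
    moreover have "L x1 ((t * K) *\<^sub>R g x1) (\<lambda>h. ((t * K\<^sup>2) * (g x1 \<bullet> h)) *\<^sub>R g x1 + (t * K) *\<^sub>R (A x1 *v h)) \<ge> \<mu>"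
    proof -
      have t1: "t \<ge> 1" using K u_pos[OF x1O] by (simp add: t_def)
      have "f (u x1) / w x1 \<ge> - (M / w0)" using fw by (simp only: abs_le_iff) linarith
      then have "K + f (u x1) / w x1 \<ge> 1" by (simp add: K_def)
      then have "t * K * (K + f (u x1) / w x1) \<ge> 1 * 1 * 1" using t1 K by (intro mult_mono) auto
      then have "t * K\<^sup>2 + t * K * f (u x1) / w x1 \<ge> 1" by (simp add: power2_eq_square algebra_simps)
      then have "(p - 1) * W x1 * (t * K\<^sup>2 + t * K * f (u x1) / w x1) \<ge> (p - 1) * (\<kappa> / 2)\<^sup>2 * 1"
        using W1 Wp p1 by (intro mult_mono) auto
      then show ?thesis unfolding L_compose_u[OF x1O Wp] \<mu>_def by simp
    qed
    moreover have "L x1 (2 *\<^sub>R (x1 - q)) (\<lambda>h. 2 *\<^sub>R h) \<le> \<Lambda>"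
    proof -
      have "L x1 (2 *\<^sub>R (x1 - q)) (\<lambda>h. 2 *\<^sub>R h) = 2 * (CARD('n) + (p - 2)) + p * (f (u x1) / w x1) * (2 * (g x1 \<bullet> (x1 - q)))"
        unfolding L_def ell_scaleR ell_id[OF g0] by simp
      moreover have "p * (f (u x1) / w x1) * (2 * (g x1 \<bullet> (x1 - q))) \<le> p * (M / w0) * (2 * (2 * \<kappa> * 1))"
      proof -
        have "\<bar>g x1 \<bullet> (x1 - q)\<bar> \<le> norm (g x1) * norm (x1 - q)" by (rule Cauchy_Schwarz_ineq2)
        also have "\<dots> \<le> 2 * \<kappa> * 1"
          using g1 dl \<rho> kappa by (intro mult_mono) (auto simp: dist_norm norm_minus_commute)
        finally have "\<bar>f (u x1) / w x1\<bar> * \<bar>g x1 \<bullet> (x1 - q)\<bar> \<le> (M / w0) * (2 * \<kappa> * 1)"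
          using fw M(1) w0 by (intro mult_mono) auto
        then have "f (u x1) / w x1 * (g x1 \<bullet> (x1 - q)) \<le> (M / w0) * (2 * \<kappa> * 1)"
          by (metis abs_le_D1 abs_mult)
        then have "(2 * p) * (f (u x1) / w x1 * (g x1 \<bullet> (x1 - q))) \<le> (2 * p) * ((M / w0) * (2 * \<kappa> * 1))"
          using p1 by (intro mult_left_mono) auto
        then show ?thesis by (simp add: mult_ac)
      qed
      ultimately show ?thesis by (simp add: \<Lambda>_def mult_ac)
    qed
    then have "\<beta> * L x1 (2 *\<^sub>R (x1 - q)) (\<lambda>h. 2 *\<^sub>R h) \<le> \<beta> * \<Lambda>" using \<beta> by (intro mult_left_mono) auto
    then have "\<beta> * L x1 (2 *\<^sub>R (x1 - q)) (\<lambda>h. 2 *\<^sub>R h) < \<mu>" using \<beta> by linarith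
    ultimately have "L x1 ((t * K) *\<^sub>R g x1) (\<lambda>h. ((t * K\<^sup>2) * (g x1 \<bullet> h)) *\<^sub>R g x1 + (t * K) *\<^sub>R (A x1 *v h))
        + - \<beta> * L x1 (2 *\<^sub>R (x1 - q)) (\<lambda>h. 2 *\<^sub>R h) > 0" by simp
    from mult_pos_pos[OF \<epsilon> this] L_P_nonneg[OF x1O Wp]
      \<open>L x1 (GP x1) (HP x1) + \<epsilon> * _ \<le> 0\<close> show False by linarith
  qed
  have "P x + \<epsilon> * (exp (K * u x) - 1 - \<beta> * ((x - q) \<bullet> (x - q))) \<le> c" if "x \<in> \<Omega> \<inter> ball q \<rho>" for x
  proof -
    have "x \<in> D" using that closure_subset by (auto simp: D_def)
    from x1(2)[OF this] \<open>\<phi> x1 \<le> c\<close> show ?thesis using that by (simp add: \<phi>_def b_def Pb_eq)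
  qed
  then show ?thesis using \<rho> \<epsilon> K \<beta> by (intro exI[of _ \<rho>] exI[of _ \<epsilon>] exI[of _ K] exI[of _ \<beta>]) auto
qed

section \<open>Normal derivative of the P-function and tangential trace of the Hessian\<close>

lemma GP_inner_g:
  assumes "x \<in> \<Omega>" "W x > 0"
  shows "GP x \<bullet> g x = - w x * (trace (A x) - \<sigma> x / W x)"
proof -
  \<comment> \<open>The equation eliminates \<open>f\<close>, and what is left is the trace of the
    Hessian across the gradient.\<close>
  have "f (u x) = - (w x / W x * trace (A x) + (p - 2) * (w x / (W x)\<^sup>2) * \<sigma> x)"
    using pointwise_eq[OF assms] by (simp add: W_powr[OF assms(2)])
  moreover have "GP x \<bullet> g x = (p - 1) * (w x / W x) * \<sigma> x + f (u x) * W x"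
    by (simp add: GP_def inner_add_left \<sigma>_def W_def)
  ultimately have "GP x \<bullet> g x = (p - 1) * (w x / W x) * \<sigma> x
      + - (w x / W x * trace (A x) + (p - 2) * (w x / (W x)\<^sup>2) * \<sigma> x) * W x"
    by (simp only:)
  also have "\<dots> = - w x * (trace (A x) - \<sigma> x / W x)"
    using assms(2) by (simp add: field_simps power2_eq_square)
  finally show ?thesis .
qed

text \<open>Along the inward ray in direction \<open>U q\<close> the barrier pushes \<open>P\<close>
  below \<open>c\<close> at a linear rate, so the derivative of \<open>P\<close> along it is
  negative at \<open>q\<close>. By \<open>GP_inner_g\<close>, carried to \<open>q\<close> through
  the continuous extensions, this is a sign for the tangential trace of the Hessian, the quantity
  that encodes the curvature.\<close>

lemma hopf_tangential_trace:
  assumes q: "q \<in> frontier \<Omega>" and less: "\<And>x. x \<in> \<Omega> \<Longrightarrow> P x < c"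
    and ray: "t1 > 0" "\<And>t. 0 < t \<Longrightarrow> t < t1 \<Longrightarrow> q + t *\<^sub>R U q \<in> \<Omega>"
    and Hb: "continuous_on (closure \<Omega>) Hb" "\<And>x. x \<in> \<Omega> \<Longrightarrow> Hb x = A x"
  shows "trace (Hb q) - ((Hb q *v U q) \<bullet> U q) / \<kappa>\<^sup>2 > 0"
proof -
  obtain \<rho> \<epsilon> K \<beta> where h: "\<rho> > 0" "\<epsilon> > 0" "K > 0" "\<beta> > 0"
    "\<And>x. x \<in> \<Omega> \<inter> ball q \<rho> \<Longrightarrow> P x + \<epsilon> * (exp (K * u x) - 1 - \<beta> * ((x - q) \<bullet> (x - q))) \<le> c"
    using hopf_barrier[OF q less] by blast
  define v where "v = U q"
  have vv: "v \<bullet> v = \<kappa>\<^sup>2" using U_norm[OF q] by (simp add: v_def flip: power2_norm_eq_inner)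
  have qc: "q \<in> closure \<Omega>" using q by (simp add: frontier_def)
  define X where "X t = q + t *\<^sub>R v" for t :: real
  have ray': "X t \<in> \<Omega>" if "0 < t" "t < t1" for t using ray(2)[OF that] by (simp add: X_def v_def)
  have X0: "X 0 = q" by (simp add: X_def)
  have Xc: "continuous_on S X" for S unfolding X_def by (intro continuous_intros)
  have Xlim: "(X \<longlongrightarrow> q) (at_right 0)"
    unfolding X_def by (rule tendsto_eq_intros | simp)+
  have evX: "\<forall>\<^sub>F t in at_right 0. X t \<in> \<Omega>"
    using eventually_at_right_real[OF ray(1)] by eventually_elim (use ray' in auto)
  then have evXc: "\<forall>\<^sub>F t in at_right 0. X t \<in> closure \<Omega>"
    by eventually_elim (use closure_subset in auto)
  have lim: "((\<lambda>t. k (X t)) \<longlongrightarrow> k q) (at_right 0)" if "continuous_on (closure \<Omega>) k" for k :: "real^'n \<Rightarrow> 'b::topological_space"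
    by (rule continuous_on_tendsto_compose[OF that Xlim qc evXc])
  define Wb where "Wb x = U x \<bullet> U x" for x
  define wb where "wb x = Wb x powr (p / 2)" for x
  define Gb where "Gb x = ((p - 1) * (wb x / Wb x)) *\<^sub>R (Hb x *v U x) + f (u x) *\<^sub>R U x" for x
  define T where "T x = trace (Hb x) - ((Hb x *v U x) \<bullet> U x) / Wb x" for x
  have Wq: "Wb q = \<kappa>\<^sup>2" "Wb q > 0" using vv kappa by (auto simp: Wb_def v_def)
  have lU: "((\<lambda>t. U (X t)) \<longlongrightarrow> U q) (at_right 0)" by (rule lim[OF U_cont])
  have lW: "((\<lambda>t. Wb (X t)) \<longlongrightarrow> Wb q) (at_right 0)" unfolding Wb_def by (intro tendsto_intros lU)
  have lw: "((\<lambda>t. wb (X t)) \<longlongrightarrow> wb q) (at_right 0)" unfolding wb_def by (intro tendsto_intros lW) (use Wq in auto)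
  have lH: "((\<lambda>t. Hb (X t)) \<longlongrightarrow> Hb q) (at_right 0)" by (rule lim[OF Hb(1)])
  have lHU: "((\<lambda>t. Hb (X t) *v U (X t)) \<longlongrightarrow> Hb q *v U q) (at_right 0)"
    by (rule bounded_bilinear.tendsto[OF bounded_bilinear_matrix_vector_mult lH lU])
  have lf: "((\<lambda>t. f (u (X t))) \<longlongrightarrow> f (u q)) (at_right 0)"
    by (rule lim) (rule continuous_on_compose2[OF f_cont u_cont], simp)
  have lG: "((\<lambda>t. Gb (X t)) \<longlongrightarrow> Gb q) (at_right 0)"
    unfolding Gb_def by (intro tendsto_intros lw lW lHU lf lU) (use Wq in auto)
  have lT: "((\<lambda>t. T (X t)) \<longlongrightarrow> T q) (at_right 0)"
    unfolding T_def trace_def by (intro tendsto_intros lW lHU lU lH) (use Wq in auto)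
  have evW: "\<forall>\<^sub>F t in at_right 0. Wb (X t) > 0"
    using order_tendstoD(1)[OF lW Wq(2)] .
  have eqs: "Wb x = W x" "wb x = w x" "Gb x = GP x" "T x = trace (A x) - \<sigma> x / W x" if "x \<in> \<Omega>" for x
    using that by (simp_all add: Wb_def wb_def Gb_def T_def W_def w_def GP_def Ag_def \<sigma>_def U_eq Hb(2))
  have evk: "\<forall>\<^sub>F t in at_right 0. Gb (X t) \<bullet> U (X t) = - wb (X t) * T (X t)"
    using evX evW by eventually_elim (simp add: eqs U_eq GP_inner_g)
  have "((\<lambda>t. - wb (X t) * T (X t)) \<longlongrightarrow> - wb q * T q) (at_right 0)"
    by (intro tendsto_intros lw lT)
  then have "((\<lambda>t. Gb (X t) \<bullet> U (X t)) \<longlongrightarrow> - wb q * T q) (at_right 0)"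
    by (subst tendsto_cong[OF evk])
  moreover have "((\<lambda>t. Gb (X t) \<bullet> U (X t)) \<longlongrightarrow> Gb q \<bullet> U q) (at_right 0)"
    by (intro tendsto_intros lG lU)
  ultimately have key: "Gb q \<bullet> U q = - wb q * T q"
    using tendsto_unique[OF trivial_limit_at_right_real] by blast
  have "Gb q \<bullet> v < 0"
  proof (rule ccontr)
    assume "\<not> Gb q \<bullet> v < 0"
    \<comment> \<open>On the ray \<open>u\<close> grows at least at rate
      \<open>\<kappa>\<^sup>2 / 2\<close>; the quadratic term of the barrier takes at most half of
      the resulting gain, which leaves the quarter.\<close>
    define \<zeta> where "\<zeta> = \<epsilon> * K * \<kappa>\<^sup>2 / 4"
    have \<zeta>: "\<zeta> > 0" using h kappa by (simp add: \<zeta>_def)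
    have "((\<lambda>t. Gb (X t) \<bullet> v) \<longlongrightarrow> Gb q \<bullet> v) (at_right 0)" by (intro tendsto_intros lG)
    then have e1: "\<forall>\<^sub>F t in at_right 0. Gb (X t) \<bullet> v > - \<zeta>"
      by (rule order_tendstoD(1)) (use \<zeta> \<open>\<not> Gb q \<bullet> v < 0\<close> in linarith)
    have "((\<lambda>t. U (X t) \<bullet> v) \<longlongrightarrow> U q \<bullet> v) (at_right 0)" by (intro tendsto_intros lU)
    then have e2: "\<forall>\<^sub>F t in at_right 0. U (X t) \<bullet> v > \<kappa>\<^sup>2 / 2"
      by (rule order_tendstoD(1)) (use vv kappa in \<open>simp add: v_def\<close>)
    have "((\<lambda>t. t * \<beta> * \<kappa>\<^sup>2) \<longlongrightarrow> 0 * \<beta> * \<kappa>\<^sup>2) (at_right 0)" by (intro tendsto_intros)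
    then have e3: "\<forall>\<^sub>F t in at_right 0. t * \<beta> * \<kappa>\<^sup>2 < K * \<kappa>\<^sup>2 / 4"
      by (rule order_tendstoD(2)) (use h kappa in simp)
    have e4: "\<forall>\<^sub>F t in at_right 0. X t \<in> ball q \<rho>"
      using Xlim by (rule topological_tendstoD) (use h in auto)
    from e1 e2 e3 e4 evX evW have "\<forall>\<^sub>F t in at_right 0. Gb (X t) \<bullet> v > - \<zeta> \<and> U (X t) \<bullet> v > \<kappa>\<^sup>2 / 2 \<and> t * \<beta> * \<kappa>\<^sup>2 < K * \<kappa>\<^sup>2 / 4
        \<and> X t \<in> ball q \<rho> \<and> X t \<in> \<Omega> \<and> Wb (X t) > 0"
      by eventually_elim blast
    then obtain t2 where t2: "t2 > 0" "\<And>t. 0 < t \<Longrightarrow> t < t2 \<Longrightarrow> Gb (X t) \<bullet> v > - \<zeta> \<and> U (X t) \<bullet> v > \<kappa>\<^sup>2 / 2 \<and> t * \<beta> * \<kappa>\<^sup>2 < K * \<kappa>\<^sup>2 / 4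
        \<and> X t \<in> ball q \<rho> \<and> X t \<in> \<Omega> \<and> Wb (X t) > 0"
      unfolding eventually_at_right_field by blast
    define t where "t = t2 / 2"
    have t: "0 < t" "t < t2" using t2 by (auto simp: t_def)
    have img: "X ` {0..t} \<subseteq> closure \<Omega>"
    proof (intro subsetI, elim imageE)
      fix y s assume "y = X s" "s \<in> {0..t}"
      then show "y \<in> closure \<Omega>"
        using t2(2)[of s] t qc X0 closure_subset by (cases "s = 0") auto
    qed
    have cl: "continuous_on {0..t} (\<lambda>s. k (X s))" if "continuous_on (closure \<Omega>) k" for k :: "real^'n \<Rightarrow> real"
      using continuous_on_compose2[OF that Xc img] .
    have drv: "((\<lambda>s. k (X s)) has_derivative (\<lambda>h. h * (G (X s) \<bullet> v))) (at s)"
      if "(k has_derivative (\<lambda>h. G (X s) \<bullet> h)) (at (X s))" for k :: "real^'n \<Rightarrow> real" and G s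
    proof -
      have "(X has_derivative (\<lambda>h. h *\<^sub>R v)) (at s)" unfolding X_def by (auto intro!: derivative_eq_intros)
      from has_derivative_compose[OF this that] show ?thesis by simp
    qed
    obtain s1 where s1: "0 < s1" "s1 < t" "Pb (X t) - Pb (X 0) = (t - 0) * (Gb (X s1) \<bullet> v)"
    proof (rule mvt[OF t(1) cl[OF Pb_cont]])
      fix s assume s: "0 < s" "s < t"
      then have sO: "X s \<in> \<Omega>" "W (X s) > 0" using t2(2)[of s] t eqs(1)[of "X s"] by auto
      have "(Pb has_derivative (\<lambda>h. GP (X s) \<bullet> h)) (at (X s))"
        by (rule has_derivative_transform_within_open[OF twice_at_has_derivative[OF twice_P[OF sO]] open_Omega sO(1)])
           (simp add: Pb_eq)
      then show "((\<lambda>s. Pb (X s)) has_derivative (\<lambda>h. h * (Gb (X s) \<bullet> v))) (at s)"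
        using drv[of Pb GP] eqs(3)[OF sO(1)] by simp
    qed
    obtain s2 where s2: "0 < s2" "s2 < t" "u (X t) - u (X 0) = (t - 0) * (U (X s2) \<bullet> v)"
    proof (rule mvt[OF t(1) cl[OF u_cont]])
      fix s assume s: "0 < s" "s < t"
      then have sO: "X s \<in> \<Omega>" using t2(2)[of s] t by auto
      show "((\<lambda>s. u (X s)) has_derivative (\<lambda>h. h * (U (X s) \<bullet> v))) (at s)"
        using drv[of u g, OF has_derivative_u[OF sO]] U_eq[OF sO] by simp
    qed
    have Xt: "X t \<in> \<Omega>" "X t \<in> ball q \<rho>" using t2(2)[OF t] by auto
    have Pt: "P (X t) - c = t * (Gb (X s1) \<bullet> v)" using s1(3) Pb_eq[OF Xt(1)] Pb_frontier[OF q] X0 by simp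
    have ut: "u (X t) = t * (U (X s2) \<bullet> v)" using s2(3) u_zero[OF q] X0 by simp
    have "K * u (X t) \<le> exp (K * u (X t)) - 1" using exp_ge_add_one_self[of "K * u (X t)"] by linarith
    moreover have "(X t - q) \<bullet> (X t - q) = t * t * \<kappa>\<^sup>2" by (simp add: X_def vv)
    ultimately have "\<epsilon> * (K * u (X t) - \<beta> * (t * t * \<kappa>\<^sup>2)) \<le> \<epsilon> * (exp (K * u (X t)) - 1 - \<beta> * ((X t - q) \<bullet> (X t - q)))"
      using h by (intro mult_left_mono) auto
    also have "\<dots> \<le> c - P (X t)" using h(5)[of "X t"] Xt by simp
    also have "\<dots> = t * (- (Gb (X s1) \<bullet> v))" using Pt by simp
    also have "\<dots> < t * \<zeta>" using t2(2)[of s1] s1 t by (intro mult_strict_left_mono) auto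
    finally have "t * (\<epsilon> * (K * (U (X s2) \<bullet> v) - t * \<beta> * \<kappa>\<^sup>2)) < t * \<zeta>"
      unfolding ut by (simp add: algebra_simps)
    then have "\<epsilon> * (K * (U (X s2) \<bullet> v) - t * \<beta> * \<kappa>\<^sup>2) < \<zeta>" using t by simp
    moreover have "\<epsilon> * (K * \<kappa>\<^sup>2 / 4) \<le> \<epsilon> * (K * (U (X s2) \<bullet> v) - t * \<beta> * \<kappa>\<^sup>2)"
    proof (intro mult_left_mono)
      have "U (X s2) \<bullet> v > \<kappa>\<^sup>2 / 2" using t2(2)[of s2] s2 t by auto
      then have "K * (U (X s2) \<bullet> v) \<ge> K * (\<kappa>\<^sup>2 / 2)" using h by (intro mult_left_mono) auto
      moreover have "t * \<beta> * \<kappa>\<^sup>2 < K * \<kappa>\<^sup>2 / 4" using t2(2)[OF t] by auto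
      ultimately show "K * \<kappa>\<^sup>2 / 4 \<le> K * (U (X s2) \<bullet> v) - t * \<beta> * \<kappa>\<^sup>2" by simp
    qed (use h in auto)
    ultimately show False by (simp add: \<zeta>_def)
  qed
  then have "wb q * T q > 0" using key by (simp add: v_def)
  moreover have "wb q > 0" using Wq by (simp add: wb_def)
  ultimately have "T q > 0" by (simp add: zero_less_mult_iff)
  then show ?thesis by (simp add: T_def Wq(1))
qed

end

section \<open>The boundary as a graph\<close>

lemma Ck_on_mono: "Ck_on k f S \<Longrightarrow> j \<le> k \<Longrightarrow> Ck_on j f S"
  unfolding Ck_on_def by auto

lemma Ck_on_continuous: "Ck_on k f S \<Longrightarrow> length is \<le> k \<Longrightarrow> continuous_on S (Dp is f)"
  unfolding Ck_on_def by blast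

lemma local_defining_mono: "local_defining k \<Omega> q r \<phi> \<Longrightarrow> j \<le> k \<Longrightarrow> local_defining j \<Omega> q r \<phi>"
  unfolding local_defining_def using Ck_on_mono by blast

text \<open>\<open>local_defining\<close> describes \<open>\<Omega>\<close> only. At a frontier
  point a positive value would persist on a neighbourhood, and that neighbourhood meets
  \<open>\<Omega>\<close>.\<close>

lemma local_defining_zero:
  assumes ld: "local_defining k \<Omega> q r \<phi>" and op: "open \<Omega>" and x: "x \<in> frontier \<Omega>" "x \<in> ball q r"
  shows "\<phi> x = 0"
proof (rule antisym)
  have cont: "continuous_on (ball q r) \<phi>"
    using ld Ck_on_continuous[of k \<phi> _ "[]"] by (simp add: local_defining_def)
  have eq: "\<Omega> \<inter> ball q r = {x \<in> ball q r. \<phi> x < 0}" using ld by (simp add: local_defining_def)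
  have mem: "y \<in> \<Omega> \<longleftrightarrow> \<phi> y < 0" if "y \<in> ball q r" for y
    using set_eq_iff[THEN iffD1, OF eq, rule_format, of y] that by simp
  have "x \<notin> \<Omega>" using x(1) op by (simp add: frontier_def interior_open)
  then show "0 \<le> \<phi> x" using mem[OF x(2)] by simp
  show "\<phi> x \<le> 0"
  proof (rule ccontr)
    assume "\<not> \<phi> x \<le> 0"
    have o: "open (ball q r \<inter> \<phi> -` {0<..})" using cont by (intro continuous_open_preimage) auto
    have "ball q r \<inter> \<phi> -` {0<..} \<inter> closure \<Omega> \<noteq> {}" using x \<open>\<not> \<phi> x \<le> 0\<close> by (auto simp: frontier_def)
    then have "ball q r \<inter> \<phi> -` {0<..} \<inter> \<Omega> \<noteq> {}" using open_Int_closure_eq_empty[OF o, of \<Omega>] by blast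
    then obtain y where "y \<in> ball q r" "\<phi> y > 0" "y \<in> \<Omega>" by auto
    then show False using mem[of y] by simp
  qed
qed

lemma local_defining_subball:
  assumes ld: "local_defining k \<Omega> q r \<phi>" and x: "x \<in> ball q r"
  obtains r' where "local_defining k \<Omega> x r' \<phi>" "ball x r' \<subseteq> ball q r"
proof -
  obtain r' where r': "r' > 0" "ball x r' \<subseteq> ball q r" using openE[OF open_ball x] by blast
  have "Ck_on k \<phi> (ball x r')"
    using ld r'(2) unfolding local_defining_def Ck_on_def by (blast intro: continuous_on_subset)
  then have "local_defining k \<Omega> x r' \<phi>"
    using ld r' unfolding local_defining_def by blast
  then show thesis using that r' by blast
qed

lemma local_defining_ray:
  assumes ld: "local_defining k \<Omega> q r \<phi>" "1 \<le> k" and op: "open \<Omega>" and q: "q \<in> frontier \<Omega>" and d: "grad \<phi> q \<bullet> d < 0"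
  shows "\<exists>t1>0. \<forall>t. 0 < t \<longrightarrow> t < t1 \<longrightarrow> q + t *\<^sub>R d \<in> \<Omega>"
proof -
  have r: "r > 0" and eq: "\<Omega> \<inter> ball q r = {x \<in> ball q r. \<phi> x < 0}" and Ck: "Ck_on k \<phi> (ball q r)"
    using ld by (auto simp: local_defining_def)
  have "(\<phi> has_derivative (\<lambda>h. grad \<phi> q \<bullet> h)) (at q)"
    by (rule Ck_on_has_derivative_grad[OF Ck]) (use ld r in auto)
  from has_derivative_direction[OF this, of d]
  have "((\<lambda>t. \<phi> (q + t *\<^sub>R d)) has_real_derivative grad \<phi> q \<bullet> d) (at 0)" .
  from DERIV_neg_dec_right[OF this d]
  obtain t0 where t0: "t0 > 0" "\<And>t. 0 < t \<Longrightarrow> t < t0 \<Longrightarrow> \<phi> (q + t *\<^sub>R d) < \<phi> q" by auto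
  have "\<forall>\<^sub>F t in nhds 0. q + t *\<^sub>R d \<in> ball q r" by (rule eventually_line_in_open) (use r in auto)
  then obtain t2 where t2: "t2 > 0" "\<And>t. \<bar>t\<bar> < t2 \<Longrightarrow> q + t *\<^sub>R d \<in> ball q r"
    by (auto simp: eventually_nhds_metric)
  have "\<phi> q = 0" by (rule local_defining_zero[OF ld(1) op q]) (use r in auto)
  have "q + t *\<^sub>R d \<in> \<Omega>" if "0 < t" "t < min t0 t2" for t
  proof -
    have "q + t *\<^sub>R d \<in> {x \<in> ball q r. \<phi> x < 0}"
      using t0(2)[of t] t2(2)[of t] that \<open>\<phi> q = 0\<close> by auto
    then show ?thesis using eq by blast
  qed
  then show ?thesis using t0 t2 by (intro exI[of _ "min t0 t2"]) auto
qed

text \<open>A tangential component of the boundary gradient would make \<open>u\<close> negative on some inward ray.\<close>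
lemma boundary_gradient_normal:
  fixes U :: "real^'n \<Rightarrow> real^'n"
  assumes op: "open \<Omega>" and q: "q \<in> frontier \<Omega>" and ld: "local_defining 1 \<Omega> q r \<phi>" and kappa: "\<kappa> > 0"
    and U: "continuous_on (closure \<Omega>) U" "\<And>x. x \<in> \<Omega> \<Longrightarrow> (u has_derivative (\<lambda>h. U x \<bullet> h)) (at x)"
    and u: "continuous_on (closure \<Omega>) u" "\<And>x. x \<in> \<Omega> \<Longrightarrow> u x > 0" "u q = 0"
    and neu: "U q \<bullet> ((1 / norm (grad \<phi> q)) *\<^sub>R grad \<phi> q) = - \<kappa>"
  shows "U q = - \<kappa> *\<^sub>R ((1 / norm (grad \<phi> q)) *\<^sub>R grad \<phi> q)"
proof (rule ccontr)
  assume ne: "U q \<noteq> - \<kappa> *\<^sub>R ((1 / norm (grad \<phi> q)) *\<^sub>R grad \<phi> q)"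
  define \<nu> where "\<nu> = (1 / norm (grad \<phi> q)) *\<^sub>R grad \<phi> q"
  have n0: "grad \<phi> q \<noteq> 0" using ld by (auto simp: local_defining_def)
  have \<nu>\<nu>: "\<nu> \<bullet> \<nu> = 1" using n0 by (simp add: \<nu>_def dot_square_norm power2_eq_square)
  have qc: "q \<in> closure \<Omega>" using q by (simp add: frontier_def)
  define \<tau> where "\<tau> = U q + \<kappa> *\<^sub>R \<nu>"
  have \<tau>0: "\<tau> \<bullet> \<tau> > 0" using ne by (simp add: \<tau>_def \<nu>_def eq_neg_iff_add_eq_0)
  have "U q \<bullet> \<nu> = - \<kappa>" using neu by (simp only: \<nu>_def)
  then have \<tau>\<nu>: "\<tau> \<bullet> \<nu> = 0" using \<nu>\<nu> by (simp add: \<tau>_def inner_add_left)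
  \<comment> \<open>With this \<open>e\<close> the direction \<open>d\<close> has U q \<bullet> d =
    \<kappa> e - |\<tau>|^2 = - |\<tau>|^2 / 2, while its normal part
    \<open>- e *\<^sub>R \<nu>\<close> still points inward.\<close>
  define e where "e = (\<tau> \<bullet> \<tau>) / (2 * \<kappa>)"
  have e: "e > 0" using \<tau>0 kappa by (simp add: e_def)
  define d where "d = - e *\<^sub>R \<nu> - \<tau>"
  have "grad \<phi> q = norm (grad \<phi> q) *\<^sub>R \<nu>" using n0 by (simp add: \<nu>_def)
  then have "grad \<phi> q \<bullet> d = norm (grad \<phi> q) * (\<nu> \<bullet> d)" by (metis inner_scaleR_left)
  also have "\<nu> \<bullet> d = - e" using \<nu>\<nu> \<tau>\<nu> by (simp add: d_def inner_diff_right inner_commute)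
  finally have "grad \<phi> q \<bullet> d < 0" using n0 e by (simp add: mult_pos_neg)
  from local_defining_ray[OF ld _ op q this]
  obtain t1 where t1: "t1 > 0" "\<And>t. 0 < t \<Longrightarrow> t < t1 \<Longrightarrow> q + t *\<^sub>R d \<in> \<Omega>" by auto
  have "U q = \<tau> - \<kappa> *\<^sub>R \<nu>" by (simp add: \<tau>_def)
  then have "U q \<bullet> d = \<kappa> * e - \<tau> \<bullet> \<tau>"
    using \<nu>\<nu> \<tau>\<nu> by (simp add: d_def inner_diff_left inner_diff_right inner_commute)
  then have neg: "U q \<bullet> d < 0" using \<tau>0 kappa by (simp add: e_def)
  have X0: "((\<lambda>t. q + t *\<^sub>R d) \<longlongrightarrow> q) (at_right 0)" by (rule tendsto_eq_intros | simp)+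
  have evX: "\<forall>\<^sub>F t in at_right 0. q + t *\<^sub>R d \<in> \<Omega>"
    using eventually_at_right_real[OF t1(1)] by eventually_elim (use t1 in auto)
  then have "\<forall>\<^sub>F t in at_right 0. q + t *\<^sub>R d \<in> closure \<Omega>" by eventually_elim (use closure_subset in auto)
  then have "((\<lambda>t. U (q + t *\<^sub>R d)) \<longlongrightarrow> U q) (at_right 0)"
    by (rule continuous_on_tendsto_compose[OF U(1) X0 qc])
  then have "((\<lambda>t. U (q + t *\<^sub>R d) \<bullet> d) \<longlongrightarrow> U q \<bullet> d) (at_right 0)" by (intro tendsto_intros)
  from order_tendstoD(2)[OF this neg] evX
  have "\<forall>\<^sub>F t in at_right 0. q + t *\<^sub>R d \<in> \<Omega> \<and> U (q + t *\<^sub>R d) \<bullet> d < 0" by eventually_elim auto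
  then obtain t2 where t2: "t2 > 0" "\<And>t. 0 < t \<Longrightarrow> t < t2 \<Longrightarrow> q + t *\<^sub>R d \<in> \<Omega> \<and> U (q + t *\<^sub>R d) \<bullet> d < 0"
    unfolding eventually_at_right_field by blast
  define t where "t = t2 / 2"
  have t: "0 < t" "t < t2" using t2 by (auto simp: t_def)
  have img: "(\<lambda>t. q + t *\<^sub>R d) ` {0..t} \<subseteq> closure \<Omega>"
  proof (intro subsetI, elim imageE)
    fix y s assume "y = q + s *\<^sub>R d" "s \<in> {0..t}"
    then show "y \<in> closure \<Omega>" using t2(2)[of s] t qc closure_subset by (cases "s = 0") auto
  qed
  obtain \<xi> where \<xi>: "0 < \<xi>" "\<xi> < t" "u (q + t *\<^sub>R d) - u (q + 0 *\<^sub>R d) = (t - 0) * (U (q + \<xi> *\<^sub>R d) \<bullet> d)"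
  proof (rule mvt[OF t(1)])
    show "continuous_on {0..t} (\<lambda>t. u (q + t *\<^sub>R d))"
      by (rule continuous_on_compose2[OF u(1) _ img]) (intro continuous_intros)
    fix s assume s: "0 < s" "s < t"
    then have sO: "q + s *\<^sub>R d \<in> \<Omega>" using t2(2)[of s] t by auto
    have "((\<lambda>t. q + t *\<^sub>R d) has_derivative (\<lambda>h. h *\<^sub>R d)) (at s)" by (auto intro!: derivative_eq_intros)
    from has_derivative_compose[OF this U(2)[OF sO]]
    show "((\<lambda>t. u (q + t *\<^sub>R d)) has_derivative (\<lambda>h. h * (U (q + s *\<^sub>R d) \<bullet> d))) (at s)" by simp
  qed
  have "t * (U (q + \<xi> *\<^sub>R d) \<bullet> d) < 0" using t2(2)[of \<xi>] \<xi> t by (intro mult_pos_neg) auto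
  then have "u (q + t *\<^sub>R d) < 0" using \<xi>(3) u(3) by simp
  moreover have "u (q + t *\<^sub>R d) > 0" using u(2) t2(2)[OF t] by blast
  ultimately show False by simp
qed

text \<open>Graph functions are kept on all of \<open>real^'n\<close> and ignore coordinate
  \<open>k\<close>. Replacing a coordinate avoids a second type of dimension n - 1 and a splitting
  of vectors.\<close>

definition put :: "'n \<Rightarrow> real^'n \<Rightarrow> real \<Rightarrow> real^'n::finite" where
  "put k x y = x + (y - x $ k) *\<^sub>R axis k 1"

lemma put_nth: "put k x y $ i = (if i = k then y else x $ i)"
  by (simp add: put_def axis_def)

lemma put_put: "put k (put k x y) z = put k x z"
  by (simp add: vec_eq_iff put_nth)

lemma put_self: "put k x (x $ k) = x"
  by (simp add: put_def)

lemma put_diff: "put k x y - put k x z = (y - z) *\<^sub>R axis k 1"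
  by (simp add: vec_eq_iff put_nth axis_def)

lemma continuous_put: "continuous_on S a \<Longrightarrow> continuous_on S b \<Longrightarrow> continuous_on S (\<lambda>t. put k (a t) (b t))"
  unfolding put_def by (intro continuous_intros)

lemma norm_put_le: "norm (put k x (q $ k) - q) \<le> norm (x - q)"
  by (rule norm_le_componentwise_cart) (simp add: put_nth)

lemma open_cylinder: "open {x. norm (put k x (q $ k) - q) < a}"
  by (intro open_Collect_less continuous_intros continuous_put)

lemma isCont_tendsto_nhds:
  fixes f :: "'a::metric_space \<Rightarrow> 'b::metric_space"
  shows "isCont f x \<Longrightarrow> (f \<longlongrightarrow> f x) (nhds x)"
  by (simp add: continuous_at_eps_delta tendsto_iff eventually_nhds_metric)

text \<open>Implicit function theorem with one real unknown. Along axis \<open>k\<close> the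
  function \<open>s * \<phi>\<close> is strictly increasing, so its zero exists by the intermediate
  value theorem and depends continuously on \<open>x\<close> by comparison of signs. The k-th
  component cancels in the derivative of \<open>\<gamma>\<close>, as \<open>\<gamma>\<close> ignores
  that coordinate.\<close>

lemma boundary_graph:
  fixes \<phi> :: "real^'n \<Rightarrow> real"
  assumes ld: "local_defining 1 \<Omega> q r \<phi>" and op: "open \<Omega>" and q: "q \<in> frontier \<Omega>" and k: "grad \<phi> q $ k \<noteq> 0"
  obtains a b \<gamma> s where "a > 0" "b > 0" "s = 1 \<or> s = -1" "\<gamma> q = q $ k"
    "\<And>x y. \<gamma> (put k x y) = \<gamma> x"
    "\<And>x. norm (put k x (q $ k) - q) < a \<Longrightarrow> \<bar>\<gamma> x - q $ k\<bar> < b"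
    "\<And>x y. norm (put k x (q $ k) - q) < a \<Longrightarrow> \<bar>y - q $ k\<bar> \<le> b \<Longrightarrow>
        put k x y \<in> ball q r \<and> grad \<phi> (put k x y) $ k \<noteq> 0 \<and> (put k x y \<in> \<Omega> \<longleftrightarrow> s * (y - \<gamma> x) < 0)"
    "\<And>x. norm (put k x (q $ k) - q) < a \<Longrightarrow> put k x (\<gamma> x) \<in> frontier \<Omega>"
    "\<And>x. norm (put k x (q $ k) - q) < a \<Longrightarrow>
       (\<gamma> has_derivative (\<lambda>h. h $ k - (grad \<phi> (put k x (\<gamma> x)) \<bullet> h) / grad \<phi> (put k x (\<gamma> x)) $ k)) (at x)"
proof -
  have r: "r > 0" and eq: "\<Omega> \<inter> ball q r = {x \<in> ball q r. \<phi> x < 0}" and Ck: "Ck_on 1 \<phi> (ball q r)"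
    using ld by (auto simp: local_defining_def)
  define s where "s = sgn (grad \<phi> q $ k)"
  have s: "s = 1 \<or> s = -1" using k by (auto simp: s_def sgn_if)
  have ss: "s * s = 1" using s by auto
  have sk: "s * grad \<phi> q $ k > 0" using k by (auto simp: s_def sgn_if)
  have der: "(\<phi> has_derivative (\<lambda>h. grad \<phi> x \<bullet> h)) (at x)" if "x \<in> ball q r" for x
    by (rule Ck_on_has_derivative_grad[OF Ck _ _ that]) auto
  have \<phi>c: "continuous_on (ball q r) \<phi>" using der
    by (intro continuous_at_imp_continuous_on) (blast intro: has_derivative_continuous)
  have "continuous_on (ball q r) (Dp [k] \<phi>)" by (rule Ck_on_continuous[OF Ck]) simp
  then have gk: "continuous_on (ball q r) (\<lambda>x. s * grad \<phi> x $ k)" unfolding grad_nth by (intro continuous_intros)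
  have "open (ball q r \<inter> (\<lambda>x. s * grad \<phi> x $ k) -` {0<..})" using gk by (intro continuous_open_preimage) auto
  moreover have "q \<in> ball q r \<inter> (\<lambda>x. s * grad \<phi> x $ k) -` {0<..}" using sk r by auto
  ultimately obtain r1 where r1: "r1 > 0" "ball q r1 \<subseteq> ball q r \<inter> (\<lambda>x. s * grad \<phi> x $ k) -` {0<..}"
    using open_contains_ball by blast
  \<comment> \<open>Half of the radius for the displacement along axis \<open>k\<close>, the other
    half for the remaining coordinates.\<close>
  define b where "b = r1 / 2"
  have b: "b > 0" using r1 by (simp add: b_def)
  have pin: "put k x y \<in> ball q r1" if "norm (put k x (q $ k) - q) < b" "\<bar>y - q $ k\<bar> \<le> b" for x y
  proof -
    have e: "put k x y - q = (put k x (q $ k) - q) + (y - q $ k) *\<^sub>R axis k 1"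
      using put_diff[of k x y "q $ k"] by (simp add: algebra_simps)
    have "norm (put k x y - q) \<le> norm (put k x (q $ k) - q) + \<bar>y - q $ k\<bar>"
      unfolding e using norm_triangle_ineq[of "put k x (q $ k) - q" "(y - q $ k) *\<^sub>R axis k (1::real)"] by simp
    then show ?thesis using that by (simp add: dist_norm norm_minus_commute b_def)
  qed
  define h where "h x y = s * \<phi> (put k x y)" for x y
  have hder: "((\<lambda>y. h x y) has_real_derivative s * grad \<phi> (put k x y) $ k) (at y)"
    if "norm (put k x (q $ k) - q) < b" "\<bar>y - q $ k\<bar> \<le> b" for x y
  proof -
    have "put k x y \<in> ball q r" using pin[OF that] r1 by auto
    from has_derivative_direction[OF der[OF this], of "axis k 1"]
    have "((\<lambda>t. \<phi> (put k x y + t *\<^sub>R axis k 1)) has_real_derivative grad \<phi> (put k x y) $ k) (at 0)"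
      by (simp add: inner_axis)
    moreover have "put k x y + t *\<^sub>R axis k 1 = put k x (t + y)" for t by (simp add: put_def algebra_simps)
    ultimately have "((\<lambda>t. \<phi> (put k x (t + y))) has_real_derivative grad \<phi> (put k x y) $ k) (at 0)" by simp
    then have "((\<lambda>y. \<phi> (put k x y)) has_real_derivative grad \<phi> (put k x y) $ k) (at y)"
      using DERIV_shift[of "\<lambda>y. \<phi> (put k x y)" _ 0 y] by simp
    then show ?thesis unfolding h_def by (rule DERIV_cmult)
  qed
  have mono: "h x y < h x z" if x: "norm (put k x (q $ k) - q) < b" and yz: "\<bar>y - q $ k\<bar> \<le> b" "\<bar>z - q $ k\<bar> \<le> b" "y < z" for x y z
  proof (rule DERIV_pos_imp_increasing[OF yz(3), of "h x"])
    fix v assume "y \<le> v" "v \<le> z"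
    then have v: "\<bar>v - q $ k\<bar> \<le> b" using yz by auto
    have "s * grad \<phi> (put k x v) $ k > 0" using pin[OF x v] r1 by auto
    then show "\<exists>d. (h x has_real_derivative d) (at v) \<and> d > 0" using hder[OF x v] by blast
  qed
  have \<phi>q: "\<phi> q = 0" by (rule local_defining_zero[OF ld op q]) (use r in auto)
  have nq: "norm (put k q (q $ k) - q) = 0" by (simp add: put_self)
  have hq: "h q (q $ k) = 0" by (simp add: h_def put_self \<phi>q)
  have hcont: "isCont (\<lambda>x. h x y) x" if "norm (put k x (q $ k) - q) < b" "\<bar>y - q $ k\<bar> \<le> b" for x y
  proof -
    have "put k x y \<in> ball q r" using pin[OF that] r1 by auto
    then have 1: "isCont \<phi> (put k x y)" using \<phi>c by (simp add: continuous_on_eq_continuous_at)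
    have 2: "isCont (\<lambda>x. put k x y) x" unfolding put_def by (intro continuous_intros)
    show ?thesis unfolding h_def by (rule continuous_mult[OF continuous_const isCont_o2[OF 2 1]])
  qed
  have "h q (q $ k + b) > 0" "h q (q $ k - b) < 0"
    using mono[of q "q $ k" "q $ k + b"] mono[of q "q $ k - b" "q $ k"] nq b hq by auto
  moreover have "((\<lambda>x. h x (q $ k + b)) \<longlongrightarrow> h q (q $ k + b)) (nhds q)" "((\<lambda>x. h x (q $ k - b)) \<longlongrightarrow> h q (q $ k - b)) (nhds q)"
    using nq b by (auto intro!: isCont_tendsto_nhds hcont)
  ultimately have "\<forall>\<^sub>F x in nhds q. h x (q $ k + b) > 0" "\<forall>\<^sub>F x in nhds q. h x (q $ k - b) < 0"
    by (auto dest: order_tendstoD)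
  then have "\<forall>\<^sub>F x in nhds q. h x (q $ k + b) > 0 \<and> h x (q $ k - b) < 0" by eventually_elim auto
  then obtain a0 where a0: "a0 > 0" "\<And>x. dist x q < a0 \<Longrightarrow> h x (q $ k + b) > 0 \<and> h x (q $ k - b) < 0"
    unfolding eventually_nhds_metric by blast
  define a where "a = min a0 b"
  have a: "a > 0" "a \<le> b" using a0 b by (auto simp: a_def)
  have hb: "h x (q $ k + b) > 0" "h x (q $ k - b) < 0" if "norm (put k x (q $ k) - q) < a" for x
  proof -
    have "h (put k x (q $ k)) (q $ k + b) > 0 \<and> h (put k x (q $ k)) (q $ k - b) < 0"
      by (rule a0(2)) (use that in \<open>simp add: a_def dist_norm\<close>)
    then show "h x (q $ k + b) > 0" "h x (q $ k - b) < 0" by (simp_all add: h_def put_put)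
  qed
  \<comment> \<open>The chosen property sees \<open>x\<close> through \<open>put k x y\<close> only,
    so \<open>put_put\<close> gives independence of coordinate \<open>k\<close> for the choice as
    well.\<close>
  define \<gamma> where "\<gamma> x = (SOME y. \<bar>y - q $ k\<bar> < b \<and> \<phi> (put k x y) = 0)" for x
  have \<gamma>ex: "\<bar>\<gamma> x - q $ k\<bar> < b \<and> \<phi> (put k x (\<gamma> x)) = 0" if x: "norm (put k x (q $ k) - q) < a" for x
  proof -
    have xb: "norm (put k x (q $ k) - q) < b" using x a by simp
    have "\<exists>y. q $ k - b \<le> y \<and> y \<le> q $ k + b \<and> h x y = 0"
    proof (rule IVT)
      show "h x (q $ k - b) \<le> 0" "0 \<le> h x (q $ k + b)" using hb[OF x] by auto
      show "\<forall>y. q $ k - b \<le> y \<and> y \<le> q $ k + b \<longrightarrow> isCont (h x) y"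
        using hder[OF xb] DERIV_isCont by (metis abs_diff_le_iff)
    qed (use b in auto)
    then obtain y where y: "q $ k - b \<le> y" "y \<le> q $ k + b" "h x y = 0" by blast
    then have "y \<noteq> q $ k - b" "y \<noteq> q $ k + b" using hb[OF x] by auto
    then have "\<bar>y - q $ k\<bar> < b" using y by auto
    moreover have "\<phi> (put k x y) = 0" using y(3) s by (auto simp: h_def)
    ultimately show ?thesis
      unfolding \<gamma>_def using someI[of "\<lambda>y. \<bar>y - q $ k\<bar> < b \<and> \<phi> (put k x y) = 0" y] by blast
  qed
  have \<gamma>0: "h x (\<gamma> x) = 0" if "norm (put k x (q $ k) - q) < a" for x
    using \<gamma>ex[OF that] by (simp add: h_def)
  have sgn_h: "h x y < 0 \<longleftrightarrow> y < \<gamma> x" "h x y > 0 \<longleftrightarrow> y > \<gamma> x"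
    if x: "norm (put k x (q $ k) - q) < a" and y: "\<bar>y - q $ k\<bar> \<le> b" for x y
  proof -
    have xb: "norm (put k x (q $ k) - q) < b" using x a by simp
    have g: "\<bar>\<gamma> x - q $ k\<bar> \<le> b" using \<gamma>ex[OF x] by simp
    show "h x y < 0 \<longleftrightarrow> y < \<gamma> x" "h x y > 0 \<longleftrightarrow> y > \<gamma> x"
      using mono[OF xb y g] mono[OF xb g y] \<gamma>0[OF x] by (cases y "\<gamma> x" rule: linorder_cases; force)+
  qed
  have region: "put k x y \<in> ball q r \<and> grad \<phi> (put k x y) $ k \<noteq> 0 \<and> (put k x y \<in> \<Omega> \<longleftrightarrow> s * (y - \<gamma> x) < 0)"
    if x: "norm (put k x (q $ k) - q) < a" and y: "\<bar>y - q $ k\<bar> \<le> b" for x y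
  proof -
    have "put k x y \<in> ball q r1" by (rule pin) (use x y a in auto)
    then have 1: "put k x y \<in> ball q r" "grad \<phi> (put k x y) $ k \<noteq> 0" using r1 by auto
    then have "put k x y \<in> \<Omega> \<longleftrightarrow> \<phi> (put k x y) < 0" using eq by blast
    also have "\<dots> \<longleftrightarrow> s * (y - \<gamma> x) < 0" using sgn_h[OF x y] s by (auto simp: h_def)
    finally show ?thesis using 1 by blast
  qed
  have front: "put k x (\<gamma> x) \<in> frontier \<Omega>" if x: "norm (put k x (q $ k) - q) < a" for x
  proof -
    have g: "\<bar>\<gamma> x - q $ k\<bar> < b" using \<gamma>ex[OF x] by simp
    have "put k x (\<gamma> x) \<notin> \<Omega>" using region[OF x, of "\<gamma> x"] g by auto
    moreover have "put k x (\<gamma> x) \<in> closure \<Omega>"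
    proof (rule Lim_in_closed_set[OF closed_closure, where F="at_right (0::real)" and f="\<lambda>\<delta>. put k x (\<gamma> x - s * \<delta>)"])
      show "((\<lambda>\<delta>. put k x (\<gamma> x - s * \<delta>)) \<longlongrightarrow> put k x (\<gamma> x)) (at_right 0)"
        unfolding put_def by (rule tendsto_eq_intros | simp)+
      have "\<forall>\<^sub>F \<delta> in at_right 0. \<delta> \<in> {0<..<b - \<bar>\<gamma> x - q $ k\<bar>}"
        by (rule eventually_at_right_real) (use g in auto)
      then show "\<forall>\<^sub>F \<delta> in at_right 0. put k x (\<gamma> x - s * \<delta>) \<in> closure \<Omega>"
      proof eventually_elim
        case (elim \<delta>)
        have "\<bar>\<gamma> x - s * \<delta> - q $ k\<bar> \<le> b" using s elim by auto
        moreover have "s * (\<gamma> x - s * \<delta> - \<gamma> x) < 0" using s elim by auto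
        ultimately have "put k x (\<gamma> x - s * \<delta>) \<in> \<Omega>" using region[OF x] by blast
        then show ?case using closure_subset by blast
      qed
    qed auto
    ultimately show ?thesis using op by (simp add: frontier_def interior_open)
  qed
  have ev_cyl: "\<forall>\<^sub>F x' in nhds x. norm (put k x' (q $ k) - q) < a" if "norm (put k x (q $ k) - q) < a" for x
    using eventually_nhds_in_open[OF open_cylinder[of k q a], of x] that by simp
  have \<gamma>cont: "isCont \<gamma> x" if x: "norm (put k x (q $ k) - q) < a" for x
    unfolding continuous_at_eps_delta
  proof (intro allI impI)
    fix e :: real assume e: "e > 0"
    have g: "\<bar>\<gamma> x - q $ k\<bar> < b" using \<gamma>ex[OF x] by simp
    define e' where "e' = min (e / 2) (b - \<bar>\<gamma> x - q $ k\<bar>)"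
    have e': "e' > 0" "e' < e" using e g by (auto simp: e'_def min_def)
    have yb: "\<bar>\<gamma> x + e' - q $ k\<bar> \<le> b" "\<bar>\<gamma> x - e' - q $ k\<bar> \<le> b" using e' by (auto simp: e'_def)
    have xb: "norm (put k x (q $ k) - q) < b" using x a by simp
    have "h x (\<gamma> x + e') > 0" "h x (\<gamma> x - e') < 0" using sgn_h[OF x] yb e' by auto
    moreover have "((\<lambda>x'. h x' (\<gamma> x + e')) \<longlongrightarrow> h x (\<gamma> x + e')) (nhds x)" "((\<lambda>x'. h x' (\<gamma> x - e')) \<longlongrightarrow> h x (\<gamma> x - e')) (nhds x)"
      by (rule isCont_tendsto_nhds[OF hcont[OF xb yb(1)]], rule isCont_tendsto_nhds[OF hcont[OF xb yb(2)]])
    ultimately have "\<forall>\<^sub>F x' in nhds x. h x' (\<gamma> x + e') > 0" "\<forall>\<^sub>F x' in nhds x. h x' (\<gamma> x - e') < 0"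
      by (auto dest: order_tendstoD)
    with ev_cyl[OF x] have "\<forall>\<^sub>F x' in nhds x. dist (\<gamma> x') (\<gamma> x) < e"
    proof eventually_elim
      case (elim x')
      then have "\<gamma> x' < \<gamma> x + e'" "\<gamma> x' > \<gamma> x - e'" using sgn_h[OF elim(1)] yb by auto
      then show ?case using e' by (auto simp: dist_real_def)
    qed
    then show "\<exists>d>0. \<forall>x'. dist x' x < d \<longrightarrow> dist (\<gamma> x') (\<gamma> x) < e"
      by (simp add: eventually_nhds_metric)
  qed
  have \<gamma>der: "(\<gamma> has_derivative (\<lambda>h. h $ k - (grad \<phi> (put k x (\<gamma> x)) \<bullet> h) / grad \<phi> (put k x (\<gamma> x)) $ k)) (at x)"
    if x: "norm (put k x (q $ k) - q) < a" for x
    unfolding has_derivative_at_alt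
  proof (intro conjI allI impI)
    define z0 where "z0 = put k x (\<gamma> x)"
    define n where "n = grad \<phi> z0"
    define \<alpha> where "\<alpha> = \<bar>n $ k\<bar>"
    have g: "\<bar>\<gamma> x - q $ k\<bar> < b" using \<gamma>ex[OF x] by simp
    have z0: "z0 \<in> ball q r" "n $ k \<noteq> 0" using region[OF x, of "\<gamma> x"] g by (auto simp: z0_def n_def)
    have \<alpha>: "\<alpha> > 0" using z0 by (simp add: \<alpha>_def)
    show "bounded_linear (\<lambda>h. h $ k - (grad \<phi> (put k x (\<gamma> x)) \<bullet> h) / grad \<phi> (put k x (\<gamma> x)) $ k)"
      by (intro bounded_linear_sub bounded_linear_vec_nth bounded_linear_compose[OF bounded_linear_divide bounded_linear_inner_right])
    fix e :: real assume e: "e > 0"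
    \<comment> \<open>The expansion of \<open>\<phi>\<close> is used twice. With
      \<open>e1 \<le> \<alpha> / 2\<close> the unknown increment \<open>q1\<close> is absorbed,
      which gives the a priori bound \<open>C * norm v\<close>; with that bound the second
      restriction on \<open>e1\<close> yields accuracy \<open>e\<close>.\<close>
    define C where "C = 2 * (norm n + \<alpha>) / \<alpha>"
    have C: "C \<ge> 0" using \<alpha> by (simp add: C_def)
    define e1 where "e1 = min (\<alpha> / 2) (e * \<alpha> / (1 + C))"
    have e1: "e1 > 0" "e1 \<le> \<alpha> / 2" "e1 * (1 + C) \<le> e * \<alpha>"
    proof -
      show "e1 > 0" using \<alpha> e C by (auto simp: e1_def)
      show "e1 \<le> \<alpha> / 2" unfolding e1_def by (rule min.cobounded1)
      have "e1 * (1 + C) \<le> e * \<alpha> / (1 + C) * (1 + C)" using C by (intro mult_right_mono) (auto simp: e1_def)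
      then show "e1 * (1 + C) \<le> e * \<alpha>" using C by simp
    qed
    obtain d1 where d1: "d1 > 0" "\<And>z. norm (z - z0) < d1 \<Longrightarrow> norm (\<phi> z - \<phi> z0 - n \<bullet> (z - z0)) \<le> e1 * norm (z - z0)"
      using der[OF z0(1)] e1(1) unfolding has_derivative_at_alt n_def by blast
    have "isCont (\<lambda>x'. put k x' (\<gamma> x')) x"
      unfolding put_def using \<gamma>cont[OF x] by (intro continuous_intros)
    then have "((\<lambda>x'. put k x' (\<gamma> x')) \<longlongrightarrow> z0) (nhds x)"
      unfolding z0_def by (rule isCont_tendsto_nhds)
    then have "\<forall>\<^sub>F x' in nhds x. dist (put k x' (\<gamma> x')) z0 < d1" using d1(1) by (rule tendstoD)
    with ev_cyl[OF x] have "\<forall>\<^sub>F x' in nhds x. norm (put k x' (q $ k) - q) < a \<and> dist (put k x' (\<gamma> x')) z0 < d1"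
      by eventually_elim auto
    then obtain d where d: "d > 0" "\<And>x'. dist x' x < d \<Longrightarrow> norm (put k x' (q $ k) - q) < a \<and> dist (put k x' (\<gamma> x')) z0 < d1"
      unfolding eventually_nhds_metric by blast
    show "\<exists>d>0. \<forall>x'. norm (x' - x) < d \<longrightarrow>
        norm (\<gamma> x' - \<gamma> x - ((x' - x) $ k - (grad \<phi> (put k x (\<gamma> x)) \<bullet> (x' - x)) / grad \<phi> (put k x (\<gamma> x)) $ k)) \<le> e * norm (x' - x)"
    proof (intro exI[of _ d] conjI d(1) allI impI)
      fix x' assume x': "norm (x' - x) < d"
      define v where "v = x' - x"
      define z where "z = put k x' (\<gamma> x')"
      have c: "norm (put k x' (q $ k) - q) < a" "norm (z - z0) < d1" using d(2)[of x'] x' by (auto simp: dist_norm z_def)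
      \<comment> \<open>The increment of \<open>\<gamma>\<close> less the k-th component of
        \<open>v\<close>: the displacement between the two graph points is then \<open>v\<close>
        plus \<open>q1\<close> times axis \<open>k\<close>.\<close>
      define q1 where "q1 = \<gamma> x' - \<gamma> x - v $ k"
      have zz: "z - z0 = v + q1 *\<^sub>R axis k 1"
        by (simp add: z_def z0_def put_def v_def q1_def algebra_simps)
      have "\<phi> z = 0" "\<phi> z0 = 0" using \<gamma>ex[OF c(1)] \<gamma>ex[OF x] by (auto simp: z_def z0_def)
      then have "\<bar>n \<bullet> (z - z0)\<bar> \<le> e1 * norm (z - z0)" using d1(2)[OF c(2)] by simp
      also have "norm (z - z0) \<le> norm v + \<bar>q1\<bar>"
        unfolding zz using norm_triangle_ineq[of v "q1 *\<^sub>R axis k (1::real)"] by simp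
      finally have 1: "\<bar>n \<bullet> v + n $ k * q1\<bar> \<le> e1 * (norm v + \<bar>q1\<bar>)"
        using e1(1) unfolding zz by (simp add: inner_add_right inner_axis mult.commute)
      have "\<alpha> * \<bar>q1\<bar> = \<bar>n $ k * q1\<bar>" by (simp add: \<alpha>_def abs_mult)
      also have "\<dots> \<le> \<bar>n \<bullet> v + n $ k * q1\<bar> + \<bar>n \<bullet> v\<bar>" by linarith
      also have "\<dots> \<le> e1 * (norm v + \<bar>q1\<bar>) + norm n * norm v"
        using 1 Cauchy_Schwarz_ineq2[of n v] by linarith
      also have "e1 * (norm v + \<bar>q1\<bar>) \<le> \<alpha> / 2 * (norm v + \<bar>q1\<bar>)" using e1 by (intro mult_right_mono) auto
      finally have "\<alpha> / 2 * \<bar>q1\<bar> \<le> (norm n + \<alpha> / 2) * norm v" by (simp add: field_simps)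
      also have "\<dots> \<le> (norm n + \<alpha>) * norm v" using \<alpha> by (intro mult_right_mono) auto
      finally have "\<bar>q1\<bar> \<le> C * norm v" using \<alpha> by (simp add: C_def field_simps)
      then have "e1 * (norm v + \<bar>q1\<bar>) \<le> e1 * (norm v + C * norm v)" using e1 by (intro mult_left_mono) auto
      also have "\<dots> = e1 * (1 + C) * norm v" by (simp add: algebra_simps)
      also have "\<dots> \<le> e * \<alpha> * norm v" using e1 by (intro mult_right_mono) auto
      finally have "\<bar>n \<bullet> v + n $ k * q1\<bar> \<le> e * \<alpha> * norm v" using 1 by simp
      moreover have "n \<bullet> v + n $ k * q1 = n $ k * (q1 + (n \<bullet> v) / n $ k)" using z0 by (simp add: field_simps)
      ultimately have "\<alpha> * \<bar>q1 + (n \<bullet> v) / n $ k\<bar> \<le> \<alpha> * (e * norm v)" by (simp add: abs_mult \<alpha>_def mult_ac)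
      then have "\<bar>q1 + (n \<bullet> v) / n $ k\<bar> \<le> e * norm v" using \<alpha> by simp
      then show "norm (\<gamma> x' - \<gamma> x - ((x' - x) $ k - (grad \<phi> (put k x (\<gamma> x)) \<bullet> (x' - x)) / grad \<phi> (put k x (\<gamma> x)) $ k)) \<le> e * norm (x' - x)"
        by (simp add: q1_def n_def v_def z0_def algebra_simps)
    qed
  qed
  have "\<gamma> q = q $ k"
  proof -
    have "norm (put k q (q $ k) - q) < a" using a nq by simp
    from sgn_h[OF this, of "q $ k"] hq b show ?thesis by auto
  qed
  moreover have "\<gamma> (put k x y) = \<gamma> x" for x y by (simp add: \<gamma>_def put_put)
  ultimately show thesis
    using that[of a b s \<gamma>] a b s \<gamma>ex region front \<gamma>der by blast
qed

section \<open>Second-order regularity of the boundary and mean curvature\<close>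

text \<open>Differentiability is known for the approximations only. Joint convergence of their
  derivatives bounds the difference quotients at 0 uniformly in \<open>\<delta>\<close>, and such a
  bound survives the pointwise limit.\<close>

lemma has_derivative_limit:
  fixes v :: "real \<Rightarrow> real" and V V' :: "real \<Rightarrow> real \<Rightarrow> real"
  assumes \<eta>0: "\<eta>0 > 0"
    and der: "\<And>\<delta> t. 0 < \<delta> \<Longrightarrow> \<delta> < \<eta>0 \<Longrightarrow> \<bar>t\<bar> < \<eta>0 \<Longrightarrow> (V \<delta> has_real_derivative V' \<delta> t) (at t)"
    and lim: "\<And>t. \<bar>t\<bar> < \<eta>0 \<Longrightarrow> ((\<lambda>\<delta>. V \<delta> t) \<longlongrightarrow> v t) (at_right 0)"
    and conv: "((\<lambda>z. V' (fst z) (snd z)) \<longlongrightarrow> w) (at_right 0 \<times>\<^sub>F nhds 0)"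
  shows "(v has_real_derivative w) (at 0)"
  unfolding has_field_derivative_def has_derivative_at_alt
proof (intro conjI allI impI bounded_linear_mult_right)
  fix e :: real assume e: "e > 0"
  have "\<forall>\<^sub>F z in at_right 0 \<times>\<^sub>F nhds (0::real). dist (V' (fst z) (snd z)) w < e" using conv e by (rule tendstoD)
  then obtain Pf Pg where Pf: "\<forall>\<^sub>F \<delta> in at_right 0. Pf \<delta>" and Pg: "\<forall>\<^sub>F t in nhds (0::real). Pg t"
    and P: "\<And>\<delta> t. Pf \<delta> \<Longrightarrow> Pg t \<Longrightarrow> dist (V' \<delta> t) w < e"
    unfolding eventually_prod_filter by auto
  obtain d1 where d1: "d1 > 0" "\<And>\<delta>. 0 < \<delta> \<Longrightarrow> \<delta> < d1 \<Longrightarrow> Pf \<delta>" using Pf unfolding eventually_at_right_field by blast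
  obtain d2 where d2: "d2 > 0" "\<And>t. \<bar>t\<bar> < d2 \<Longrightarrow> Pg t" using Pg by (auto simp: eventually_nhds_metric)
  show "\<exists>d>0. \<forall>t. norm (t - (0::real)) < d \<longrightarrow> norm (v t - v 0 - w * (t - 0)) \<le> e * norm (t - 0)"
  proof (intro exI[of _ "min d2 \<eta>0"] conjI allI impI)
    show "min d2 \<eta>0 > 0" using d2 \<eta>0 by simp
    fix t :: real assume "norm (t - 0) < min d2 \<eta>0"
    then have t: "\<bar>t\<bar> < d2" "\<bar>t\<bar> < \<eta>0" by auto
    have b: "norm ((V \<delta> t - w * t) - (V \<delta> 0 - w * 0)) \<le> e * norm (t - 0)" if \<delta>: "0 < \<delta>" "\<delta> < min d1 \<eta>0" for \<delta>
    proof (rule field_differentiable_bound[where S="closed_segment 0 t" and f'="\<lambda>t. V' \<delta> t - w"])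
      fix z assume z: "z \<in> closed_segment 0 t"
      have zt: "\<bar>z\<bar> \<le> \<bar>t\<bar>" using z by (auto simp: closed_segment_eq_real_ivl split: if_splits)
      have "(V \<delta> has_real_derivative V' \<delta> z) (at z)" using \<delta> zt t by (intro der) auto
      then have "((\<lambda>t. V \<delta> t - w * t) has_real_derivative V' \<delta> z - w) (at z)"
        by (auto intro!: derivative_eq_intros)
      then show "((\<lambda>t. V \<delta> t - w * t) has_real_derivative V' \<delta> z - w) (at z within closed_segment 0 t)"
        by (rule has_field_derivative_at_within)
      have "dist (V' \<delta> z) w < e" using \<delta> zt t by (intro P d1 d2) auto
      then show "norm (V' \<delta> z - w) \<le> e" by (simp add: dist_real_def)
    qed auto
    have "((\<lambda>\<delta>. norm ((V \<delta> t - w * t) - (V \<delta> 0 - w * 0))) \<longlongrightarrow> norm ((v t - w * t) - (v 0 - w * 0))) (at_right 0)"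
      using t \<eta>0 by (intro tendsto_intros lim) auto
    then have "norm ((v t - w * t) - (v 0 - w * 0)) \<le> e * norm (t - 0)"
    proof (rule tendsto_upperbound)
      have "\<forall>\<^sub>F \<delta> in at_right 0. \<delta> \<in> {0<..<min d1 \<eta>0}" by (rule eventually_at_right_real) (use d1 \<eta>0 in auto)
      then show "\<forall>\<^sub>F \<delta> in at_right 0. norm ((V \<delta> t - w * t) - (V \<delta> 0 - w * 0)) \<le> e * norm (t - 0)"
        by eventually_elim (use b in auto)
    qed simp
    then show "norm (v t - v 0 - w * (t - 0)) \<le> e * norm (t - 0)" by (simp add: algebra_simps)
  qed
qed

lemma Ck_on_2I:
  fixes f :: "real^'n \<Rightarrow> real"
  assumes S: "open S" and f: "continuous_on S f" and D: "\<And>i. continuous_on S (D i)" and E: "\<And>i j. continuous_on S (E j i)"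
    and der: "\<And>x i. x \<in> S \<Longrightarrow> ((\<lambda>t. f (x + t *\<^sub>R axis i 1)) has_real_derivative D i x) (at 0)"
    and der2: "\<And>x i j. x \<in> S \<Longrightarrow> ((\<lambda>t. D i (x + t *\<^sub>R axis j 1)) has_real_derivative E j i x) (at 0)"
  shows "Ck_on 2 f S" "\<And>x i. x \<in> S \<Longrightarrow> partial i f x = D i x"
proof -
  show 1: "partial i f x = D i x" if "x \<in> S" for x i
    unfolding partial_def by (rule DERIV_imp_deriv[OF der[OF that]])
  have 2: "partial j (partial i f) x = E j i x" if "x \<in> S" for x i j
  proof -
    have "partial j (partial i f) x = partial j (D i) x" by (rule partial_cong_open[OF S that 1])
    also have "\<dots> = E j i x" unfolding partial_def by (rule DERIV_imp_deriv[OF der2[OF that]])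
    finally show ?thesis .
  qed
  have c1: "continuous_on S (partial i f)" for i by (rule continuous_on_eq[OF D]) (simp add: 1)
  have c2: "continuous_on S (partial j (partial i f))" for i j by (rule continuous_on_eq[OF E]) (simp add: 2)
  have d2: "(\<lambda>t. partial i f (x + t *\<^sub>R axis j 1)) differentiable (at 0)" if "x \<in> S" for x i j
  proof -
    have "\<forall>\<^sub>F t in nhds 0. partial i f (x + t *\<^sub>R axis j 1) = D i (x + t *\<^sub>R axis j 1)"
      using eventually_line_in_open[OF S that, of "axis j 1"] by eventually_elim (rule 1)
    then have "((\<lambda>t. partial i f (x + t *\<^sub>R axis j 1)) has_real_derivative E j i x) (at 0)"
      using der2[OF that] by (subst DERIV_cong_ev[OF refl _ refl]) auto
    then show ?thesis using real_differentiable_def by blast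
  qed
  show "Ck_on 2 f S"
    unfolding Ck_on_def
  proof (intro conjI allI impI)
    fix "is" :: "'n list" assume "length is \<le> 2"
    then consider "is = []" | i where "is = [i]" | i j where "is = [j, i]"
      by (cases "is" rule: list.exhaust; cases "tl is" rule: list.exhaust; auto simp: le_Suc_eq numeral_2_eq_2)
    then show "continuous_on S (Dp is f)" by cases (simp_all add: f c1 c2)
  next
    fix "is" :: "'n list" and i x assume a: "length is < 2 \<and> x \<in> S"
    then consider "is = []" | i where "is = [i]"
      by (cases "is" rule: list.exhaust; cases "tl is" rule: list.exhaust; auto)
    then show "(\<lambda>t. Dp is f (x + t *\<^sub>R axis i 1)) differentiable (at 0)"
    proof cases
      case 1
      have "((\<lambda>t. f (x + t *\<^sub>R axis i 1)) has_real_derivative D i x) (at 0)" using der a by blast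
      then show ?thesis using 1 real_differentiable_def by auto
    qed (use d2 a in simp)
  qed
qed

text \<open>The slope of the graph is written through \<open>U\<close> instead of the gradient of a
  C^1 defining function. The two vectors are parallel on the boundary, so the quotient is the same,
  but \<open>U\<close> has a derivative that extends continuously to the boundary; this is the step
  from C^1 to C^2.\<close>

locale graph_boundary =
  fixes \<Omega> :: "(real^'n) set" and U :: "real^'n \<Rightarrow> real^'n" and Hb :: "real^'n \<Rightarrow> real^'n^'n"
    and q :: "real^'n" and k :: 'n and a b s :: real and \<gamma> :: "real^'n \<Rightarrow> real"
  assumes ab: "a > 0" "b > 0" and s: "s = 1 \<or> s = -1" and \<gamma>q: "\<gamma> q = q $ k"
    and bound: "\<And>x. norm (put k x (q $ k) - q) < a \<Longrightarrow> \<bar>\<gamma> x - q $ k\<bar> < b"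
    and region: "\<And>x y. norm (put k x (q $ k) - q) < a \<Longrightarrow> \<bar>y - q $ k\<bar> \<le> b \<Longrightarrow> put k x y \<in> \<Omega> \<longleftrightarrow> s * (y - \<gamma> x) < 0"
    and front: "\<And>x. norm (put k x (q $ k) - q) < a \<Longrightarrow> put k x (\<gamma> x) \<in> frontier \<Omega>"
    and Uk: "\<And>x. norm (put k x (q $ k) - q) < a \<Longrightarrow> U (put k x (\<gamma> x)) $ k \<noteq> 0"
    and \<gamma>der: "\<And>x. norm (put k x (q $ k) - q) < a \<Longrightarrow>
       (\<gamma> has_derivative (\<lambda>h. h $ k - (U (put k x (\<gamma> x)) \<bullet> h) / U (put k x (\<gamma> x)) $ k)) (at x)"
    and Ucont: "continuous_on (closure \<Omega>) U" and Hcont: "continuous_on (closure \<Omega>) Hb"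
    and Uder: "\<And>x. x \<in> \<Omega> \<Longrightarrow> (U has_derivative (\<lambda>h. Hb x *v h)) (at x)"
begin

definition "cyl = {x. norm (put k x (q $ k) - q) < a}"
definition "G x = put k x (\<gamma> x)"
definition "R x = U (G x)"
text \<open>The derivative of \<open>G\<close> along \<open>v\<close>: \<open>v\<close> is corrected
  along axis \<open>k\<close> so as to become orthogonal to \<open>R x\<close>, that is, tangent to
  the boundary at \<open>G x\<close>.\<close>

definition "T v x = v - ((R x \<bullet> v) / R x $ k) *\<^sub>R axis k 1"

lemma open_cyl: "open cyl" unfolding cyl_def by (rule open_cylinder)
lemma q_cyl: "q \<in> cyl" using ab by (simp add: cyl_def put_self)
lemma Gq: "G q = q" by (simp add: G_def \<gamma>q put_self)
lemma Rk: "x \<in> cyl \<Longrightarrow> R x $ k \<noteq> 0" using Uk by (simp add: cyl_def R_def G_def)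
lemma G_front: "x \<in> cyl \<Longrightarrow> G x \<in> frontier \<Omega>" using front by (simp add: cyl_def G_def)
lemma G_closure: "x \<in> cyl \<Longrightarrow> G x \<in> closure \<Omega>" using G_front by (auto simp: frontier_def)

lemma \<gamma>_der: "x \<in> cyl \<Longrightarrow> (\<gamma> has_derivative (\<lambda>h. h $ k - (R x \<bullet> h) / R x $ k)) (at x)"
  using \<gamma>der by (simp add: cyl_def R_def G_def)

lemma G_der: "x \<in> cyl \<Longrightarrow> (G has_derivative (\<lambda>h. T h x)) (at x)"
proof -
  assume x: "x \<in> cyl"
  have "(G has_derivative (\<lambda>h. h + ((h $ k - (R x \<bullet> h) / R x $ k) - h $ k) *\<^sub>R axis k 1)) (at x)"
    unfolding G_def put_def
    by (intro has_derivative_add has_derivative_ident has_derivative_scaleR_left has_derivative_diff \<gamma>_der[OF x]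
        bounded_linear_imp_has_derivative bounded_linear_vec_nth)
  then show ?thesis by (rule has_derivative_eq_rhs) (auto simp: T_def)
qed

lemma G_isCont: "x \<in> cyl \<Longrightarrow> isCont G x"
  using G_der has_derivative_continuous by blast

lemma G_continuous: "continuous_on cyl G"
  using G_isCont by (simp add: continuous_at_imp_continuous_on)

lemma R_continuous: "continuous_on cyl R"
  unfolding R_def by (rule continuous_on_compose2[OF Ucont G_continuous]) (use G_closure in auto)

lemma HG_continuous: "continuous_on cyl (\<lambda>x. Hb (G x))"
  by (rule continuous_on_compose2[OF Hcont G_continuous]) (use G_closure in auto)

lemma T_continuous: "continuous_on cyl (T v)"
  unfolding T_def using Rk by (intro continuous_intros R_continuous) auto

text \<open>The curve \<open>G (x + t v)\<close> lies in the boundary; it is approximated by its vertical translates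
  into \<open>\<Omega>\<close>, along which the chain rule applies.\<close>
lemma R_der:
  assumes x: "x \<in> cyl"
  shows "((\<lambda>t. R (x + t *\<^sub>R v) $ i) has_real_derivative (Hb (G x) *v T v x) $ i) (at 0)"
proof -
  \<comment> \<open>Half of the room left in the cylinder: one half for the variation of
    \<open>\<gamma>\<close> near \<open>x\<close>, one for the shift
    \<open>\<delta>\<close>.\<close>
  define m where "m = (b - \<bar>\<gamma> x - q $ k\<bar>) / 2"
  have m: "m > 0" using bound[of x] x by (simp add: m_def cyl_def)
  define S where "S = cyl \<inter> \<gamma> -` ball (\<gamma> x) m"
  have "continuous_on cyl \<gamma>"
    using \<gamma>_der by (intro continuous_at_imp_continuous_on) (blast intro: has_derivative_continuous)
  then have "open S" unfolding S_def using open_cyl by (intro continuous_open_preimage) auto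
  moreover have "x \<in> S" using x m by (simp add: S_def)
  ultimately have evS: "\<forall>\<^sub>F t in nhds 0. x + t *\<^sub>R v \<in> S" by (rule eventually_line_in_open)
  then obtain \<eta>1 where \<eta>1: "\<eta>1 > 0" "\<And>t. \<bar>t\<bar> < \<eta>1 \<Longrightarrow> x + t *\<^sub>R v \<in> S" by (auto simp: eventually_nhds_metric)
  define \<eta>0 where "\<eta>0 = min \<eta>1 m"
  have \<eta>0: "\<eta>0 > 0" using \<eta>1 m by (simp add: \<eta>0_def)
  define sh where "sh \<delta> y = G y - (s * \<delta>) *\<^sub>R axis k 1" for \<delta> y
  have shO: "sh \<delta> y \<in> \<Omega>" if "y \<in> S" "0 < \<delta>" "\<delta> < m" for \<delta> y
  proof -
    have y: "y \<in> cyl" "\<bar>\<gamma> y - \<gamma> x\<bar> < m" using that(1) by (auto simp: S_def dist_real_def)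
    have "sh \<delta> y = put k y (\<gamma> y - s * \<delta>)" by (simp add: sh_def G_def put_def algebra_simps)
    moreover have "\<bar>\<gamma> y - s * \<delta> - q $ k\<bar> \<le> b"
    proof -
      have "s * \<delta> \<le> \<delta>" "- \<delta> \<le> s * \<delta>" using s that by auto
      moreover have "b = 2 * m + \<bar>\<gamma> x - q $ k\<bar>" by (simp add: m_def field_simps)
      ultimately show ?thesis
        using y(2) that(3) abs_ge_self[of "\<gamma> x - q $ k"] abs_ge_minus_self[of "\<gamma> x - q $ k"]
        unfolding abs_le_iff abs_less_iff by linarith
    qed
    moreover have "s * ((\<gamma> y - s * \<delta>) - \<gamma> y) < 0" using s that by auto
    ultimately show ?thesis using region[of y "\<gamma> y - s * \<delta>"] y(1) by (simp add: cyl_def)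
  qed
  show ?thesis
  proof (rule has_derivative_limit[where V="\<lambda>\<delta> t. U (sh \<delta> (x + t *\<^sub>R v)) $ i" and V'="\<lambda>\<delta> t. (Hb (sh \<delta> (x + t *\<^sub>R v)) *v T v (x + t *\<^sub>R v)) $ i", OF \<eta>0])
    fix \<delta> t :: real assume \<delta>: "0 < \<delta>" "\<delta> < \<eta>0" and t: "\<bar>t\<bar> < \<eta>0"
    let ?y = "x + t *\<^sub>R v"
    have y: "?y \<in> S" using \<eta>1(2)[of t] t by (simp add: \<eta>0_def)
    then have yc: "?y \<in> cyl" by (simp add: S_def)
    have O: "sh \<delta> ?y \<in> \<Omega>" using shO[OF y] \<delta> by (simp add: \<eta>0_def)
    have "(sh \<delta> has_derivative (\<lambda>h. T h ?y - 0)) (at ?y)"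
      unfolding sh_def by (intro has_derivative_diff G_der[OF yc] has_derivative_const)
    then have "(sh \<delta> has_derivative (\<lambda>h. T h ?y)) (at ?y)" by simp
    from has_derivative_compose[OF this Uder[OF O]]
    have "((\<lambda>y. U (sh \<delta> y)) has_derivative (\<lambda>h. Hb (sh \<delta> ?y) *v T h ?y)) (at ?y)" .
    from bounded_linear.has_derivative[OF bounded_linear_vec_nth this, of i]
    have "((\<lambda>y. U (sh \<delta> y) $ i) has_derivative (\<lambda>h. (Hb (sh \<delta> ?y) *v T h ?y) $ i)) (at ?y)" .
    from has_derivative_direction[OF this, of v]
    show "((\<lambda>t. U (sh \<delta> (x + t *\<^sub>R v)) $ i) has_real_derivative (Hb (sh \<delta> ?y) *v T v ?y) $ i) (at t)"
      by (rule has_real_derivative_along_axis[where f="\<lambda>y. U (sh \<delta> y) $ i"])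
  next
    fix t :: real assume t: "\<bar>t\<bar> < \<eta>0"
    let ?y = "x + t *\<^sub>R v"
    have y: "?y \<in> S" using \<eta>1(2)[of t] t by (simp add: \<eta>0_def)
    then have yc: "?y \<in> cyl" by (simp add: S_def)
    have "((\<lambda>\<delta>. sh \<delta> ?y) \<longlongrightarrow> G ?y) (at_right 0)" unfolding sh_def by (rule tendsto_eq_intros | simp)+
    moreover have "\<forall>\<^sub>F \<delta> in at_right 0. \<delta> \<in> {0<..<m}" by (rule eventually_at_right_real[OF m])
    then have "\<forall>\<^sub>F \<delta> in at_right 0. sh \<delta> ?y \<in> closure \<Omega>"
      by eventually_elim (use shO[OF y] closure_subset in auto)
    ultimately have "((\<lambda>\<delta>. U (sh \<delta> ?y)) \<longlongrightarrow> U (G ?y)) (at_right 0)"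
      using continuous_on_tendsto_compose[OF Ucont _ G_closure[OF yc]] by blast
    then show "((\<lambda>\<delta>. U (sh \<delta> ?y) $ i) \<longlongrightarrow> R ?y $ i) (at_right 0)"
      unfolding R_def by (rule tendsto_vec_nth)
  next
    let ?F = "at_right (0::real) \<times>\<^sub>F nhds (0::real)"
    have f: "(fst \<longlongrightarrow> 0) ?F"
      using filterlim_fst[of "at_right (0::real)" "nhds (0::real)"] by (simp add: filterlim_at)
    have sn: "(snd \<longlongrightarrow> 0) ?F" by (rule filterlim_snd)
    have l: "((\<lambda>z. x + snd z *\<^sub>R v) \<longlongrightarrow> x) ?F" by (rule tendsto_eq_intros sn | simp)+
    have lG: "((\<lambda>z. G (x + snd z *\<^sub>R v)) \<longlongrightarrow> G x) ?F" by (rule isCont_tendsto_compose[OF G_isCont[OF x] l])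
    have lsh: "((\<lambda>z. sh (fst z) (x + snd z *\<^sub>R v)) \<longlongrightarrow> G x) ?F"
      unfolding sh_def by (rule tendsto_eq_intros lG f | simp)+
    have "\<forall>\<^sub>F \<delta> in at_right 0. \<delta> \<in> {0<..<m}" by (rule eventually_at_right_real[OF m])
    from eventually_prodI[OF this evS] have "\<forall>\<^sub>F z in ?F. sh (fst z) (x + snd z *\<^sub>R v) \<in> closure \<Omega>"
      by (rule eventually_mono) (use shO closure_subset in auto)
    then have lH: "((\<lambda>z. Hb (sh (fst z) (x + snd z *\<^sub>R v))) \<longlongrightarrow> Hb (G x)) ?F"
      by (rule continuous_on_tendsto_compose[OF Hcont lsh G_closure[OF x]])
    have "isCont (T v) x" using T_continuous open_cyl x by (simp add: continuous_on_eq_continuous_at)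
    then have lT: "((\<lambda>z. T v (x + snd z *\<^sub>R v)) \<longlongrightarrow> T v x) ?F" by (rule isCont_tendsto_compose[OF _ l])
    show "((\<lambda>z. (Hb (sh (fst z) (x + snd z *\<^sub>R v)) *v T v (x + snd z *\<^sub>R v)) $ i) \<longlongrightarrow> (Hb (G x) *v T v x) $ i) ?F"
      by (intro tendsto_vec_nth bounded_bilinear.tendsto[OF bounded_bilinear_matrix_vector_mult lH lT])
  qed
qed

text \<open>The signed height over the graph serves as defining function. Its partial derivatives
  are quotients of components of \<open>R\<close>, and \<open>R_der\<close> differentiates these
  once more, with continuous result.\<close>

lemma local_defining_2: "\<exists>r \<phi>. local_defining 2 \<Omega> q r \<phi>"
proof (intro exI)
  define r where "r = min a b"
  define \<phi> where "\<phi> x = s * (x $ k - \<gamma> x)" for x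
  have r: "r > 0" using ab by (simp add: r_def)
  have cyl: "x \<in> cyl" if "x \<in> ball q r" for x
    using that norm_put_le[of k x q] by (simp add: cyl_def r_def dist_norm norm_minus_commute)
  have der: "(\<phi> has_derivative (\<lambda>h. s * ((R x \<bullet> h) / R x $ k))) (at x)" if "x \<in> cyl" for x
  proof -
    have "(\<phi> has_derivative (\<lambda>h. s * (h $ k - (h $ k - (R x \<bullet> h) / R x $ k)))) (at x)"
      unfolding \<phi>_def
      by (intro has_derivative_mult_right has_derivative_diff \<gamma>_der[OF that] bounded_linear_imp_has_derivative bounded_linear_vec_nth)
    then show ?thesis by simp
  qed
  define D where "D i x = s * (R x $ i / R x $ k)" for i x
  define \<rho> where "\<rho> j i x = (Hb (G x) *v T (axis j 1) x) $ i" for j i x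
  define E where "E j i x = s * ((\<rho> j i x * R x $ k - R x $ i * \<rho> j k x) / (R x $ k * R x $ k))" for j i x
  have sub: "ball q r \<subseteq> cyl" using cyl by blast
  have c\<rho>: "continuous_on (ball q r) (\<rho> j i)" for i j
    unfolding \<rho>_def
    by (intro continuous_on_component bounded_bilinear.continuous_on[OF bounded_bilinear_matrix_vector_mult]
        continuous_on_subset[OF HG_continuous sub] continuous_on_subset[OF T_continuous sub])
  have cR: "continuous_on (ball q r) R" by (rule continuous_on_subset[OF R_continuous sub])
  have c\<phi>: "continuous_on (ball q r) \<phi>"
    using der cyl by (intro continuous_at_imp_continuous_on) (blast intro: has_derivative_continuous)
  have cD: "continuous_on (ball q r) (D i)" for i
    unfolding D_def using Rk cyl by (intro continuous_intros cR) auto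
  have cE: "continuous_on (ball q r) (E j i)" for i j
    unfolding E_def using Rk cyl by (intro continuous_intros cR c\<rho>) auto
  have d1: "((\<lambda>t. \<phi> (x + t *\<^sub>R axis i 1)) has_real_derivative D i x) (at 0)" if "x \<in> ball q r" for x i
    using has_derivative_direction[OF der[OF cyl[OF that]], of "axis i 1"] by (simp add: D_def inner_axis)
  have d2: "((\<lambda>t. D i (x + t *\<^sub>R axis j 1)) has_real_derivative E j i x) (at 0)" if "x \<in> ball q r" for x i j
  proof -
    have R0: "R (x + 0 *\<^sub>R axis j 1) $ k \<noteq> 0" using Rk[OF cyl[OF that]] by simp
    show ?thesis unfolding D_def E_def \<rho>_def
      using DERIV_cmult[OF DERIV_divide[OF R_der[OF cyl[OF that], of "axis j 1" i] R_der[OF cyl[OF that], of "axis j 1" k] R0], of s] by simp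
  qed
  have Ck: "Ck_on 2 \<phi> (ball q r)"
    by (rule Ck_on_2I(1)[OF open_ball c\<phi> cD cE]) (erule d1, erule d2)
  have par: "partial i \<phi> x = D i x" if "x \<in> ball q r" for x i
    by (rule Ck_on_2I(2)[OF open_ball c\<phi> cD cE _ _ that]) (erule d1, erule d2)
  have "grad \<phi> x \<noteq> 0" if "x \<in> ball q r" for x
  proof -
    have "grad \<phi> x $ k = s" using par[OF that, of k] Rk[OF cyl[OF that]] by (simp add: grad_def D_def)
    then show ?thesis using s by auto
  qed
  moreover have "\<Omega> \<inter> ball q r = {x \<in> ball q r. \<phi> x < 0}"
  proof -
    have "x \<in> \<Omega> \<longleftrightarrow> \<phi> x < 0" if "x \<in> ball q r" for x
    proof -
      have "\<bar>x $ k - q $ k\<bar> \<le> norm (x - q)" using component_le_norm_cart[of "x - q" k] by simp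
      then have "\<bar>x $ k - q $ k\<bar> \<le> b" using that by (simp add: r_def dist_norm norm_minus_commute)
      then show ?thesis using region[of x "x $ k"] cyl[OF that] by (simp add: put_self \<phi>_def cyl_def)
    qed
    then show ?thesis by blast
  qed
  ultimately show "local_defining 2 \<Omega> q r \<phi>" unfolding local_defining_def using r Ck by blast
qed

text \<open>\<open>U\<close> and \<open>- \<kappa> *\<^sub>R \<nu>\<close> agree on the boundary,
  hence so do their tangential derivatives, whatever the extension \<open>\<nu>\<close> off the
  boundary. Summed over tangential directions, this identifies the tangential trace of
  \<open>Hb q\<close> with -\<kappa> times the divergence of \<open>\<nu>\<close>, to which the
  normal direction adds nothing by \<open>orth\<close>.\<close>

lemma divg_normal_neg:
  assumes N: "(\<nu> has_derivative N) (at q)" and orth: "\<And>h. \<nu> q \<bullet> N h = 0" and \<nu>\<nu>: "\<nu> q \<bullet> \<nu> q = 1"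
    and RN: "\<And>x. x \<in> cyl \<Longrightarrow> R x = - \<kappa> *\<^sub>R \<nu> (G x)" and kappa: "\<kappa> > 0"
    and tr: "trace (Hb q) - ((Hb q *v U q) \<bullet> U q) / \<kappa>\<^sup>2 > 0"
  shows "divg \<nu> q < 0"
proof -
  define g where "g = U q"
  have linN: "linear N" using N by (rule has_derivative_linear)
  have Rq: "R q = g" by (simp add: R_def Gq g_def)
  have g\<nu>: "g = - \<kappa> *\<^sub>R \<nu> q" using RN[OF q_cyl] by (simp add: Rq Gq)
  have gg: "g \<bullet> g = \<kappa>\<^sup>2" using \<nu>\<nu> by (simp add: g\<nu> power2_eq_square)
  have g0: "g \<noteq> 0" using gg kappa by auto
  have tang: "Hb q *v v = - \<kappa> *\<^sub>R N v" if v: "g \<bullet> v = 0" for v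
  proof -
    have Tv: "T v q = v" using v by (simp add: T_def Rq)
    have "(Hb q *v v) $ i = (- \<kappa> *\<^sub>R N v) $ i" for i
    proof (rule DERIV_unique)
      show "((\<lambda>t. R (q + t *\<^sub>R v) $ i) has_real_derivative (Hb q *v v) $ i) (at 0)"
        using R_der[OF q_cyl, of v i] by (simp add: Gq Tv)
      have "(\<nu> has_derivative N) (at (G q))" using N by (simp add: Gq)
      from has_derivative_compose[OF G_der[OF q_cyl] this]
      have "((\<lambda>x. \<nu> (G x)) has_derivative (\<lambda>h. N (T h q))) (at q)" .
      from has_derivative_scaleR_right[OF this, of "- \<kappa>"]
      have "((\<lambda>x. - \<kappa> *\<^sub>R \<nu> (G x)) has_derivative (\<lambda>h. - \<kappa> *\<^sub>R N (T h q))) (at q)" .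
      from bounded_linear.has_derivative[OF bounded_linear_vec_nth this, of i]
      have "((\<lambda>x. (- \<kappa> *\<^sub>R \<nu> (G x)) $ i) has_derivative (\<lambda>h. (- \<kappa> *\<^sub>R N (T h q)) $ i)) (at q)" .
      from has_derivative_direction[OF this, of v]
      have d: "((\<lambda>t. (- \<kappa> *\<^sub>R \<nu> (G (q + t *\<^sub>R v))) $ i) has_real_derivative (- \<kappa> *\<^sub>R N v) $ i) (at 0)" by (simp only: Tv)
      have "\<forall>\<^sub>F t in nhds 0. R (q + t *\<^sub>R v) $ i = (- \<kappa> *\<^sub>R \<nu> (G (q + t *\<^sub>R v))) $ i"
        using eventually_line_in_open[OF open_cyl q_cyl, of v] by eventually_elim (simp only: RN)
      then show "((\<lambda>t. R (q + t *\<^sub>R v) $ i) has_real_derivative (- \<kappa> *\<^sub>R N v) $ i) (at 0)"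
        using d by (subst DERIV_cong_ev[OF refl _ refl])
    qed
    then show ?thesis by (simp add: vec_eq_iff)
  qed
  \<comment> \<open>The axes projected onto the tangent space. With p = 2 the operator
    \<open>ell\<close> is the plain trace, so \<open>ell_decomp\<close> treats the divergence and
    the trace of \<open>Hb q\<close> alike.\<close>
  define e where "e i = axis i 1 - (g $ i / (g \<bullet> g)) *\<^sub>R g" for i
  have ge: "g \<bullet> e i = 0" for i using g0 by (simp add: e_def inner_diff_right inner_axis)
  have "divg \<nu> q = (\<Sum>i\<in>UNIV. N (axis i 1) $ i)"
    unfolding divg_def by (intro sum.cong refl partial_eqI bounded_linear.has_derivative[OF bounded_linear_vec_nth N])
  also have "\<dots> = ell 2 g N" by (simp add: ell_def)
  also have "\<dots> = (\<Sum>i\<in>UNIV. e i \<bullet> N (e i)) + (2 - 1) * (g \<bullet> N g) / (g \<bullet> g)"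
    unfolding e_def by (rule ell_decomp[OF linN g0])
  also have "g \<bullet> N g = 0" using orth by (simp add: g\<nu>)
  finally have d1: "divg \<nu> q = (\<Sum>i\<in>UNIV. e i \<bullet> N (e i))" by simp
  have "trace (Hb q) = ell 2 g (\<lambda>h. Hb q *v h)"
    by (simp add: ell_def trace_def matrix_vector_mult_basis column_def)
  also have "\<dots> = (\<Sum>i\<in>UNIV. e i \<bullet> (Hb q *v e i)) + (2 - 1) * (g \<bullet> (Hb q *v g)) / (g \<bullet> g)"
    unfolding e_def by (rule ell_decomp[OF matrix_vector_mul_linear g0])
  finally have "(\<Sum>i\<in>UNIV. e i \<bullet> (Hb q *v e i)) > 0"
    using tr gg unfolding g_def by (simp add: inner_commute)
  also have "(\<Sum>i\<in>UNIV. e i \<bullet> (Hb q *v e i)) = - \<kappa> * divg \<nu> q"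
    unfolding d1 tang[OF ge] by (simp add: sum_distrib_left)
  finally show ?thesis using kappa by (simp add: mult_less_0_iff)
qed

end

text \<open>Unit length near \<open>q\<close>, differentiated, makes the derivative of the normal
  orthogonal to the normal.\<close>

lemma unit_normal_derivative:
  fixes \<phi> :: "real^'n \<Rightarrow> real"
  assumes ld: "local_defining 2 \<Omega> q r \<phi>"
  defines "\<nu> \<equiv> \<lambda>x. (1 / norm (grad \<phi> x)) *\<^sub>R grad \<phi> x"
  shows "\<exists>N. (\<nu> has_derivative N) (at q) \<and> (\<forall>h. \<nu> q \<bullet> N h = 0)" "\<nu> q \<bullet> \<nu> q = 1"
proof -
  have r: "r > 0" and Ck: "Ck_on 2 \<phi> (ball q r)" and n0: "\<And>x. x \<in> ball q r \<Longrightarrow> grad \<phi> x \<noteq> 0"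
    using ld by (auto simp: local_defining_def)
  have qb: "q \<in> ball q r" using r by simp
  have unit: "\<nu> x \<bullet> \<nu> x = 1" if "x \<in> ball q r" for x
    using n0[OF that] by (simp add: \<nu>_def dot_square_norm power2_eq_square)
  show "\<nu> q \<bullet> \<nu> q = 1" by (rule unit[OF qb])
  \<comment> \<open>The squared norm: its power -1/2 is the reciprocal norm in a form to which the
    rule for \<open>powr\<close> applies.\<close>
  define V where "V x = grad \<phi> x \<bullet> grad \<phi> x" for x
  have g: "(grad \<phi> has_derivative (\<lambda>h. hess \<phi> q *v h)) (at q)"
    by (rule Ck_on_has_derivative_hess[OF Ck _ _ qb]) auto
  obtain V' where V': "(V has_derivative V') (at q)" unfolding V_def using has_derivative_inner[OF g g] by blast
  have "V q > 0" using n0[OF qb] by (simp add: V_def)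
  from has_derivative_scaleR[OF has_derivative_compose[OF V' has_real_derivative_powr[OF this, of "-1/2", unfolded has_field_derivative_def]] g]
  obtain N where N: "((\<lambda>x. V x powr (-1/2) *\<^sub>R grad \<phi> x) has_derivative N) (at q)" by blast
  have "V x powr (-1/2) *\<^sub>R grad \<phi> x = \<nu> x" if "x \<in> ball q r" for x
  proof -
    have "V x powr (-1/2) = 1 / sqrt (V x)"
      using n0[OF that] by (simp add: V_def powr_minus_divide powr_half_sqrt)
    then show ?thesis by (simp add: \<nu>_def V_def norm_eq_sqrt_inner)
  qed
  then have N\<nu>: "(\<nu> has_derivative N) (at q)"
    using has_derivative_transform_within_open[OF N open_ball qb] by blast
  have "((\<lambda>x. \<nu> x \<bullet> \<nu> x) has_derivative (\<lambda>h. \<nu> q \<bullet> N h + N h \<bullet> \<nu> q)) (at q)"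
    by (rule has_derivative_inner[OF N\<nu> N\<nu>])
  moreover have "((\<lambda>x. \<nu> x \<bullet> \<nu> x) has_derivative (\<lambda>h. 0)) (at q)"
    by (rule has_derivative_transform_within_open[OF has_derivative_const[of 1] open_ball qb]) (simp add: unit)
  ultimately have "(\<lambda>h. \<nu> q \<bullet> N h + N h \<bullet> \<nu> q) = (\<lambda>h. 0)" by (rule has_derivative_unique)
  then have "\<nu> q \<bullet> N h + N h \<bullet> \<nu> q = 0" for h by meson
  then have "\<forall>h. \<nu> q \<bullet> N h = 0" by (simp add: inner_commute)
  then show "\<exists>N. (\<nu> has_derivative N) (at q) \<and> (\<forall>h. \<nu> q \<bullet> N h = 0)" using N\<nu> by blast
qed

text \<open>The one function \<open>\<phi>\<close> is a defining function at all nearby boundary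
  points too, so \<open>UN\<close> holds along the whole graph and permits the exchange of its
  gradient for \<open>U\<close> in the slope.\<close>

lemma graph_boundary_exists:
  fixes \<Omega> :: "(real^'n) set"
  assumes op: "open \<Omega>" and q: "q \<in> frontier \<Omega>" and ld: "local_defining 1 \<Omega> q r \<phi>" and kappa: "\<kappa> > 0"
    and UN: "\<And>z r \<phi>. z \<in> frontier \<Omega> \<Longrightarrow> local_defining 1 \<Omega> z r \<phi> \<Longrightarrow> U z = - \<kappa> *\<^sub>R ((1 / norm (grad \<phi> z)) *\<^sub>R grad \<phi> z)"
    and U: "continuous_on (closure \<Omega>) U" "continuous_on (closure \<Omega>) Hb"
      "\<And>x. x \<in> \<Omega> \<Longrightarrow> (U has_derivative (\<lambda>h. Hb x *v h)) (at x)"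
  shows "\<exists>k a b s \<gamma>. graph_boundary \<Omega> U Hb q k a b s \<gamma> \<and>
     (\<forall>x. norm (put k x (q $ k) - q) < a \<longrightarrow> U (put k x (\<gamma> x)) = - \<kappa> *\<^sub>R ((1 / norm (grad \<phi> (put k x (\<gamma> x)))) *\<^sub>R grad \<phi> (put k x (\<gamma> x))))"
proof -
  have r: "r > 0" and "grad \<phi> q \<noteq> 0" using ld by (auto simp: local_defining_def)
  then obtain k where k: "grad \<phi> q $ k \<noteq> 0" by (auto simp: vec_eq_iff)
  obtain a b \<gamma> s where gr: "a > 0" "b > 0" "s = 1 \<or> s = -1" "\<gamma> q = q $ k"
    "\<And>x y. \<gamma> (put k x y) = \<gamma> x"
    "\<And>x. norm (put k x (q $ k) - q) < a \<Longrightarrow> \<bar>\<gamma> x - q $ k\<bar> < b"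
    "\<And>x y. norm (put k x (q $ k) - q) < a \<Longrightarrow> \<bar>y - q $ k\<bar> \<le> b \<Longrightarrow>
        put k x y \<in> ball q r \<and> grad \<phi> (put k x y) $ k \<noteq> 0 \<and> (put k x y \<in> \<Omega> \<longleftrightarrow> s * (y - \<gamma> x) < 0)"
    "\<And>x. norm (put k x (q $ k) - q) < a \<Longrightarrow> put k x (\<gamma> x) \<in> frontier \<Omega>"
    "\<And>x. norm (put k x (q $ k) - q) < a \<Longrightarrow>
       (\<gamma> has_derivative (\<lambda>h. h $ k - (grad \<phi> (put k x (\<gamma> x)) \<bullet> h) / grad \<phi> (put k x (\<gamma> x)) $ k)) (at x)"
    by (rule boundary_graph[OF ld op q k]) blast
  have z: "put k x (\<gamma> x) \<in> ball q r" "grad \<phi> (put k x (\<gamma> x)) $ k \<noteq> 0" if "norm (put k x (q $ k) - q) < a" for x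
    using gr(7)[OF that, of "\<gamma> x"] gr(6)[OF that] by auto
  have Uz: "U (put k x (\<gamma> x)) = - \<kappa> *\<^sub>R ((1 / norm (grad \<phi> (put k x (\<gamma> x)))) *\<^sub>R grad \<phi> (put k x (\<gamma> x)))"
    if x: "norm (put k x (q $ k) - q) < a" for x
  proof -
    obtain r' where "local_defining 1 \<Omega> (put k x (\<gamma> x)) r' \<phi>"
      using local_defining_subball[OF ld z(1)[OF x]] by blast
    then show ?thesis by (rule UN[OF gr(8)[OF x]])
  qed
  have nz: "grad \<phi> (put k x (\<gamma> x)) \<noteq> 0" if "norm (put k x (q $ k) - q) < a" for x
    using z(2)[OF that] by auto
  have ratio: "(U (put k x (\<gamma> x)) \<bullet> h) / U (put k x (\<gamma> x)) $ k = (grad \<phi> (put k x (\<gamma> x)) \<bullet> h) / grad \<phi> (put k x (\<gamma> x)) $ k"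
    if "norm (put k x (q $ k) - q) < a" for x h
    unfolding Uz[OF that] using kappa nz[OF that] z(2)[OF that] by simp
  have "graph_boundary \<Omega> U Hb q k a b s \<gamma>"
  proof
    show "U (put k x (\<gamma> x)) $ k \<noteq> 0" if "norm (put k x (q $ k) - q) < a" for x
      unfolding Uz[OF that] using kappa nz[OF that] z(2)[OF that] by simp
    show "(\<gamma> has_derivative (\<lambda>h. h $ k - (U (put k x (\<gamma> x)) \<bullet> h) / U (put k x (\<gamma> x)) $ k)) (at x)"
      if "norm (put k x (q $ k) - q) < a" for x
      unfolding ratio[OF that] by (rule gr(9)[OF that])
    show "put k x y \<in> \<Omega> \<longleftrightarrow> s * (y - \<gamma> x) < 0" if "norm (put k x (q $ k) - q) < a" "\<bar>y - q $ k\<bar> \<le> b" for x y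
      using gr(7)[OF that] by blast
  qed (use gr U in auto)
  then show ?thesis using Uz by blast
qed

theorem theorem1p1:
  fixes \<Omega> :: "(real^'n) set" and u :: "real^'n \<Rightarrow> real"
    and f F :: "real \<Rightarrow> real" and p \<kappa> :: real
  assumes n2: "CARD('n) \<ge> 2"
    and p: "1 < p"
    and dom: "C1_domain \<Omega>"
    and f_C1: "\<forall>s. f differentiable (at s)" "continuous_on UNIV (deriv f)"
    and kappa: "\<kappa> > 0"
    and u_C3: "Ck_closure 3 u \<Omega>"
    and u_bdd: "bounded (u ` \<Omega>)"
    and eq: "p_laplace_eq p f u \<Omega>"
    and pos: "\<forall>x\<in>\<Omega>. u x > 0"
    and dir: "\<forall>q\<in>frontier \<Omega>. u q = 0"
    and neu: "\<forall>q\<in>frontier \<Omega>. \<forall>\<nu>. ext_normal \<Omega> q \<nu> \<longrightarrow> bgrad u \<Omega> q \<bullet> \<nu> = - \<kappa>"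
    and F_prim: "\<forall>s. (F has_real_derivative f s) (at s)"
    and F_C2: "\<forall>s. deriv F differentiable (at s)" "continuous_on UNIV (deriv (deriv F))"
    and F_nonpos: "\<forall>s. F s \<le> 0"
    and F0: "F 0 \<ge> - ((p - 1) / p) * \<kappa> powr p"
    and F_deg: "p > 2 \<Longrightarrow> \<forall>u0. F u0 = 0 \<longrightarrow> F \<in> O[at u0](\<lambda>s. \<bar>s - u0\<bar> powr p)"
  shows "parallel_sol \<Omega> u \<or>
         (\<forall>q\<in>frontier \<Omega>. (\<exists>H. mean_curv \<Omega> q H) \<and> (\<forall>H. mean_curv \<Omega> q H \<longrightarrow> H < 0))"
proof (cases "frontier \<Omega> = {}")
  case True
  \<comment> \<open>Without boundary the curvature alternative holds vacuously.\<close>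
  then show ?thesis by simp
next
  case False
  have op: "open \<Omega>" and conn: "connected \<Omega>" "\<Omega> \<noteq> {}"
    and ldex: "\<And>q. q \<in> frontier \<Omega> \<Longrightarrow> \<exists>r \<phi>. local_defining 1 \<Omega> q r \<phi>"
    using dom by (auto simp: C1_domain_def)
  have u3: "Ck_on 3 u \<Omega>" and uc: "continuous_on (closure \<Omega>) u"
    and ext: "\<And>is. length is \<le> 3 \<Longrightarrow> \<exists>g. continuous_on (closure \<Omega>) g \<and> (\<forall>x\<in>\<Omega>. g x = Dp is u x)"
    using u_C3 by (auto simp: Ck_closure_def)
  have "\<forall>is. \<exists>g. length is \<le> 3 \<longrightarrow> continuous_on (closure \<Omega>) g \<and> (\<forall>x\<in>\<Omega>. g x = Dp is u x)" using ext by blast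
  then obtain V where V: "\<And>is. length is \<le> 3 \<Longrightarrow> continuous_on (closure \<Omega>) (V is)"
    "\<And>is x. length is \<le> 3 \<Longrightarrow> x \<in> \<Omega> \<Longrightarrow> V is x = Dp is u x"
    using choice[of "\<lambda>is g. length is \<le> 3 \<longrightarrow> continuous_on (closure \<Omega>) g \<and> (\<forall>x\<in>\<Omega>. g x = Dp is u x)"] by blast
  \<comment> \<open>The extensions of order one feed the boundary condition, those of order two the
    curvature.\<close>
  define U where "U x = (\<chi> i. V [i] x)" for x
  define Hb where "Hb x = (\<chi> i j. V [j, i] x)" for x
  have Uc: "continuous_on (closure \<Omega>) U" unfolding U_def by (intro continuous_on_vec_lambda V(1)) simp
  have Hc: "continuous_on (closure \<Omega>) Hb" unfolding Hb_def by (intro continuous_on_vec_lambda V(1)) simp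
  have Ueq: "U x = grad u x" if "x \<in> \<Omega>" for x using V(2)[OF _ that] by (simp add: U_def vec_eq_iff grad_nth)
  have Heq: "Hb x = hess u x" if "x \<in> \<Omega>" for x using V(2)[OF _ that] by (simp add: Hb_def vec_eq_iff hess_def)
  have uder: "(u has_derivative (\<lambda>h. U x \<bullet> h)) (at x)" if "x \<in> \<Omega>" for x
    using Ck_on_has_derivative_grad[OF u3 op _ that] by (simp add: Ueq[OF that])
  have Uder: "(U has_derivative (\<lambda>h. Hb x *v h)) (at x)" if x: "x \<in> \<Omega>" for x
  proof -
    have "(grad u has_derivative (\<lambda>h. hess u x *v h)) (at x)" by (rule Ck_on_has_derivative_hess[OF u3 op _ x]) simp
    from has_derivative_transform_within_open[OF this op x, of U]
    show ?thesis using Ueq Heq[OF x] by simp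
  qed
  \<comment> \<open>\<open>bgrad\<close> is a limit from inside. It equals the extension because a
    frontier point lies in the closure but not in the open set itself, so the filter within
    \<open>\<Omega>\<close> is nontrivial.\<close>
  have bg: "bgrad u \<Omega> q = U q" if q: "q \<in> frontier \<Omega>" for q
  proof -
    have qc: "q \<in> closure \<Omega>" "q \<notin> \<Omega>" using q op by (auto simp: frontier_def interior_open)
    have nt: "at q within \<Omega> \<noteq> bot" using qc by (simp add: trivial_limit_within closure_def)
    have "Lim (at q within \<Omega>) (partial i u) = V [i] q" for i
    proof (rule tendsto_Lim[OF nt])
      have "(V [i] \<longlongrightarrow> V [i] q) (at q within closure \<Omega>)" using V(1)[of "[i]"] qc by (simp add: continuous_on_def)
      then have l: "(V [i] \<longlongrightarrow> V [i] q) (at q within \<Omega>)" by (rule tendsto_within_subset) (rule closure_subset)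
      have "\<forall>\<^sub>F x in at q within \<Omega>. V [i] x = partial i u x"
        using V(2)[of "[i]"] by (simp add: eventually_at_filter)
      then show "(partial i u \<longlongrightarrow> V [i] q) (at q within \<Omega>)" by (rule Lim_transform_eventually[OF l])
    qed
    then show ?thesis by (simp add: bgrad_def U_def)
  qed
  \<comment> \<open>Stated for every defining function at \<open>q\<close>: the graph needs it at
    neighbouring points, and the curvature for an arbitrary C^2 defining function.\<close>
  have UN: "U q = - \<kappa> *\<^sub>R ((1 / norm (grad \<phi> q)) *\<^sub>R grad \<phi> q)"
    if q: "q \<in> frontier \<Omega>" and ld: "local_defining 1 \<Omega> q r \<phi>" for q r \<phi>
  proof (rule boundary_gradient_normal[OF op q ld kappa Uc uder uc])
    show "u q = 0" using dir q by blast
    have "ext_normal \<Omega> q ((1 / norm (grad \<phi> q)) *\<^sub>R grad \<phi> q)" unfolding ext_normal_def using ld by blast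
    then show "U q \<bullet> ((1 / norm (grad \<phi> q)) *\<^sub>R grad \<phi> q) = - \<kappa>" using neu q bg[OF q] by metis
  qed (use pos in auto)
  have gex: "\<exists>k a b s \<gamma>. graph_boundary \<Omega> U Hb q k a b s \<gamma> \<and>
     (\<forall>x. norm (put k x (q $ k) - q) < a \<longrightarrow> U (put k x (\<gamma> x)) = - \<kappa> *\<^sub>R ((1 / norm (grad \<phi> (put k x (\<gamma> x)))) *\<^sub>R grad \<phi> (put k x (\<gamma> x))))"
    if "q \<in> frontier \<Omega>" "local_defining 1 \<Omega> q r \<phi>" for q r \<phi>
    by (rule graph_boundary_exists[OF op that kappa _ Uc Hc]) (rule UN, assumption, assumption, rule Uder, assumption)
  interpret overdet \<Omega> u f F p U \<kappa>
  proof
    fix q assume q: "q \<in> frontier \<Omega>"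
    then obtain r \<phi> where ld: "local_defining 1 \<Omega> q r \<phi>" using ldex by blast
    have "grad \<phi> q \<noteq> 0" using ld by (auto simp: local_defining_def)
    then show "norm (U q) = \<kappa>" unfolding UN[OF q ld] using kappa by simp
  qed (use op p u3 f_C1 F_prim F_nonpos eq kappa Uc Ueq uc u_bdd pos dir F0 in auto)
  obtain q0 where q0: "q0 \<in> frontier \<Omega>" using False by blast
  have reg: "W x > 0" if "x \<in> \<Omega>" "P x = c" for x
    by (rule regular_where_P_eq_c[OF F_deg conn(1) q0 that])
  show ?thesis
  proof (cases "\<exists>x0\<in>\<Omega>. P x0 = c")
    case True
    then obtain x0 where x0: "x0 \<in> \<Omega>" "P x0 = c" by blast
    have const: "P x = c" if "x \<in> \<Omega>" for x by (rule strong_maximum_principle[OF reg conn(1) x0 that])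
    have "parallel_sol \<Omega> u" by (rule P_const_parallel[OF const reg[OF _ const] conn q0])
    then show ?thesis by blast
  next
    case False
    then have less: "P x < c" if "x \<in> \<Omega>" for x using P_le_c[OF that] that by force
    have "(\<exists>H. mean_curv \<Omega> q H) \<and> (\<forall>H. mean_curv \<Omega> q H \<longrightarrow> H < 0)" if q: "q \<in> frontier \<Omega>" for q
    proof
      obtain r \<phi> where ld: "local_defining 1 \<Omega> q r \<phi>" using ldex[OF q] by blast
      obtain k a b s \<gamma> where "graph_boundary \<Omega> U Hb q k a b s \<gamma>"
        using gex[OF q ld] by blast
      from graph_boundary.local_defining_2[OF this]
      \<comment> \<open>\<open>mean_curv\<close> is a relation; some C^2 defining function must
        exist, or the sign statement for all \<open>H\<close> would be empty.\<close>
      show "\<exists>H. mean_curv \<Omega> q H" unfolding mean_curv_def by blast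
    next
      show "\<forall>H. mean_curv \<Omega> q H \<longrightarrow> H < 0"
      proof (intro allI impI)
        fix H assume "mean_curv \<Omega> q H"
        then obtain r \<phi> where ld2: "local_defining 2 \<Omega> q r \<phi>"
          and H: "H = divg (\<lambda>x. (1 / norm (grad \<phi> x)) *\<^sub>R grad \<phi> x) q / (real CARD('n) - 1)"
          unfolding mean_curv_def by blast
        have ld: "local_defining 1 \<Omega> q r \<phi>" by (rule local_defining_mono[OF ld2]) simp
        have n0: "grad \<phi> q \<noteq> 0" using ld by (auto simp: local_defining_def)
        \<comment> \<open>The graph is rebuilt from the given \<open>\<phi>\<close>, so that along
          it \<open>U\<close> is -\<kappa> times the very normal field whose divergence defines
          \<open>H\<close>.\<close>
        obtain k a b s \<gamma> where gb: "graph_boundary \<Omega> U Hb q k a b s \<gamma>"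
          and Ug: "\<And>x. norm (put k x (q $ k) - q) < a \<Longrightarrow> U (put k x (\<gamma> x)) = - \<kappa> *\<^sub>R ((1 / norm (grad \<phi> (put k x (\<gamma> x)))) *\<^sub>R grad \<phi> (put k x (\<gamma> x)))"
          using gex[OF q ld] by blast
        interpret gb: graph_boundary \<Omega> U Hb q k a b s \<gamma> by (rule gb)
        have "grad \<phi> q \<bullet> U q < 0"
          unfolding UN[OF q ld] using n0 kappa by (simp add: dot_square_norm power2_eq_square)
        then obtain t1 where t1: "t1 > 0" "\<And>t. 0 < t \<Longrightarrow> t < t1 \<Longrightarrow> q + t *\<^sub>R U q \<in> \<Omega>"
          using local_defining_ray[OF ld _ op q] by blast
        have tr: "trace (Hb q) - ((Hb q *v U q) \<bullet> U q) / \<kappa>\<^sup>2 > 0"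
          by (rule hopf_tangential_trace[OF q less t1 Hc Heq])
        obtain N where N: "((\<lambda>x. (1 / norm (grad \<phi> x)) *\<^sub>R grad \<phi> x) has_derivative N) (at q)"
          "\<And>h. (1 / norm (grad \<phi> q)) *\<^sub>R grad \<phi> q \<bullet> N h = 0"
          using unit_normal_derivative(1)[OF ld2] by blast
        have "divg (\<lambda>x. (1 / norm (grad \<phi> x)) *\<^sub>R grad \<phi> x) q < 0"
          by (rule gb.divg_normal_neg[OF N unit_normal_derivative(2)[OF ld2] _ kappa tr])
             (simp only: gb.cyl_def gb.R_def gb.G_def mem_Collect_eq Ug)
        then show "H < 0" unfolding H using n2 by (intro divide_neg_pos) auto
      qed
    qed
    then show ?thesis by blast
  qed
qed

end
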